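(* Let $\alpha$ be an indeterminate and $\Lambda$ the algebra of symmetric functions over $\mathbb{Q}(\alpha)$ in $x_1,x_2,\ldots$, with the bilinear form $\langle p_\lambda,p_\mu\rangle=\alpha^{\ell(\lambda)}z_\lambda\delta_{\lambda\mu}$. Let $A^{(1)},A^{(2)},\ldots$ be the Sekiguchi–Debiard operators at infinity acting on $\Lambda$ (defined in the context). Then for each $k=1,2,\ldots$, $$A^{(k)}=(-1)^k\sum_{\ell(\lambda)=k}c_\lambda\, m_\lambda\, m_\lambda^{\ast},$$ where $\lambda$ ranges over all partitions of length $k$ (on any given element of $\Lambda$ only finitely many terms of the sum act nontrivially).
   Context: Partitions: for a partition $\lambda$, $\ell(\lambda)$ is the number of nonzero parts; if $k_r$ is the multiplicity of the part $r$ then $c_\lambda=k_1!\,k_2!\cdots$ and $z_\lambda=1^{k_1}k_1!\,2^{k_2}k_2!\cdots$. Let $\Lambda_N$ be the algebra of symmetric polynomials in $x_1,\dots,x_N$ over $\mathbb{Q}(\alpha)$, $\rho_N:\Lambda_N\to\Lambda_{N-1}$ the homomorphism $x_N\mapsto 0$ ($\Lambda_0=\mathbb{Q}(\alpha)$), and $\Lambda$ the inverse limit of $\Lambda_1\leftarrow\Lambda_2\leftarrow\cdots$ in graded algebras, with projections $\pi_N:\Lambda\to\Lambda_N$ (setting $x_{N+1}=x_{N+2}=\dots=0$). $m_\lambda\in\Lambda$ is the monomial symmetric function (the limit of the sums of all distinct monomials obtained by permuting variables in $x_1^{\lambda_1}x_2^{\lambda_2}\cdots$), $m_\emptyset=1$;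 $p_n=x_1^n+x_2^n+\cdots$, $p_\lambda=p_{\lambda_1}p_{\lambda_2}\cdots$. For $f\in\Lambda$, $f^\ast$ is the operator adjoint to multiplication by $f$ with respect to $\langle\,,\rangle$. Sekiguchi–Debiard operators: with $\Delta(x_1,\dots,x_N)=\prod_{i<j}(x_i-x_j)$, $\partial_i=\partial/\partial x_i$ and $u$ a variable, put $$S_N(u)=\Delta(x_1,\dots,x_N)^{-1}\sum_{\sigma\in S_N}(-1)^\sigma\prod_{i=1}^N x_i^{N-\sigma(i)}\big(u+\sigma(i)-1-\alpha x_i\partial_i\big),$$ a polynomial in $u$ of degree $N$ whose coefficients are pairwise commuting operators preserving $\Lambda_N$. Writing $(u)_k=u(u+1)\cdots(u+k-1)$, $(u)_0=1$, expand uniquely $S_N(u)/(u)_N=\sum_{k=0}^N A_N^{(k)}/(u)_k$ with operators $A_N^{(k)}$ on $\Lambda_N$ (set $A_N^{(k)}=0$ for $k>N$). It is known that $\rho_N A_N^{(k)}=A_{N-1}^{(k)}\rho_N$ for all $N,k$, so there are unique linear operators $A^{(k)}$ on $\Lambda$ with $\pi_N A^{(k)}=A_N^{(k)}\pi_N$ for all $N\ge1$; these are the Sekiguchi–Debiard operators at infinity, and $A(u)=1+\sum_{k\ge1}A^{(k)}/(u)_k$. *)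

theory Defs
  imports
    "HOL-Library.Poly_Mapping"
    "HOL-Library.Multiset"
    "HOL-Computational_Algebra.Polynomial"
    "HOL-Computational_Algebra.Fraction_Field"
    "HOL-Combinatorics.Permutations"
begin

section \<open>Polynomials over the field of rational functions in alpha\<close>

type_synonym ratfun = "rat poly fract"

definition alpha :: ratfun where
  "alpha = Fract [:0, 1:] 1"

text \<open>
  A polynomial is a finitely supported map from exponent vectors to coefficients. The variables
  are \<open>X i\<close> for \<open>i :: nat\<close>; the first \<open>N\<close> variables are those with \<open>1 \<le> i \<le> N\<close>.
\<close>

type_synonym mpoly = "(nat \<Rightarrow>\<^sub>0 nat) \<Rightarrow>\<^sub>0 ratfun"

definition X :: "nat \<Rightarrow> mpoly" where
  "X i = Poly_Mapping.single (Poly_Mapping.single i 1) 1"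

definition const :: "ratfun \<Rightarrow> mpoly" where
  "const c = Poly_Mapping.single 0 c"

definition mon_subst :: "(nat \<Rightarrow> mpoly) \<Rightarrow> (nat \<Rightarrow>\<^sub>0 nat) \<Rightarrow> mpoly" where
  "mon_subst s m = (\<Prod>i\<in>Poly_Mapping.keys m. s i ^ Poly_Mapping.lookup m i)"

definition subst :: "(nat \<Rightarrow> mpoly) \<Rightarrow> mpoly \<Rightarrow> mpoly" where
  "subst s p = (\<Sum>m\<in>Poly_Mapping.keys p. const (Poly_Mapping.lookup p m) * mon_subst s m)"

definition mdeg :: "(nat \<Rightarrow>\<^sub>0 nat) \<Rightarrow> nat" where
  "mdeg m = (\<Sum>i\<in>Poly_Mapping.keys m. Poly_Mapping.lookup m i)"

definition partial_deriv :: "nat \<Rightarrow> mpoly \<Rightarrow> mpoly" where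
  "partial_deriv i p =
     (\<Sum>m\<in>Poly_Mapping.keys p.
        Poly_Mapping.single (m - Poly_Mapping.single i 1)
          (of_nat (Poly_Mapping.lookup m i) * Poly_Mapping.lookup p m))"

lemma keys_multE:
  fixes p q :: mpoly
  assumes "m \<in> Poly_Mapping.keys (p * q)"
  obtains a b where "a \<in> Poly_Mapping.keys p" "b \<in> Poly_Mapping.keys q" "m = a + b"
  using assms keys_mult[of p q] by blast

lemma keys_add_nat: "Poly_Mapping.keys (a + b) = Poly_Mapping.keys a \<union> Poly_Mapping.keys b"
  for a b :: "nat \<Rightarrow>\<^sub>0 nat"
  by (auto simp: in_keys_iff lookup_add)

lemma mdeg_superset:
  assumes "finite A" "Poly_Mapping.keys m \<subseteq> A"
  shows "mdeg m = (\<Sum>i\<in>A. Poly_Mapping.lookup m i)"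
  unfolding mdeg_def
  by (rule sum.mono_neutral_left) (use assms in \<open>auto simp: in_keys_iff\<close>)

lemma mdeg_add: "mdeg (a + b) = mdeg a + mdeg b"
proof -
  let ?A = "Poly_Mapping.keys a \<union> Poly_Mapping.keys b"
  have "mdeg (a + b) = (\<Sum>i\<in>?A. Poly_Mapping.lookup (a + b) i)"
    by (rule mdeg_superset) (auto simp: keys_add_nat)
  also have "\<dots> = mdeg a + mdeg b"
    using mdeg_superset[of ?A a] mdeg_superset[of ?A b] by (simp add: lookup_add sum.distrib)
  finally show ?thesis .
qed

lemma mon_subst_superset:
  assumes "finite A" "Poly_Mapping.keys m \<subseteq> A"
  shows "mon_subst s m = (\<Prod>i\<in>A. s i ^ Poly_Mapping.lookup m i)"
  unfolding mon_subst_def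
  by (rule prod.mono_neutral_left) (use assms in \<open>auto simp: in_keys_iff\<close>)

lemma mon_subst_add: "mon_subst s (a + b) = mon_subst s a * mon_subst s b"
proof -
  let ?A = "Poly_Mapping.keys a \<union> Poly_Mapping.keys b"
  have "mon_subst s (a + b) = (\<Prod>i\<in>?A. s i ^ Poly_Mapping.lookup (a + b) i)"
    by (rule mon_subst_superset) (auto simp: keys_add_nat)
  also have "\<dots> = mon_subst s a * mon_subst s b"
    using mon_subst_superset[of ?A a s] mon_subst_superset[of ?A b s]
    by (simp add: lookup_add power_add prod.distrib)
  finally show ?thesis .
qed

lemma const_add: "const (a + b) = const a + const b"
  by (simp add: const_def single_add)

lemma const_mult: "const (a * b) = const a * const b"
  by (simp add: const_def mult_single)

lemma const_0 [simp]: "const 0 = 0" and const_1 [simp]: "const 1 = 1"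
  by (simp_all add: const_def)

lemma subst_superset:
  assumes "finite A" "Poly_Mapping.keys p \<subseteq> A"
  shows "subst s p = (\<Sum>m\<in>A. const (Poly_Mapping.lookup p m) * mon_subst s m)"
  unfolding subst_def
  by (rule sum.mono_neutral_left) (use assms in \<open>auto simp: in_keys_iff\<close>)

lemma subst_0 [simp]: "subst s 0 = 0"
  by (simp add: subst_def)

lemma subst_single: "subst s (Poly_Mapping.single m c) = const c * mon_subst s m"
  by (simp add: subst_def)

lemma subst_const [simp]: "subst s (const c) = const c"
  using subst_single[of s 0 c] by (simp add: mon_subst_def const_def)

lemma subst_1 [simp]: "subst s 1 = 1"
  using subst_const[of s 1] by simp

lemma subst_X [simp]: "subst s (X i) = s i"
  by (simp add: X_def subst_single mon_subst_def)

lemma subst_add: "subst s (p + q) = subst s p + subst s q"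
proof -
  let ?A = "Poly_Mapping.keys p \<union> Poly_Mapping.keys q"
  have "subst s (p + q) =
      (\<Sum>m\<in>?A. const (Poly_Mapping.lookup (p + q) m) * mon_subst s m)"
    using keys_add[of p q] by (intro subst_superset) auto
  also have "\<dots> = subst s p + subst s q"
    using subst_superset[of ?A p s] subst_superset[of ?A q s]
    by (simp add: lookup_add const_add sum.distrib distrib_right)
  finally show ?thesis .
qed

lemma subst_sum: "subst s (sum f A) = (\<Sum>a\<in>A. subst s (f a))"
  by (induction A rule: infinite_finite_induct) (simp_all add: subst_add)

lemma poly_mapping_sum_single:
  fixes p :: mpoly
  shows "p = (\<Sum>m\<in>Poly_Mapping.keys p. Poly_Mapping.single m (Poly_Mapping.lookup p m))"
  by (rule poly_mapping_eqI)
     (simp add: lookup_sum lookup_single when_def in_keys_iff)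

lemma subst_mult: "subst s (p * q) = subst s p * subst s q"
proof -
  let ?l = "Poly_Mapping.lookup"
  have "p * q = (\<Sum>a\<in>Poly_Mapping.keys p. \<Sum>b\<in>Poly_Mapping.keys q.
      Poly_Mapping.single a (?l p a) * Poly_Mapping.single b (?l q b))"
    by (subst poly_mapping_sum_single[of p], subst poly_mapping_sum_single[of q])
       (simp add: sum_product)
  then have "subst s (p * q) = (\<Sum>a\<in>Poly_Mapping.keys p. \<Sum>b\<in>Poly_Mapping.keys q.
      (const (?l p a) * mon_subst s a) * (const (?l q b) * mon_subst s b))"
    by (simp add: subst_sum mult_single subst_single const_mult mon_subst_add mult_ac)
  then show ?thesis
    by (simp add: subst_def sum_product)
qed

lemma subst_uminus: "subst s (- p) = - subst s p"
  using subst_add[of s p "- p"] by (simp add: add_eq_0_iff)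

lemma subst_power: "subst s (p ^ n) = subst s p ^ n"
  by (induction n) (simp_all add: subst_mult)


section \<open>Symmetric polynomials and symmetric functions\<close>

definition sym_polys :: "nat \<Rightarrow> mpoly set" where
  "sym_polys N = {p. (\<forall>m\<in>Poly_Mapping.keys p. Poly_Mapping.keys m \<subseteq> {1..N}) \<and>
                     (\<forall>\<sigma>. \<sigma> permutes {1..N} \<longrightarrow> subst (\<lambda>i. X (\<sigma> i)) p = p)}"

definition rho :: "nat \<Rightarrow> mpoly \<Rightarrow> mpoly" where
  "rho N = subst (X(N := 0))"

definition deg_le :: "nat \<Rightarrow> mpoly \<Rightarrow> bool" where
  "deg_le d p \<longleftrightarrow> (\<forall>m\<in>Poly_Mapping.keys p. mdeg m \<le> d)"

lemma sym_polys_add: "p \<in> sym_polys N \<Longrightarrow> q \<in> sym_polys N \<Longrightarrow> p + q \<in> sym_polys N"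
  using keys_add[of p q] by (auto simp: sym_polys_def subst_add dest!: set_mp)

lemma sym_polys_uminus: "p \<in> sym_polys N \<Longrightarrow> - p \<in> sym_polys N"
  by (auto simp: sym_polys_def subst_uminus in_keys_iff)

lemma sym_polys_mult:
  assumes "p \<in> sym_polys N" "q \<in> sym_polys N"
  shows "p * q \<in> sym_polys N"
proof -
  have "Poly_Mapping.keys m \<subseteq> {1..N}" if "m \<in> Poly_Mapping.keys (p * q)" for m
    using that assms by (elim keys_multE) (simp add: keys_add_nat sym_polys_def)
  then show ?thesis
    using assms by (simp add: sym_polys_def subst_mult)
qed

lemma sym_polys_const: "const c \<in> sym_polys N"
  by (auto simp: sym_polys_def const_def[of c, symmetric]) (auto simp: const_def split: if_splits)

lemma sym_polys_0: "0 \<in> sym_polys N" and sym_polys_1: "1 \<in> sym_polys N"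
  using sym_polys_const[of 0 N] sym_polys_const[of 1 N] by simp_all

lemma deg_le_mono: "deg_le d p \<Longrightarrow> d \<le> e \<Longrightarrow> deg_le e p"
  by (auto simp: deg_le_def)

lemma deg_le_add: "deg_le d p \<Longrightarrow> deg_le d q \<Longrightarrow> deg_le d (p + q)"
  using keys_add[of p q] by (auto simp: deg_le_def dest!: set_mp)

lemma deg_le_uminus: "deg_le d p \<Longrightarrow> deg_le d (- p)"
  by (auto simp: deg_le_def in_keys_iff)

lemma deg_le_mult: "deg_le d p \<Longrightarrow> deg_le e q \<Longrightarrow> deg_le (d + e) (p * q)"
  unfolding deg_le_def by (auto elim!: keys_multE simp: mdeg_add intro!: add_mono)

lemma deg_le_const: "deg_le d (const c)"
  by (auto simp: deg_le_def const_def mdeg_def split: if_splits)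

text \<open>
  The inverse limit in graded algebras: coherent sequences of symmetric polynomials of bounded
  degree. The component with index \<open>0\<close> is a constant determined by the one with index \<open>1\<close>.
\<close>

typedef symfun =
  "{f :: nat \<Rightarrow> mpoly. (\<forall>N. f N \<in> sym_polys N) \<and> (\<forall>N. rho (Suc N) (f (Suc N)) = f N) \<and>
      (\<exists>d. \<forall>N. deg_le d (f N))}"
  morphisms proj_seq Abs_symfun
  by (rule exI[of _ "\<lambda>_. 0"]) (auto simp: sym_polys_0 rho_def deg_le_def)

setup_lifting type_definition_symfun

definition proj :: "nat \<Rightarrow> symfun \<Rightarrow> mpoly" where
  "proj N f = proj_seq f N"

instantiation symfun :: comm_ring_1
begin

lift_definition zero_symfun :: symfun is "\<lambda>_. 0"
  by (auto simp: sym_polys_0 rho_def deg_le_def)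

lift_definition one_symfun :: symfun is "\<lambda>_. 1"
  using deg_le_const[of _ 1] by (auto simp: sym_polys_1 rho_def)

lift_definition plus_symfun :: "symfun \<Rightarrow> symfun \<Rightarrow> symfun" is "\<lambda>f g N. f N + g N"
proof (safe; (simp add: sym_polys_add rho_def subst_add; fail)?)
  fix f g :: "nat \<Rightarrow> mpoly" and d e
  assume "\<forall>N. deg_le d (f N)" "\<forall>N. deg_le e (g N)"
  then have "\<forall>N. deg_le (max d e) (f N + g N)"
    by (meson deg_le_add deg_le_mono max.cobounded1 max.cobounded2)
  then show "\<exists>d. \<forall>N. deg_le d (f N + g N)" ..
qed

lift_definition uminus_symfun :: "symfun \<Rightarrow> symfun" is "\<lambda>f N. - f N"
  by (auto simp: sym_polys_uminus rho_def subst_uminus) (meson deg_le_uminus)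

definition minus_symfun :: "symfun \<Rightarrow> symfun \<Rightarrow> symfun" where
  "minus_symfun f g = f + - g"

lift_definition times_symfun :: "symfun \<Rightarrow> symfun \<Rightarrow> symfun" is "\<lambda>f g N. f N * g N"
  by (auto simp: sym_polys_mult rho_def subst_mult) (meson deg_le_mult)

instance
  by standard
     (unfold minus_symfun_def, (transfer, simp add: fun_eq_iff algebra_simps)+)

end

lift_definition scale :: "ratfun \<Rightarrow> symfun \<Rightarrow> symfun" is "\<lambda>c f N. const c * f N"
  by (auto simp: sym_polys_mult sym_polys_const rho_def subst_mult)
     (meson deg_le_mult deg_le_const)

interpretation symfun: vector_space scale
  by standard (transfer; simp add: fun_eq_iff const_add const_mult algebra_simps)+


section \<open>Partitions, power sums and monomial symmetric functions\<close>

definition is_partition :: "nat multiset \<Rightarrow> bool" where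
  "is_partition \<mu> \<longleftrightarrow> 0 \<notin># \<mu>"

definition c_part :: "nat multiset \<Rightarrow> nat" where
  "c_part \<mu> = (\<Prod>r\<in>set_mset \<mu>. fact (count \<mu> r))"

definition z_part :: "nat multiset \<Rightarrow> nat" where
  "z_part \<mu> = (\<Prod>r\<in>set_mset \<mu>. r ^ count \<mu> r * fact (count \<mu> r))"

lemma keys_X [simp]: "Poly_Mapping.keys (X i) = {Poly_Mapping.single i 1}"
  by (simp add: X_def)

lemma deg_le_X: "deg_le 1 (X i)"
  by (simp add: deg_le_def mdeg_def)

lemma deg_le_X_power: "deg_le n (X i ^ n)"
proof (induction n)
  case 0
  then show ?case using deg_le_const[of 0 1] by simp
next
  case (Suc n)
  then show ?case using deg_le_mult[OF deg_le_X[of i]] by simp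
qed

lemma deg_le_sum: "(\<And>a. a \<in> A \<Longrightarrow> deg_le d (f a)) \<Longrightarrow> deg_le d (sum f A)"
  by (induction A rule: infinite_finite_induct)
     (auto intro: deg_le_add simp: deg_le_const[of _ 0, simplified])

lemma keys_keys_X_power: "m \<in> Poly_Mapping.keys (X i ^ n) \<Longrightarrow> Poly_Mapping.keys m \<subseteq> {i}"
proof (induction n arbitrary: m)
  case (Suc n)
  from Suc.prems obtain a b where "a \<in> Poly_Mapping.keys (X i)"
      "b \<in> Poly_Mapping.keys (X i ^ n)" "m = a + b"
    by (auto elim: keys_multE)
  with Suc.IH[of b] show ?case by (auto simp: keys_add_nat)
qed auto

text \<open>The power sum \<open>p\<^sub>n\<close> is only meant for \<open>n > 0\<close>; for \<open>n = 0\<close> the sums are not coherent.\<close>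

lift_definition powersum :: "nat \<Rightarrow> symfun" is
  "\<lambda>n N. if n = 0 then 0 else \<Sum>i\<in>{1..N}. X i ^ n"
proof -
  fix n :: nat
  let ?f = "\<lambda>N. if n = 0 then 0 else \<Sum>i\<in>{1..N}. X i ^ n"
  have "?f N \<in> sym_polys N" for N
  proof (cases "n = 0")
    case False
    have "Poly_Mapping.keys m \<subseteq> {1..N}"
      if m: "m \<in> Poly_Mapping.keys (\<Sum>i\<in>{1..N}. X i ^ n)" for m
    proof -
      from subsetD[OF keys_sum m] obtain i where "i \<in> {1..N}" "m \<in> Poly_Mapping.keys (X i ^ n)"
        by (elim UN_E)
      with keys_keys_X_power[of m i n] show ?thesis by auto
    qed
    moreover have "subst (\<lambda>i. X (\<sigma> i)) (\<Sum>i\<in>{1..N}. X i ^ n) = (\<Sum>i\<in>{1..N}. X i ^ n)"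
      if "\<sigma> permutes {1..N}" for \<sigma>
      by (simp add: subst_sum subst_power sum.permute[OF that, of "\<lambda>i. X i ^ n", unfolded o_def, symmetric]
          del: One_nat_def)
    ultimately show ?thesis using False by (auto simp: sym_polys_def)
  qed (simp add: sym_polys_0)
  moreover have "rho (Suc N) (?f (Suc N)) = ?f N" for N
    by (simp add: rho_def subst_sum subst_power subst_add)
  moreover have "deg_le n (?f N)" for N
    by (auto intro!: deg_le_sum deg_le_X_power simp: deg_le_const[of _ 0, simplified])
  ultimately show "(\<forall>N. ?f N \<in> sym_polys N) \<and> (\<forall>N. rho (Suc N) (?f (Suc N)) = ?f N) \<and>
      (\<exists>d. \<forall>N. deg_le d (?f N))" by blast
qed

definition powersum_part :: "nat multiset \<Rightarrow> symfun" where
  "powersum_part \<mu> = (\<Prod>r\<in>#\<mu>. powersum r)"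

text \<open>
  The distinct monomials arising from \<open>x\<^sub>1\<^bsup>\<mu>\<^sub>1\<^esup> x\<^sub>2\<^bsup>\<mu>\<^sub>2\<^esup> \<cdots>\<close> by permuting \<open>x\<^sub>1, \<dots>, x\<^sub>N\<close> are those
  whose multiset of nonzero exponents is \<open>\<mu>\<close>; there are none if \<open>N\<close> is smaller than the length.
\<close>

definition mon_exps :: "nat \<Rightarrow> nat multiset \<Rightarrow> (nat \<Rightarrow>\<^sub>0 nat) set" where
  "mon_exps N \<mu> = {m. Poly_Mapping.keys m \<subseteq> {1..N} \<and>
      image_mset (Poly_Mapping.lookup m) (mset_set (Poly_Mapping.keys m)) = \<mu>}"

lemma image_mset_perm:
  assumes "\<sigma> permutes {1..N}" "m \<in> mon_exps N \<mu>"
  shows "Poly_Mapping.map_key (inv \<sigma>) m \<in> mon_exps N \<mu>"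
proof -
  let ?m = "Poly_Mapping.map_key (inv \<sigma>) m"
  have inj: "inj (inv \<sigma>)" and bij: "bij \<sigma>"
    using permutes_inj[OF permutes_inv[OF assms(1)]] permutes_bij[OF assms(1)] by blast+
  have keys: "Poly_Mapping.keys ?m = \<sigma> ` Poly_Mapping.keys m"
    using keys_map_key[OF inj, of m] bij by (simp add: bij_vimage_eq_inv_image bij_imp_bij_inv inv_inv_eq)
  have lookup: "Poly_Mapping.lookup ?m (\<sigma> i) = Poly_Mapping.lookup m i" for i
    using inj bij by (simp add: map_key.rep_eq bij_is_inj)
  have "\<sigma> ` Poly_Mapping.keys m \<subseteq> {1..N}"
    using assms permutes_in_image[OF assms(1)] by (auto simp: mon_exps_def)
  moreover have "image_mset (Poly_Mapping.lookup ?m) (mset_set (\<sigma> ` Poly_Mapping.keys m)) =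
      image_mset (Poly_Mapping.lookup m) (mset_set (Poly_Mapping.keys m))"
    using inj_on_subset[OF bij_is_inj[OF bij]]
    by (subst image_mset_mset_set[symmetric]) (auto simp: lookup multiset.map_comp o_def)
  ultimately show ?thesis using assms(2) by (simp add: mon_exps_def keys)
qed

lemma mon_subst_X: "mon_subst X m = Poly_Mapping.single m 1"
proof -
  have pow: "X i ^ n = Poly_Mapping.single (Poly_Mapping.single i n) 1" for i n
    by (induction n) (simp_all add: X_def mult_single single_add[symmetric])
  have "(\<Prod>i\<in>A. X i ^ Poly_Mapping.lookup m i) =
      Poly_Mapping.single (\<Sum>i\<in>A. Poly_Mapping.single i (Poly_Mapping.lookup m i)) 1" for A
    by (induction A rule: infinite_finite_induct) (simp_all add: pow mult_single)
  moreover have "(\<Sum>i\<in>Poly_Mapping.keys m. Poly_Mapping.single i (Poly_Mapping.lookup m i)) = m"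
    by (rule poly_mapping_eqI) (simp add: lookup_sum lookup_single when_def in_keys_iff)
  ultimately show ?thesis by (simp add: mon_subst_def)
qed

lemma mon_subst_perm:
  assumes "\<sigma> permutes {1..N}"
  shows "mon_subst (\<lambda>i. X (\<sigma> i)) m = Poly_Mapping.single (Poly_Mapping.map_key (inv \<sigma>) m) 1"
proof -
  let ?m = "Poly_Mapping.map_key (inv \<sigma>) m"
  have inj: "inj (inv \<sigma>)" and bij: "bij \<sigma>"
    using permutes_inj[OF permutes_inv[OF assms]] permutes_bij[OF assms] by blast+
  have keys: "Poly_Mapping.keys ?m = \<sigma> ` Poly_Mapping.keys m"
    using keys_map_key[OF inj, of m] bij by (simp add: bij_vimage_eq_inv_image bij_imp_bij_inv inv_inv_eq)
  have "mon_subst X ?m = (\<Prod>i\<in>Poly_Mapping.keys m. X (\<sigma> i) ^ Poly_Mapping.lookup ?m (\<sigma> i))"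
    unfolding mon_subst_def keys using inj_on_subset[OF bij_is_inj[OF bij]]
    by (subst prod.reindex) auto
  also have "\<dots> = mon_subst (\<lambda>i. X (\<sigma> i)) m"
    using inj bij by (simp add: mon_subst_def map_key.rep_eq bij_is_inj)
  finally show ?thesis by (simp add: mon_subst_X)
qed

lemma mon_exps_mdeg: "m \<in> mon_exps N \<mu> \<Longrightarrow> mdeg m = sum_mset \<mu>"
  by (auto simp: mon_exps_def mdeg_def sum_unfold_sum_mset)

lemma finite_mon_exps: "finite (mon_exps N \<mu>)"
proof (rule finite_imageD[where f = Poly_Mapping.lookup])
  let ?F = "{f. \<forall>i. (i \<in> {1..N} \<longrightarrow> f i \<in> insert 0 (set_mset \<mu>)) \<and> (i \<notin> {1..N} \<longrightarrow> f i = 0)}"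
  have "Poly_Mapping.lookup m \<in> ?F" if m: "m \<in> mon_exps N \<mu>" for m
  proof -
    have "Poly_Mapping.lookup m i \<in> set_mset \<mu>" if "Poly_Mapping.lookup m i \<noteq> 0" for i
      using m that by (auto simp: mon_exps_def in_keys_iff)
    moreover have "Poly_Mapping.lookup m i = 0" if "i \<notin> {1..N}" for i
      proof (rule ccontr)
      assume "Poly_Mapping.lookup m i \<noteq> 0"
      then have "i \<in> Poly_Mapping.keys m" by (simp add: in_keys_iff)
      then show False using m that by (auto simp: mon_exps_def)
    qed
    ultimately show ?thesis by auto
  qed
  then have "Poly_Mapping.lookup ` mon_exps N \<mu> \<subseteq> ?F"
    by (rule image_subsetI)
  moreover have "finite ?F"
    by (intro finite_set_of_finite_funs) auto
  ultimately show "finite (Poly_Mapping.lookup ` mon_exps N \<mu>)"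
    by (rule finite_subset)
  show "inj_on Poly_Mapping.lookup (mon_exps N \<mu>)"
  proof (rule inj_onI)
    fix a b :: "nat \<Rightarrow>\<^sub>0 nat"
    assume "Poly_Mapping.lookup a = Poly_Mapping.lookup b"
    then show "a = b" by (rule lookup_inject[THEN iffD1])
  qed
qed

lift_definition monomial_sym :: "nat multiset \<Rightarrow> symfun" is
  "\<lambda>\<mu> N. \<Sum>m\<in>mon_exps N \<mu>. Poly_Mapping.single m 1"
proof -
  fix \<mu> :: "nat multiset"
  let ?f = "\<lambda>N. \<Sum>m\<in>mon_exps N \<mu>. Poly_Mapping.single m 1 :: mpoly"
  have keys: "Poly_Mapping.keys (?f N) \<subseteq> mon_exps N \<mu>" for N
    using keys_sum[of "\<lambda>m. Poly_Mapping.single m 1 :: mpoly" "mon_exps N \<mu>"] by auto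
  have "?f N \<in> sym_polys N" for N
  proof -
    have "subst (\<lambda>i. X (\<sigma> i)) (?f N) = ?f N" if \<sigma>: "\<sigma> permutes {1..N}" for \<sigma>
    proof -
      have inj: "inj (inv \<sigma>)"
        by (rule permutes_inj[OF permutes_inv[OF \<sigma>]])
      have inj': "inj_on (Poly_Mapping.map_key (inv \<sigma>)) (mon_exps N \<mu>)"
      proof (rule inj_onI, rule poly_mapping_eqI)
        fix a b :: "nat \<Rightarrow>\<^sub>0 nat" and i
        assume eq: "Poly_Mapping.map_key (inv \<sigma>) a = Poly_Mapping.map_key (inv \<sigma>) b"
        have "Poly_Mapping.lookup (Poly_Mapping.map_key (inv \<sigma>) c) (\<sigma> i) =
            Poly_Mapping.lookup c i" for c :: "nat \<Rightarrow>\<^sub>0 nat"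
          using inj permutes_inverses(2)[OF \<sigma>] by (simp add: map_key.rep_eq)
        from this[of a] this[of b] show "Poly_Mapping.lookup a i = Poly_Mapping.lookup b i"
          by (simp add: eq)
      qed
      have "Poly_Mapping.map_key (inv \<sigma>) ` mon_exps N \<mu> = mon_exps N \<mu>"
        by (rule endo_inj_surj[OF finite_mon_exps _ inj']) (use image_mset_perm[OF \<sigma>] in blast)
      then have "bij_betw (Poly_Mapping.map_key (inv \<sigma>)) (mon_exps N \<mu>) (mon_exps N \<mu>)"
        using inj' by (simp add: bij_betw_def)
      then show ?thesis
        using sum.reindex_bij_betw[of "Poly_Mapping.map_key (inv \<sigma>)" "mon_exps N \<mu>" "mon_exps N \<mu>"
            "\<lambda>m. Poly_Mapping.single m 1 :: mpoly"]
        by (simp add: subst_sum subst_single mon_subst_perm[OF \<sigma>])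
    qed
    moreover have "Poly_Mapping.keys m \<subseteq> {1..N}" if "m \<in> Poly_Mapping.keys (?f N)" for m
      using that keys[of N] by (auto simp: mon_exps_def)
    ultimately show ?thesis by (simp add: sym_polys_def)
  qed
  moreover have "rho (Suc N) (?f (Suc N)) = ?f N" for N
  proof -
    have *: "mon_subst (X(Suc N := 0)) m =
        (if m \<in> mon_exps N \<mu> then Poly_Mapping.single m 1 else 0)"
      if m: "m \<in> mon_exps (Suc N) \<mu>" for m
    proof (cases "Suc N \<in> Poly_Mapping.keys m")
      case True
      then have "m \<notin> mon_exps N \<mu>" by (auto simp: mon_exps_def)
      with True show ?thesis by (auto simp: mon_subst_def in_keys_iff intro!: bexI[of _ "Suc N"])
    next
      case False
      with m have "m \<in> mon_exps N \<mu>"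
        by (auto simp: mon_exps_def atLeastAtMostSuc_conv)
      moreover have "mon_subst (X(Suc N := 0)) m = mon_subst X m"
        unfolding mon_subst_def using False by (intro prod.cong) auto
      ultimately show ?thesis by (simp add: mon_subst_X)
    qed
    have "rho (Suc N) (?f (Suc N)) =
        (\<Sum>m\<in>mon_exps (Suc N) \<mu>. if m \<in> mon_exps N \<mu> then Poly_Mapping.single m 1 else 0)"
      by (simp add: rho_def subst_sum subst_single *)
    also have "\<dots> = ?f N"
    proof -
      have "mon_exps (Suc N) \<mu> \<inter> mon_exps N \<mu> = mon_exps N \<mu>"
        by (auto simp: mon_exps_def)
      then show ?thesis
        by (simp add: sum.inter_restrict[OF finite_mon_exps, symmetric])
    qed
    finally show ?thesis .
  qed
  moreover have "deg_le (sum_mset \<mu>) (?f N)" for N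
    unfolding deg_le_def
  proof
    fix m assume "m \<in> Poly_Mapping.keys (?f N)"
    then have "m \<in> mon_exps N \<mu>" by (rule subsetD[OF keys])
    then show "mdeg m \<le> sum_mset \<mu>" by (simp add: mon_exps_mdeg)
  qed
  ultimately show "(\<forall>N. ?f N \<in> sym_polys N) \<and> (\<forall>N. rho (Suc N) (?f (Suc N)) = ?f N) \<and>
      (\<exists>d. \<forall>N. deg_le d (?f N))" by (intro conjI allI exI[of _ "sum_mset \<mu>"])
qed


section \<open>The bilinear form and adjoints\<close>

definition bilinear_form :: "(symfun \<Rightarrow> symfun \<Rightarrow> ratfun) \<Rightarrow> bool" where
  "bilinear_form B \<longleftrightarrow>
     (\<forall>f. Vector_Spaces.linear scale (*) (B f)) \<and>
     (\<forall>g. Vector_Spaces.linear scale (*) (\<lambda>f. B f g))"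

text \<open>The form is unique because the \<open>powersum_part \<mu>\<close> form a basis.\<close>

definition jack_form :: "symfun \<Rightarrow> symfun \<Rightarrow> ratfun" where
  "jack_form = (THE B. bilinear_form B \<and>
     (\<forall>\<mu> \<nu>. is_partition \<mu> \<longrightarrow> is_partition \<nu> \<longrightarrow>
        B (powersum_part \<mu>) (powersum_part \<nu>) =
          (if \<mu> = \<nu> then alpha ^ size \<mu> * of_nat (z_part \<mu>) else 0)))"

definition adjoint_op :: "symfun \<Rightarrow> symfun \<Rightarrow> symfun" where
  "adjoint_op f = (THE T. \<forall>g h. jack_form (T g) h = jack_form g (f * h))"


section \<open>Sekiguchi-Debiard operators\<close>

text \<open>
  The variable \<open>u\<close> is the indeterminate of \<open>mpoly poly\<close>; the operators take values in the
  fraction field of this ring.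
\<close>

definition vandermonde :: "nat \<Rightarrow> mpoly" where
  "vandermonde N = (\<Prod>j\<in>{1..N}. \<Prod>i\<in>{1..<j}. X i - X j)"

definition u_frac :: "mpoly poly fract" where
  "u_frac = Fract [:0, 1:] 1"

text \<open>The operator \<open>x\<^sub>i\<^bsup>N - s\<^esup> (u + s - 1 - \<alpha> x\<^sub>i \<partial>\<^sub>i)\<close>, acting coefficientwise in \<open>u\<close>.\<close>

definition SD_factor :: "nat \<Rightarrow> nat \<Rightarrow> nat \<Rightarrow> mpoly poly \<Rightarrow> mpoly poly" where
  "SD_factor N s i g =
     [:X i ^ (N - s):] *
       ([:of_nat s - 1, 1:] * g - map_poly (\<lambda>h. const alpha * X i * partial_deriv i h) g)"

definition SD_op :: "nat \<Rightarrow> mpoly \<Rightarrow> mpoly poly fract" where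
  "SD_op N f = inverse (Fract [:vandermonde N:] 1) *
     (\<Sum>\<sigma> | \<sigma> permutes {1..N}.
        Fract (of_int (sign \<sigma>) * foldr (\<lambda>i. SD_factor N (\<sigma> i) i) [1..<Suc N] [:f:]) 1)"

definition SD_coeffs :: "nat \<Rightarrow> mpoly \<Rightarrow> nat \<Rightarrow> mpoly" where
  "SD_coeffs N f = (THE a. (\<forall>k. a k \<in> sym_polys N) \<and> (\<forall>k>N. a k = 0) \<and>
     SD_op N f / pochhammer u_frac N = (\<Sum>k\<le>N. Fract [:a k:] 1 / pochhammer u_frac k))"

definition SD_coeff :: "nat \<Rightarrow> nat \<Rightarrow> mpoly \<Rightarrow> mpoly" where
  "SD_coeff k N f = SD_coeffs N f k"

definition SD_infinity :: "nat \<Rightarrow> symfun \<Rightarrow> symfun" where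
  "SD_infinity k = (THE A. Vector_Spaces.linear scale scale A \<and>
     (\<forall>N\<ge>1. \<forall>f. proj N (A f) = SD_coeff k N (proj N f)))"

end

(*
  Let p_n^* be the adjoint of multiplication by p_n. On symmetric functions restricted to N variables,
  alpha x_i d_i acts as q_i = sum_n x_i^n p_n^*, so S_N(u) acts as the determinant of
  x_i^(N-j) (u + j - 1 - q_i) divided by Delta, with commuting entries.
  For a set I of variables put E_I = sum x^m (c_l m_l)^*, over the exponents m with support I,
  where l is the type of m. The rule
    p_n (c_l m_l) = c_(l,n) m_(l,n) + sum_a c_(l-a,a+n) m_(l-a,a+n)
  yields, for i not in I,
    q_i E_I = E_(I+i) + sum_(a in I) (x_i E_I - x_a E_(I-a+i)) / (x_a - x_i).
  Expanding the determinant along its first column, induction on N gives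
    S_N(u) = sum_I (-1)^|I| (u+|I|)_(N-|I|) E_I.
  The inductive step is a rational function identity for the weights
  w_i = x_i^(N-1) / prod_(j /= i) (x_i - x_j). Finally sum_(|I|=k) E_I is the restriction of
  sum_(l(mu)=k) c_mu m_mu m_mu^* to N variables.
*)
theory Submission
  imports Defs "HOL-Computational_Algebra.Polynomial_Factorial"
begin

text \<open>On the reproducing kernel of the form, p_n^* acts as multiplication by p_n(y). There q_i
  is the sum over j of x_i y_j / (1 - x_i y_j), and E_I the sum of such products over injective
  choices of one j for each element of I. In q_i E_I a fresh j gives E_(I+i), while reusing the y of
  a gives two fractions in one variable; their partial fraction decomposition has the denominator
  x_a - x_i and exchanges a for i. The kernel itself stays in the background: sums are cut at a
  degree bound D, and the decomposition becomes a finite telescoping sum. Adjoints live on \<Lambda>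
  and not on polynomials in N variables, and a single E_I f is not symmetric. So E_I f multiplies
  monomials by projections of adjoints taken in \<Lambda>. The column expansion works because the
  minor without row b contains x_b only through these projections, where q_b is known. The form is
  prescribed on power sums, so these must be a basis; the product rule for p_n, triangular in the
  number of parts, also yields this. Finally (u+k)_(N-k) / (u)_N = 1 / (u)_k turns the sum over |I|
  = k into the coefficient sought.\<close>

section \<open>Interpolation identities\<close>

lemma pderiv_sum: "pderiv (sum f A) = (\<Sum>a\<in>A. pderiv (f a))"
  by (induction A rule: infinite_finite_induct) (simp_all add: pderiv_add)

text \<open>With n nodes, the n-th power minus the monic polynomial vanishing on them has degree
  below n, so it is its own Lagrange interpolant; its values at the nodes are the powers
  \<open>x i ^ card T\<close>.\<close>

lemma power_interpolation:
  fixes x :: "'i \<Rightarrow> 'a::field"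
  assumes fin: "finite T" and inj: "inj_on x T"
  shows "monom 1 (card T) = (\<Prod>j\<in>T. [:- x j, 1:]) +
    (\<Sum>i\<in>T. smult (x i ^ card T / (\<Prod>j\<in>T - {i}. x i - x j)) (\<Prod>j\<in>T - {i}. [:- x j, 1:]))"
    (is "?m = ?Q + ?R")
proof -
  define n where "n = card T"
  define c where "c i = x i ^ card T / (\<Prod>j\<in>T - {i}. x i - x j)" for i
  have dQ: "degree ?Q = n"
    by (simp add: degree_prod_eq_sum_degree n_def)
  have lQ: "coeff ?Q n = 1"
    using lead_coeff_prod[of "\<lambda>j. [:- x j, 1:]" T] unfolding dQ by simp
  show ?thesis
  proof (cases "T = {}")
    case True then show ?thesis by simp
  next
    case False
    then have n0: "n > 0" using fin by (simp add: n_def card_gt_0_iff)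
    have dm: "degree (?m - ?Q) < n"
    proof -
      have "coeff (?m - ?Q) i = 0" if "i \<ge> n" for i
        using that dQ lQ by (cases "i = n") (auto simp: n_def[symmetric] coeff_eq_0)
      then show ?thesis using n0 
        by (metis degree_0 leading_coeff_0_iff linorder_not_less)
    qed
    have dR: "degree ?R < n"
    proof -
      have "degree (smult (c i) (\<Prod>j\<in>T - {i}. [:- x j, 1:])) \<le> n - 1" if "i \<in> T" for i
        using that fin degree_smult_le[of "c i" "\<Prod>j\<in>T - {i}. [:- x j, 1:]"]
        by (simp add: degree_prod_eq_sum_degree n_def)
      then have "degree ?R \<le> n - 1" unfolding c_def[symmetric]
        by (intro degree_sum_le fin)
      then show ?thesis using n0 by simp
    qed
    have "?m - ?Q = ?R"
    proof (rule poly_eqI_degree[of "x ` T"])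
      show "degree (?m - ?Q) < card (x ` T)" "degree ?R < card (x ` T)"
        using dm dR card_image[OF inj] by (simp_all add: n_def)
      fix z assume "z \<in> x ` T"
      then obtain k where k: "k \<in> T" "z = x k" by auto
      have "poly ?Q z = 0" using k fin by (auto simp: poly_prod)
      have "poly ?R z = (\<Sum>i\<in>T. c i * (\<Prod>j\<in>T - {i}. x k - x j))"
        by (simp add: poly_sum poly_prod k c_def)
      also have "\<dots> = (\<Sum>i\<in>T. if i = k then x k ^ card T else 0)"
      proof (rule sum.cong)
        fix i assume i: "i \<in> T"
        show "c i * (\<Prod>j\<in>T - {i}. x k - x j) = (if i = k then x k ^ card T else 0)"
        proof (cases "i = k")
          case True
          have "(\<Prod>j\<in>T - {k}. x k - x j) \<noteq> 0"
            using fin k inj by (auto simp: inj_on_def)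
          with True show ?thesis by (simp add: c_def)
        next
          case False
          with k fin show ?thesis by auto
        qed
      qed simp
      also have "\<dots> = x k ^ card T" using fin k by simp
      finally show "poly (?m - ?Q) z = poly ?R z"
        using \<open>poly ?Q z = 0\<close> k by (simp add: poly_monom)
    qed
    then show ?thesis by (simp add: algebra_simps)
  qed
qed

text \<open>These terms are left when the Vandermonde determinant is expanded along its column of
  highest powers and then divided by itself; hence they sum to 1.\<close>

definition lag_weight :: "('i \<Rightarrow> 'a::field) \<Rightarrow> 'i set \<Rightarrow> 'i \<Rightarrow> 'a" where
  "lag_weight x S i = x i ^ (card S - 1) / (\<Prod>j\<in>S - {i}. x i - x j)"

text \<open>Both identities come from \<open>power_interpolation\<close> on \<open>T\<close>: the first by evaluating at \<open>x a\<close>,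
  the second by evaluating the derivative there.\<close>

lemma lag_weight_insert:
  fixes x :: "'i \<Rightarrow> 'a::field"
  assumes fin: "finite T" and inj: "inj_on x (insert a T)" and a: "a \<notin> T"
  shows "lag_weight x (insert a T) a = 1 - (\<Sum>i\<in>T. lag_weight x (insert a T) i)"
    and "(\<Sum>i\<in>T. (lag_weight x (insert a T) i * x a + lag_weight x (insert a T) a * x i) / (x i - x a)) = 0"
proof -
  define n where "n = card T"
  define z where "z = x a"
  define w where "w = lag_weight x (insert a T)"
  define c where "c i = x i ^ n / (\<Prod>j\<in>T - {i}. x i - x j)" for i
  define Q where "Q = (\<Prod>j\<in>T. z - x j)"
  define T1 where "T1 = (\<Sum>j\<in>T. 1 / (z - x j))"
  have ne: "z - x i \<noteq> 0" "x i - z \<noteq> 0" if "i \<in> T" for i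
    using that inj a by (auto simp: inj_on_def z_def)
  have Q0: "Q \<noteq> 0" using ne fin by (auto simp: Q_def)
  have inj': "inj_on x T" using inj by (rule inj_on_subset) auto
  have Qi: "(\<Prod>j\<in>T - {i}. z - x j) = Q / (z - x i)" if "i \<in> T" for i
    using that fin ne[OF that] by (simp add: Q_def prod.remove[of T i] field_simps)
  have Qij: "(\<Prod>j\<in>T - {i} - {k}. z - x j) = Q / ((z - x i) * (z - x k))"
    if "i \<in> T" "k \<in> T" "k \<noteq> i" for i k
  proof -
    have "(z - x k) * (\<Prod>j\<in>T - {i} - {k}. z - x j) = Q / (z - x i)"
      using that fin Qi[of i] by (simp add: prod.remove[of "T - {i}" k])
    then have "(\<Prod>j\<in>T - {i} - {k}. z - x j) = Q / (z - x i) / (z - x k)"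
      by (metis nonzero_mult_div_cancel_left ne(1) that(2))
    then show ?thesis by simp
  qed
  have wa: "w a = z ^ n / Q"
    using a fin by (simp add: w_def lag_weight_def n_def Q_def z_def)
  have wi: "w i = - c i / (z - x i)" if i: "i \<in> T" for i
  proof -
    have "insert a T - {i} = insert a (T - {i})" using i a by auto
    then have "w i = x i ^ n / ((x i - z) * (\<Prod>j\<in>T - {i}. x i - x j))"
      using a fin i by (simp add: w_def lag_weight_def n_def z_def)
    also have "\<dots> = c i / (x i - z)" by (simp add: c_def)
    also have "\<dots> = - c i / (z - x i)" 
      by (metis minus_diff_eq divide_minus_right minus_divide_left)
    finally show ?thesis .
  qed
  have interp: "monom 1 n = (\<Prod>j\<in>T. [:- x j, 1:]) +
    (\<Sum>i\<in>T. smult (c i) (\<Prod>j\<in>T - {i}. [:- x j, 1:]))"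
    using power_interpolation[OF fin inj'] by (simp add: n_def c_def)
  have "z ^ n = Q + (\<Sum>i\<in>T. c i * (Q / (z - x i)))"
    using arg_cong[OF interp, of "\<lambda>p. poly p z"] Qi
    by (simp add: poly_monom poly_prod poly_sum Q_def)
  also have "(\<Sum>i\<in>T. c i * (Q / (z - x i))) = - Q * (\<Sum>i\<in>T. w i)"
    unfolding sum_distrib_left by (intro sum.cong) (simp_all add: wi)
  finally have z1: "z ^ n = Q * (1 - sum w T)" by (simp add: algebra_simps)
  show 1: "lag_weight x (insert a T) a = 1 - (\<Sum>i\<in>T. lag_weight x (insert a T) i)"
    unfolding w_def[symmetric] using Q0 by (simp add: wa z1)
  \<comment> \<open>Differentiation removes one more linear factor from each product. Since
    \<open>z\<close> is not a node, a shortened product is \<open>Q\<close> divided by the factors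
    removed.\<close>
  have "poly (pderiv (monom 1 n)) z = (\<Sum>j\<in>T. Q / (z - x j)) +
      (\<Sum>i\<in>T. c i * (\<Sum>k\<in>T - {i}. Q / ((z - x i) * (z - x k))))"
    unfolding interp
    by (simp add: pderiv_add pderiv_sum pderiv_smult pderiv_prod pderiv_pCons poly_sum poly_prod
        Qi Qij)
  also have "(\<Sum>j\<in>T. Q / (z - x j)) = Q * T1"
    by (simp add: T1_def sum_distrib_left)
  also have "(\<Sum>i\<in>T. c i * (\<Sum>k\<in>T - {i}. Q / ((z - x i) * (z - x k)))) =
     (\<Sum>i\<in>T. - Q * w i * (T1 - 1 / (z - x i)))"
  proof (rule sum.cong)
    fix i assume i: "i \<in> T"
    have "(\<Sum>k\<in>T - {i}. Q / ((z - x i) * (z - x k))) = Q / (z - x i) * (\<Sum>k\<in>T - {i}. 1 / (z - x k))"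
      by (simp add: sum_distrib_left)
    also have "(\<Sum>k\<in>T - {i}. 1 / (z - x k)) = T1 - 1 / (z - x i)"
      using fin i by (simp add: T1_def sum.remove[of T i])
    finally show "c i * (\<Sum>k\<in>T - {i}. Q / ((z - x i) * (z - x k))) = - Q * w i * (T1 - 1 / (z - x i))"
      by (simp add: wi[OF i])
  qed simp
  also have "\<dots> = - Q * T1 * sum w T + Q * (\<Sum>i\<in>T. w i / (z - x i))"
    by (simp add: sum_distrib_left sum_negf[symmetric] sum.distrib[symmetric] algebra_simps)
  finally have "poly (pderiv (monom 1 n)) z = Q * (T1 * w a + (\<Sum>i\<in>T. w i / (z - x i)))"
    by (simp add: 1[folded w_def] algebra_simps)
  \<comment> \<open>The factor \<open>z\<close> restores the exponent n, so that n - 1 causes no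
    trouble at n = 0.\<close>
  moreover have "z * poly (pderiv (monom 1 n)) z = of_nat n * z ^ n"
    by (cases n) (simp_all add: pderiv_monom poly_monom)
  ultimately have "of_nat n * (w a * Q) = Q * (z * T1 * w a + z * (\<Sum>i\<in>T. w i / (z - x i)))"
    using wa Q0 by (simp add: algebra_simps)
  then have z2: "of_nat n * w a = z * T1 * w a + z * (\<Sum>i\<in>T. w i / (z - x i))"
    using Q0 by (simp add: mult.commute[of Q] mult.assoc[symmetric])
  have "(\<Sum>i\<in>T. (w i * z + w a * x i) / (x i - z)) =
    (\<Sum>i\<in>T. - z * (w i / (z - x i)) + w a - z * w a * (1 / (z - x i)))"
  proof (rule sum.cong)
    fix i assume i: "i \<in> T"
    show "(w i * z + w a * x i) / (x i - z) = - z * (w i / (z - x i)) + w a - z * w a * (1 / (z - x i))"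
      using ne[OF i] by (simp add: divide_simps) (simp add: algebra_simps)
  qed simp
  also have "\<dots> = - z * (\<Sum>i\<in>T. w i / (z - x i)) + of_nat n * w a - z * w a * T1"
    by (simp add: sum.distrib sum_subtractf sum_distrib_left T1_def n_def sum_negf)
  also have "\<dots> = 0" using z2 by (simp add: algebra_simps)
  finally show "(\<Sum>i\<in>T. (lag_weight x (insert a T) i * x a + lag_weight x (insert a T) a * x i) / (x i - x a)) = 0"
    by (simp add: w_def z_def)
qed

lemma lag_weight_sum:
  fixes x :: "'i \<Rightarrow> 'a::field"
  assumes "finite S" "inj_on x S" "S \<noteq> {}"
  shows "(\<Sum>i\<in>S. lag_weight x S i) = 1"
proof -
  obtain a where a: "a \<in> S" using assms by auto
  then have "S = insert a (S - {a})" by auto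
  then show ?thesis
    using lag_weight_insert(1)[of "S - {a}" x a] assms a by (simp add: sum.remove[of S a])
qed

text \<open>The summand is antisymmetric in \<open>a\<close> and \<open>i\<close>, so the case of a singleton \<open>J\<close> suffices.\<close>

lemma lag_weight_antisym:
  fixes x :: "'i \<Rightarrow> 'a::field"
  assumes fin: "finite S" and inj: "inj_on x S" and J: "J \<subseteq> S"
  shows "(\<Sum>a\<in>J. \<Sum>i\<in>S - J. (lag_weight x S i * x a + lag_weight x S a * x i) / (x i - x a)) = 0"
proof -
  define F where "F a i = (lag_weight x S i * x a + lag_weight x S a * x i) / (x i - x a)" for a i
  have anti: "F a i = - F i a" for a i
    unfolding F_def by (metis add.commute minus_diff_eq divide_minus_right)
  have F0: "F a a = 0" for a by (simp add: F_def)
  have one: "(\<Sum>i\<in>S. F a i) = 0" if a: "a \<in> S" for a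
  proof -
    have "S = insert a (S - {a})" using a by auto
    then show ?thesis using lag_weight_insert(2)[of "S - {a}" x a] fin inj a F0
      by (simp add: sum.remove[of S a] F_def)
  qed
  have finJ: "finite J" using J fin finite_subset by blast
  have "(\<Sum>a\<in>J. \<Sum>i\<in>J. F a i) = 0"
    using finJ
  proof (induction J)
    case (insert b J)
    have "(\<Sum>a\<in>J. F a b) = - (\<Sum>a\<in>J. F b a)"
      by (simp add: sum_negf[symmetric] anti[of b])
    with insert show ?case by (simp add: F0 sum.distrib)
  qed simp
  moreover have "(\<Sum>i\<in>S. F a i) = (\<Sum>i\<in>J. F a i) + (\<Sum>i\<in>S - J. F a i)" for a
    using sum.subset_diff[OF J fin, of "F a"] by (simp add: add.commute)
  ultimately have "(\<Sum>a\<in>J. \<Sum>i\<in>S - J. F a i) = (\<Sum>a\<in>J. \<Sum>i\<in>S. F a i)"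
    by (simp add: sum.distrib)
  also have "\<dots> = 0" using one J by (intro sum.neutral) auto
  finally show ?thesis by (simp add: F_def)
qed

section \<open>Regrouping sums over a subset and an index outside it\<close>

lemma sum_Pow_remove_swap:
  assumes "finite S"
  shows "(\<Sum>b\<in>S. \<Sum>I\<in>Pow (S - {b}). g b I) = (\<Sum>J\<in>Pow S. \<Sum>b\<in>S - J. g b J)"
proof -
  have "(\<Sum>b\<in>S. \<Sum>I\<in>Pow (S - {b}). g b I) = (\<Sum>(b,I)\<in>Sigma S (\<lambda>b. Pow (S - {b})). g b I)"
    using assms by (subst sum.Sigma) auto
  also have "\<dots> = (\<Sum>(J,b)\<in>Sigma (Pow S) (\<lambda>J. S - J). g b J)"
    by (rule sum.reindex_bij_witness[of _ "\<lambda>(J,b). (b,J)" "\<lambda>(b,J). (J,b)"]) auto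
  also have "\<dots> = (\<Sum>J\<in>Pow S. \<Sum>b\<in>S - J. g b J)"
    using assms by (subst sum.Sigma) auto
  finally show ?thesis .
qed

text \<open>A pair of a set I and an index b outside it can be filed under I, as in
  \<open>sum_Pow_remove_swap\<close>, or under \<open>insert b I\<close>, as here. The choice
  depends on which of the two sets is the argument of \<open>E\<close>.\<close>

lemma sum_Pow_remove_insert:
  assumes "finite S"
  shows "(\<Sum>b\<in>S. \<Sum>I\<in>Pow (S - {b}). g b I) = (\<Sum>J\<in>Pow S. \<Sum>b\<in>J. g b (J - {b}))"
proof -
  have "(\<Sum>b\<in>S. \<Sum>I\<in>Pow (S - {b}). g b I) = (\<Sum>(b,I)\<in>Sigma S (\<lambda>b. Pow (S - {b})). g b I)"
    using assms by (subst sum.Sigma) auto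
  also have "\<dots> = (\<Sum>(J,b)\<in>Sigma (Pow S) (\<lambda>J. J). g b (J - {b}))"
    by (rule sum.reindex_bij_witness[of _ "\<lambda>(J,b). (b,J - {b})" "\<lambda>(b,J). (insert b J,b)"])
      (auto simp: subset_Diff_insert)
  also have "\<dots> = (\<Sum>J\<in>Pow S. \<Sum>b\<in>J. g b (J - {b}))"
    using assms by (subst sum.Sigma) (auto intro: finite_subset)
  finally show ?thesis .
qed

lemma sum_offdiag_swap:
  assumes "finite J"
  shows "(\<Sum>b\<in>J. \<Sum>a\<in>J - {b}. g b a) = (\<Sum>a\<in>J. \<Sum>b\<in>J - {a}. g b a)"
proof -
  have "(\<Sum>b\<in>J. \<Sum>a\<in>J - {b}. g b a) = (\<Sum>b\<in>J. \<Sum>a\<in>J. if a = b then 0 else g b a)"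
    using assms by (intro sum.cong refl sum.mono_neutral_cong_left) auto
  also have "\<dots> = (\<Sum>a\<in>J. \<Sum>b\<in>J. if a = b then 0 else g b a)"
    by (rule sum.swap)
  also have "\<dots> = (\<Sum>a\<in>J. \<Sum>b\<in>J - {a}. g b a)"
    using assms by (intro sum.cong refl sum.mono_neutral_cong_right) auto
  finally show ?thesis .
qed

text \<open>The inductive step of the determinant evaluation: the left-hand side is the Laplace expansion
  along the first column, \<open>E I\<close> the contribution of the variables with indices in \<open>I\<close>, and
  \<open>pochhammer v (card S)\<close> the shifted factorial in \<open>u\<close>.\<close>

lemma lagrange_exclusion_step:
  fixes x :: "'i \<Rightarrow> 'a::field" and E :: "'i set \<Rightarrow> 'a" and v :: 'a
  assumes fin: "finite S" and inj: "inj_on x S" and ne: "S \<noteq> {}"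
  shows "(\<Sum>b\<in>S. lag_weight x S b * (\<Sum>I\<in>Pow (S - {b}).
      (- 1) ^ card I * pochhammer (v + 1 + of_nat (card I)) (card S - 1 - card I) *
      (v * E I - (E (insert b I) + (\<Sum>a\<in>I. (x b * E I - x a * E (insert b (I - {a}))) / (x a - x b))))))
    = (\<Sum>I\<in>Pow S. (- 1) ^ card I * pochhammer (v + of_nat (card I)) (card S - card I) * E I)"
proof -
  define w where "w = lag_weight x S"
  define P where "P j = pochhammer (v + 1 + of_nat j) (card S - 1 - j)" for j
  define P' where "P' j = pochhammer (v + of_nat j) (card S - j)" for j
  define s where "s I = (- 1 :: 'a) ^ card I" for I :: "'i set"
  have finJ: "finite J" if "J \<in> Pow S" for J using that fin finite_subset by blast
  \<comment> \<open>Taking b out of J flips the sign, and the loss of one element is absorbed by the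
    shift from \<open>v\<close> to \<open>v + 1\<close>.\<close>
  have sP: "s (J - {b}) * P (card (J - {b})) = - (s J * P' (card J))" if "b \<in> J" "J \<in> Pow S" for b J
  proof -
    have "card J = Suc (card (J - {b}))" using that finJ by (metis card.remove)
    then show ?thesis by (simp add: s_def P_def P'_def add_ac)
  qed
  \<comment> \<open>Three kinds of arguments of \<open>E\<close> occur: I, I with b added, and I
    with a exchanged for b. Each sum is regrouped by its argument J, so that the claim can be
    compared coefficient by coefficient.\<close>
  have "(\<Sum>b\<in>S. w b * (\<Sum>I\<in>Pow (S - {b}). s I * P (card I) *
      (v * E I - (E (insert b I) + (\<Sum>a\<in>I. (x b * E I - x a * E (insert b (I - {a}))) / (x a - x b))))))
    = (\<Sum>b\<in>S. \<Sum>I\<in>Pow (S - {b}). w b * s I * P (card I) * E I * (v - (\<Sum>a\<in>I. x b / (x a - x b))))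
     - (\<Sum>b\<in>S. \<Sum>I\<in>Pow (S - {b}). w b * s I * P (card I) * E (insert b I))
     + (\<Sum>b\<in>S. \<Sum>I\<in>Pow (S - {b}). \<Sum>a\<in>I. w b * s I * P (card I) * (x a / (x a - x b)) * E (insert b (I - {a})))"
    unfolding sum_distrib_left sum.distrib[symmetric] sum_subtractf[symmetric]
    by (intro sum.cong refl)
      (simp add: algebra_simps sum_distrib_left sum.distrib sum_subtractf diff_divide_distrib)
  also have "(\<Sum>b\<in>S. \<Sum>I\<in>Pow (S - {b}). w b * s I * P (card I) * E I * (v - (\<Sum>a\<in>I. x b / (x a - x b))))
     = (\<Sum>J\<in>Pow S. s J * E J * (P (card J) * (\<Sum>b\<in>S - J. w b * (v - (\<Sum>a\<in>J. x b / (x a - x b))))))"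
    unfolding sum_Pow_remove_swap[OF fin] by (simp add: sum_distrib_left mult_ac)
  also have "(\<Sum>b\<in>S. \<Sum>I\<in>Pow (S - {b}). w b * s I * P (card I) * E (insert b I))
     = (\<Sum>J\<in>Pow S. \<Sum>b\<in>J. w b * (s (J - {b}) * P (card (J - {b}))) * E J)"
    unfolding sum_Pow_remove_insert[OF fin] by (intro sum.cong refl) (simp add: insert_absorb mult_ac)
  also have "\<dots> = - (\<Sum>J\<in>Pow S. s J * E J * (P' (card J) * (\<Sum>b\<in>J. w b)))"
    unfolding sum_negf[symmetric] sum_distrib_left by (intro sum.cong refl, subst sP) (auto simp: mult_ac)
  also have "(\<Sum>b\<in>S. \<Sum>I\<in>Pow (S - {b}). \<Sum>a\<in>I. w b * s I * P (card I) * (x a / (x a - x b)) * E (insert b (I - {a})))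
     = (\<Sum>J\<in>Pow S. \<Sum>b\<in>J. \<Sum>a\<in>J - {b}. w b * (s (J - {b}) * P (card (J - {b}))) * (x a / (x a - x b)) * E (J - {a}))"
    unfolding sum_Pow_remove_insert[OF fin]
  proof (intro sum.cong refl)
    fix J and b a :: 'i assume "b \<in> J" "a \<in> J - {b}"
    then have "insert b (J - {b} - {a}) = J - {a}" by auto
    then show "w b * s (J - {b}) * P (card (J - {b})) * (x a / (x a - x b)) * E (insert b (J - {b} - {a})) =
       w b * (s (J - {b}) * P (card (J - {b}))) * (x a / (x a - x b)) * E (J - {a})"
      by (simp add: mult_ac)
  qed
  \<comment> \<open>Sign and shifted factorial depend on the cardinality alone, so they may be taken
    at \<open>J - {a}\<close>, the argument of \<open>E\<close>; then a can become the outer index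
    and be removed from J.\<close>
  also have "\<dots> = (\<Sum>J\<in>Pow S. \<Sum>b\<in>J. \<Sum>a\<in>J - {b}. w b * (s (J - {a}) * P (card (J - {a}))) * (x a / (x a - x b)) * E (J - {a}))"
    by (intro sum.cong refl) (simp add: s_def)
  also have "\<dots> = (\<Sum>J\<in>Pow S. \<Sum>a\<in>J. \<Sum>b\<in>J - {a}. w b * (s (J - {a}) * P (card (J - {a}))) * (x a / (x a - x b)) * E (J - {a}))"
  proof (rule sum.cong[OF refl])
    fix J assume J: "J \<in> Pow S"
    show "(\<Sum>b\<in>J. \<Sum>a\<in>J - {b}. w b * (s (J - {a}) * P (card (J - {a}))) * (x a / (x a - x b)) * E (J - {a})) =
       (\<Sum>a\<in>J. \<Sum>b\<in>J - {a}. w b * (s (J - {a}) * P (card (J - {a}))) * (x a / (x a - x b)) * E (J - {a}))"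
      by (rule sum_offdiag_swap[OF finJ[OF J]])
  qed
  also have "\<dots> = (\<Sum>J\<in>Pow S. s J * E J * (P (card J) * (\<Sum>a\<in>S - J. \<Sum>b\<in>J. w b * (x a / (x a - x b)))))"
    unfolding sum_Pow_remove_insert[OF fin, symmetric, of "\<lambda>a J. \<Sum>b\<in>J. w b * (s J * P (card J)) * (x a / (x a - x b)) * E J"]
    unfolding sum_Pow_remove_swap[OF fin] by (simp add: sum_distrib_left mult_ac)
  also have "(\<Sum>J\<in>Pow S. s J * E J * (P (card J) * (\<Sum>b\<in>S - J. w b * (v - (\<Sum>a\<in>J. x b / (x a - x b)))))) -
     - (\<Sum>J\<in>Pow S. s J * E J * (P' (card J) * (\<Sum>b\<in>J. w b))) +
     (\<Sum>J\<in>Pow S. s J * E J * (P (card J) * (\<Sum>a\<in>S - J. \<Sum>b\<in>J. w b * (x a / (x a - x b))))) =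
     (\<Sum>J\<in>Pow S. s J * E J * (P (card J) * ((\<Sum>b\<in>S - J. w b * (v - (\<Sum>a\<in>J. x b / (x a - x b)))) +
        (\<Sum>a\<in>S - J. \<Sum>b\<in>J. w b * (x a / (x a - x b)))) + P' (card J) * (\<Sum>b\<in>J. w b)))"
    by (subst diff_minus_eq_add, subst sum.distrib[symmetric], subst sum.distrib[symmetric],
        rule sum.cong[OF refl]) (simp add: ring_distribs add_ac)
  also have "\<dots> = (\<Sum>J\<in>Pow S. s J * E J * P' (card J))"
  proof (intro sum.cong refl)
    fix J assume J: "J \<in> Pow S"
    have W: "sum w J = 1 - sum w (S - J)"
      using lag_weight_sum[OF fin inj ne] sum.subset_diff[of J S w] J fin by (simp add: w_def algebra_simps)
    have "P (card J) * ((\<Sum>b\<in>S - J. w b * (v - (\<Sum>a\<in>J. x b / (x a - x b)))) +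
        (\<Sum>a\<in>S - J. \<Sum>b\<in>J. w b * (x a / (x a - x b)))) + P' (card J) * sum w J = P' (card J)"
    \<comment> \<open>At \<open>J = S\<close> the subtraction in \<open>P\<close> is truncated and
      \<open>P'\<close> is no multiple of \<open>P\<close> by the expected factor, but there the
      sums over \<open>S - J\<close> are empty.\<close>
    proof (cases "J = S")
      case True then show ?thesis using W by simp
    next
      case False
      then have lt: "card J < card S" using J fin by (simp add: psubset_card_mono psubset_eq)
      have P': "P' (card J) = (v + of_nat (card J)) * P (card J)"
      proof -
        have "card S - card J = Suc (card S - 1 - card J)" using lt by simp
        then show ?thesis unfolding P_def P'_def by (simp add: pochhammer_rec add_ac)
      qed
      have "(\<Sum>b\<in>S - J. w b * (v - (\<Sum>a\<in>J. x b / (x a - x b)))) +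
        (\<Sum>a\<in>S - J. \<Sum>b\<in>J. w b * (x a / (x a - x b))) =
        (\<Sum>i\<in>S - J. v * w i) + (\<Sum>i\<in>S - J. \<Sum>a\<in>J. w i + (w i * x a + w a * x i) / (x i - x a))"
        unfolding sum.distrib[symmetric]
      proof (intro sum.cong refl)
        fix i assume i: "i \<in> S - J"
        \<comment> \<open>Splitting off \<open>w i\<close> exposes the summand of
          \<open>lag_weight_antisym\<close>, whose double sum vanishes. Each a in J then leaves one
          \<open>w i\<close>, which completes \<open>v\<close> to
          \<open>v + of_nat (card J)\<close>, the first factor of \<open>P'\<close>.\<close>
        have "(\<Sum>a\<in>J. w i + (w i * x a + w a * x i) / (x i - x a)) =
          (\<Sum>a\<in>J. - w i * (x i / (x a - x i)) + w a * (x i / (x i - x a)))"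
        proof (intro sum.cong refl)
          fix a assume a: "a \<in> J"
          then have "x i - x a \<noteq> 0" "x a - x i \<noteq> 0" using i J inj by (auto simp: inj_on_def)
          then show "w i + (w i * x a + w a * x i) / (x i - x a) = - w i * (x i / (x a - x i)) + w a * (x i / (x i - x a))"
            by (simp add: divide_simps) (simp add: algebra_simps)
        qed
        then show "w i * (v - (\<Sum>a\<in>J. x i / (x a - x i))) + (\<Sum>b\<in>J. w b * (x i / (x i - x b))) =
         v * w i + (\<Sum>a\<in>J. w i + (w i * x a + w a * x i) / (x i - x a))"
          by (simp add: sum.distrib sum_distrib_left right_diff_distrib sum_negf sum_subtractf)
      qed
      also have "(\<Sum>i\<in>S - J. \<Sum>a\<in>J. w i + (w i * x a + w a * x i) / (x i - x a)) = of_nat (card J) * sum w (S - J)"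
        using lag_weight_antisym[OF fin inj, of J] J
        unfolding sum.swap[of _ "S - J" J] 
        by (simp add: sum.distrib w_def sum_distrib_left)
      finally show ?thesis unfolding P' W
        by (simp add: sum_distrib_left[symmetric] algebra_simps)
    qed
    then show "s J * E J * (P (card J) * ((\<Sum>b\<in>S - J. w b * (v - (\<Sum>a\<in>J. x b / (x a - x b)))) +
        (\<Sum>a\<in>S - J. \<Sum>b\<in>J. w b * (x a / (x a - x b)))) + P' (card J) * sum w J) = s J * E J * P' (card J)"
      by simp
  qed
  finally show ?thesis by (simp add: w_def s_def P_def P'_def mult_ac)
qed

section \<open>Exponent vectors and their types\<close>

definition mtype :: "(nat \<Rightarrow>\<^sub>0 nat) \<Rightarrow> nat multiset" where
  "mtype m = image_mset (Poly_Mapping.lookup m) (mset_set (Poly_Mapping.keys m))"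

lemma is_partition_mtype: "is_partition (mtype m)"
  by (auto simp: is_partition_def mtype_def in_keys_iff)

lemma size_mtype: "size (mtype m) = card (Poly_Mapping.keys m)"
  by (simp add: mtype_def)

lemma sum_mset_mtype: "sum_mset (mtype m) = mdeg m"
  by (simp add: mtype_def mdeg_def sum_unfold_sum_mset)

lemma mon_exps_mtype: "mon_exps N \<mu> = {m. Poly_Mapping.keys m \<subseteq> {1..N} \<and> mtype m = \<mu>}"
  by (simp add: mon_exps_def mtype_def)

lemma mtype_add_single:
  assumes "r \<notin> Poly_Mapping.keys m" "n > 0"
  shows "mtype (m + Poly_Mapping.single r n) = add_mset n (mtype m)"
proof -
  have "mtype (m + Poly_Mapping.single r n) = add_mset n
    (image_mset (Poly_Mapping.lookup (m + Poly_Mapping.single r n)) (mset_set (Poly_Mapping.keys m)))"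
    using assms by (simp add: mtype_def keys_add_nat lookup_add in_keys_iff)
  also have "image_mset (Poly_Mapping.lookup (m + Poly_Mapping.single r n)) (mset_set (Poly_Mapping.keys m)) = mtype m"
    unfolding mtype_def using assms
    by (intro image_mset_cong) (auto simp: lookup_add lookup_single when_def)
  finally show ?thesis .
qed

lemma remove_key:
  fixes m :: "nat \<Rightarrow>\<^sub>0 nat" and a :: nat
  defines "m0 \<equiv> m - Poly_Mapping.single a (Poly_Mapping.lookup m a)"
  shows "m = m0 + Poly_Mapping.single a (Poly_Mapping.lookup m a)"
    and "Poly_Mapping.keys m0 = Poly_Mapping.keys m - {a}"
  unfolding m0_def
  by (auto intro!: poly_mapping_eqI simp: lookup_add lookup_minus lookup_single when_def in_keys_iff split: if_splits)

lemma mtype_add_single_key: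
  assumes "a \<in> Poly_Mapping.keys m"
  shows "mtype (m + Poly_Mapping.single a n) =
    add_mset (Poly_Mapping.lookup m a + n) (mtype m - {#Poly_Mapping.lookup m a#})"
proof -
  define m0 where "m0 = m - Poly_Mapping.single a (Poly_Mapping.lookup m a)"
  define s where "s = Poly_Mapping.lookup m a"
  have m: "m = m0 + Poly_Mapping.single a s" and k: "a \<notin> Poly_Mapping.keys m0"
    using remove_key[of m a] by (simp_all add: m0_def s_def)
  have s: "s > 0" using assms by (simp add: s_def in_keys_iff)
  have "m + Poly_Mapping.single a n = m0 + Poly_Mapping.single a (s + n)"
    by (subst m) (simp add: single_add add.assoc)
  then show ?thesis using mtype_add_single[OF k s] mtype_add_single[OF k, of "s + n"] s m
    by (metis add_gr_0 add_mset_remove_trivial s_def)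
qed

section \<open>The augmented monomial symmetric functions\<close>

text \<open>The factor \<open>c_part\<close> turns a sum over distinct monomials into a sum over
  injective assignments of parts to variables; in this normalisation every term of the product with
  a power sum has coefficient 1.\<close>

definition aug_monomial :: "nat multiset \<Rightarrow> symfun" where
  "aug_monomial \<mu> = of_nat (c_part \<mu>) * monomial_sym \<mu>"

lemma proj_simps [simp]:
  "proj N (f + g) = proj N f + proj N g" "proj N (f * g) = proj N f * proj N g"
  "proj N 0 = 0" "proj N 1 = 1" "proj N (- f) = - proj N f" "proj N (scale c f) = const c * proj N f"
  by (simp_all add: proj_def plus_symfun.rep_eq times_symfun.rep_eq zero_symfun.rep_eq
      one_symfun.rep_eq uminus_symfun.rep_eq scale.rep_eq)

lemma proj_diff [simp]: "proj N (f - g) = proj N f - proj N g"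
  by (metis diff_conv_add_uminus proj_simps(1,5))

lemma proj_sum: "proj N (sum f A) = (\<Sum>a\<in>A. proj N (f a))"
  by (induction A rule: infinite_finite_induct) simp_all

lemma proj_power: "proj N (f ^ n) = proj N f ^ n"
  by (induction n) simp_all

lemma proj_of_nat [simp]: "proj N (of_nat n) = of_nat n"
  by (induction n) simp_all

lemma proj_sum_mset: "proj N (sum_mset A) = (\<Sum>a\<in>#A. proj N a)"
  by (induction A) simp_all

lemma proj_powersum: "n > 0 \<Longrightarrow> proj N (powersum n) = (\<Sum>i\<in>{1..N}. X i ^ n)"
  by (simp add: proj_def powersum.rep_eq)

lemma proj_monomial_sym: "proj N (monomial_sym \<mu>) = (\<Sum>m\<in>mon_exps N \<mu>. Poly_Mapping.single m 1)"
  by (simp add: proj_def monomial_sym.rep_eq)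

lemma proj_ext: "(\<And>N. proj N f = proj N g) \<Longrightarrow> f = g"
  by (simp add: proj_def proj_seq_inject[symmetric] fun_eq_iff)

lemma X_power: "X i ^ n = Poly_Mapping.single (Poly_Mapping.single i n) 1"
  by (induction n) (simp_all add: X_def mult_single single_add[symmetric])

lemma lookup_of_nat_mult: "Poly_Mapping.lookup (of_nat c * p) m = of_nat c * Poly_Mapping.lookup (p :: mpoly) m"
  by (induction c) (simp_all add: lookup_add algebra_simps)

lemma lookup_proj_aug_monomial:
  "Poly_Mapping.lookup (proj N (aug_monomial \<mu>)) m =
    of_nat (if m \<in> mon_exps N \<mu> then c_part \<mu> else 0)"
  using finite_mon_exps[of N \<mu>]
  by (auto simp: aug_monomial_def lookup_of_nat_mult proj_monomial_sym lookup_sum lookup_single when_def)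

lemma c_part_superset:
  assumes "finite A" "set_mset \<mu> \<subseteq> A"
  shows "c_part \<mu> = (\<Prod>r\<in>A. fact (count \<mu> r))"
  unfolding c_part_def
  by (rule prod.mono_neutral_left) (use assms in \<open>auto simp: not_in_iff\<close>)

lemma c_part_add_mset: "c_part (add_mset a \<mu>) = c_part \<mu> * (count \<mu> a + 1)"
proof -
  let ?A = "insert a (set_mset \<mu>)"
  have "c_part (add_mset a \<mu>) = (\<Prod>r\<in>?A. fact (count (add_mset a \<mu>) r))"
    by (rule c_part_superset) auto
  also have "\<dots> = fact (count \<mu> a + 1) * (\<Prod>r\<in>?A - {a}. fact (count \<mu> r))"
    by (subst prod.remove[of _ a]) auto
  also have "\<dots> = (count \<mu> a + 1) * (\<Prod>r\<in>?A. fact (count \<mu> r))"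
    by (subst (2) prod.remove[of _ a]) (auto simp: algebra_simps)
  also have "(\<Prod>r\<in>?A. fact (count \<mu> r)) = c_part \<mu>"
    by (rule c_part_superset[symmetric]) auto
  finally show ?thesis by (simp add: mult.commute)
qed

lemma sum_mset_sum_count:
  "(\<Sum>b\<in>#\<mu>. g b) = (\<Sum>b\<in>set_mset \<mu>. of_nat (count \<mu> b) * (g b :: 'a :: semiring_1))"
proof (induction \<mu>)
  case (add a \<mu>)
  have "(\<Sum>b\<in>set_mset (add_mset a \<mu>). of_nat (count (add_mset a \<mu>) b) * g b) =
      (\<Sum>b\<in>insert a (set_mset \<mu>). (if b = a then g a else 0) + of_nat (count \<mu> b) * g b)"
    by (intro sum.cong) (auto simp: distrib_right)
  also have "\<dots> = g a + (\<Sum>b\<in>insert a (set_mset \<mu>). of_nat (count \<mu> b) * g b)"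
    by (simp add: sum.distrib)
  also have "(\<Sum>b\<in>insert a (set_mset \<mu>). of_nat (count \<mu> b) * g b) = (\<Sum>b\<in>set_mset \<mu>. of_nat (count \<mu> b) * g b)"
    by (intro sum.mono_neutral_right) (auto simp: not_in_iff)
  finally show ?case using add by simp
qed simp

text \<open>Coefficients of a monomial of type \<open>\<nu>\<close> on the two sides of \<open>powersum_times_aug_monomial\<close>.\<close>

lemma aug_count_identity:
  assumes n: "n > 0" and part: "is_partition \<kappa>"
  shows "c_part \<kappa> * (\<Sum>b\<in>#\<nu>. if n \<le> b \<and> (if b = n then \<nu> - {#b#} else add_mset (b - n) (\<nu> - {#b#})) = \<kappa> then 1 else 0)
    = (if \<nu> = add_mset n \<kappa> then c_part (add_mset n \<kappa>) else 0) +
      (\<Sum>a\<in>#\<kappa>. if \<nu> = add_mset (a + n) (\<kappa> - {#a#}) then c_part \<nu> else 0)"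
    (is "_ * (\<Sum>b\<in>#\<nu>. if ?C b then 1 else 0) = ?R1 + ?R2")
proof -
  let ?A = "{a\<in>set_mset \<kappa>. \<nu> = add_mset (a + n) (\<kappa> - {#a#})}"
  let ?B = "{b\<in>set_mset \<nu>. n < b \<and> add_mset (b - n) (\<nu> - {#b#}) = \<kappa>}"
  have sum_mset_set: "(\<Sum>b\<in>#\<mu>. g b) = (\<Sum>b\<in>set_mset \<mu>. count \<mu> b * g b)" for g :: "nat \<Rightarrow> nat" and \<mu>
    by (simp add: sum_mset_sum_count)
  have "(\<Sum>b\<in>#\<nu>. if ?C b then 1 else 0) = (\<Sum>b\<in>{b\<in>set_mset \<nu>. ?C b}. count \<nu> b)"
    unfolding sum_mset_set by (subst sum.inter_filter) (auto intro!: sum.cong)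
  \<comment> \<open>Division by the n-th power of a variable deletes a part equal to n and shortens
    a larger one; these are the two kinds of terms on the right.\<close>
  also have "{b\<in>set_mset \<nu>. ?C b} = {b\<in>set_mset \<nu>. b = n \<and> \<nu> - {#n#} = \<kappa>} \<union> ?B"
    by auto
  also have "(\<Sum>b\<in>\<dots>. count \<nu> b) = (\<Sum>b\<in>{b\<in>set_mset \<nu>. b = n \<and> \<nu> - {#n#} = \<kappa>}. count \<nu> b) + (\<Sum>b\<in>?B. count \<nu> b)"
    by (rule sum.union_disjoint) auto
  finally have L: "c_part \<kappa> * (\<Sum>b\<in>#\<nu>. if ?C b then 1 else 0) = 
    c_part \<kappa> * (\<Sum>b\<in>{b\<in>set_mset \<nu>. b = n \<and> \<nu> - {#n#} = \<kappa>}. count \<nu> b) + (\<Sum>b\<in>?B. c_part \<kappa> * count \<nu> b)"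
    by (simp add: distrib_left sum_distrib_left)
  have "c_part \<kappa> * (\<Sum>b\<in>{b\<in>set_mset \<nu>. b = n \<and> \<nu> - {#n#} = \<kappa>}. count \<nu> b) = ?R1"
  proof (cases "\<nu> = add_mset n \<kappa>")
    case True
    then have "{b\<in>set_mset \<nu>. b = n \<and> \<nu> - {#n#} = \<kappa>} = {n}" by auto
    then show ?thesis using True by (simp add: c_part_add_mset)
  next
    case False
    then have *: "{b\<in>set_mset \<nu>. b = n \<and> \<nu> - {#n#} = \<kappa>} = {}" by auto
    show ?thesis unfolding * using False by simp
  qed
  moreover have "(\<Sum>b\<in>?B. c_part \<kappa> * count \<nu> b) = (\<Sum>a\<in>?A. c_part \<nu> * count \<kappa> a)"
  proof (rule sum.reindex_bij_witness[of _ "\<lambda>a. a + n" "\<lambda>b. b - n"])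
    fix b assume b: "b \<in> ?B"
    then show "b - n + n = b" by auto
    \<comment> \<open>Relative to the common rest \<eta>, \<nu> has the extra part b and \<kappa>
      the extra part b - n, so both products equal \<open>c_part \<eta>\<close> times the
      multiplicities of these two parts.\<close>
    define \<eta> where "\<eta> = \<nu> - {#b#}"
    have 1: "\<nu> = add_mset b \<eta>" "\<kappa> = add_mset (b - n) \<eta>" using b by (auto simp: \<eta>_def)
    with b show "b - n \<in> ?A" by auto
    show "c_part \<nu> * count \<kappa> (b - n) = c_part \<kappa> * count \<nu> b"
      by (simp add: 1 c_part_add_mset algebra_simps)
  next
    fix a assume a: "a \<in> ?A"
    then show "a + n - n = a" by simp
    \<comment> \<open>A part 0 would correspond to b = n, which belongs to the deletion
      case.\<close>
    have "a > 0" using a part by (auto simp: is_partition_def intro: Suc_leI gr0I)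
    with a show "a + n \<in> ?B" by auto
  qed
  moreover have "?R2 = (\<Sum>a\<in>?A. c_part \<nu> * count \<kappa> a)"
    unfolding sum_mset_set by (subst sum.inter_filter) (auto intro!: sum.cong)
  ultimately show ?thesis using L by simp
qed

text \<open>An n-th power meets either a variable outside the monomial, where it creates a part n,
  or one carrying a part a, which becomes a + n. The coefficient of a monomial counts the variables
  whose n-th power divides it with a quotient of type \<kappa>.\<close>

lemma powersum_times_aug_monomial:
  assumes n: "n > 0" and part: "is_partition \<kappa>"
  shows "powersum n * aug_monomial \<kappa> =
    aug_monomial (add_mset n \<kappa>) + (\<Sum>a\<in>#\<kappa>. aug_monomial (add_mset (a + n) (\<kappa> - {#a#})))"
proof (rule proj_ext, rule poly_mapping_eqI)
  fix N m
  define e where "e i = Poly_Mapping.single i n" for i :: nat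
  \<comment> \<open>Subtraction of exponents is truncated, so divisibility by \<open>X i ^ n\<close>
    has to be carried as a separate condition.\<close>
  have sub: "m - e i \<in> mon_exps N \<kappa> \<and> n \<le> Poly_Mapping.lookup m i \<longleftrightarrow>
     Poly_Mapping.keys m \<subseteq> {1..N} \<and> n \<le> Poly_Mapping.lookup m i \<and>
     (if Poly_Mapping.lookup m i = n then mtype m - {#Poly_Mapping.lookup m i#} 
      else add_mset (Poly_Mapping.lookup m i - n) (mtype m - {#Poly_Mapping.lookup m i#})) = \<kappa>"
    if i: "i \<in> {1..N}" for i
  proof (cases "n \<le> Poly_Mapping.lookup m i")
    case True
    let ?b = "Poly_Mapping.lookup m i"
    define m0 where "m0 = m - Poly_Mapping.single i ?b"
    have m: "m = m0 + Poly_Mapping.single i ?b" and k: "i \<notin> Poly_Mapping.keys m0"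
      using remove_key[of m i] by (simp_all add: m0_def)
    have me: "m - e i = m0 + Poly_Mapping.single i (?b - n)"
      unfolding m0_def e_def using True
      by (intro poly_mapping_eqI) (simp add: lookup_add lookup_minus lookup_single when_def)
    have t: "mtype m - {#?b#} = mtype m0"
      by (subst m, subst mtype_add_single) (use k True n in auto)
    have "mtype (m - e i) = (if ?b = n then mtype m0 else add_mset (?b - n) (mtype m0))"
      using True k unfolding me by (auto simp: mtype_add_single)
    moreover have "Poly_Mapping.keys (m - e i) \<subseteq> {1..N} \<longleftrightarrow> Poly_Mapping.keys m \<subseteq> {1..N}"
    proof -
      have "Poly_Mapping.keys m = insert i (Poly_Mapping.keys m0)"
        using arg_cong[OF m, of Poly_Mapping.keys] True n by (auto simp: keys_add_nat)
      moreover have "Poly_Mapping.keys (m - e i) = Poly_Mapping.keys m0 \<union> (if ?b = n then {} else {i})"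
        unfolding me keys_add_nat using True by auto
      ultimately show ?thesis using i by auto
    qed
    ultimately show ?thesis using True t by (auto simp: mon_exps_mtype)
  qed auto
  have "Poly_Mapping.lookup (proj N (powersum n * aug_monomial \<kappa>)) m =
     of_nat (c_part \<kappa>) * (\<Sum>i\<in>{1..N}. \<Sum>m'\<in>mon_exps N \<kappa>. if m = e i + m' then 1 else 0)"
  proof -
    have "proj N (powersum n * aug_monomial \<kappa>) = of_nat (c_part \<kappa>) *
      ((\<Sum>i\<in>{1..N}. Poly_Mapping.single (e i) 1) * (\<Sum>m'\<in>mon_exps N \<kappa>. Poly_Mapping.single m' 1))"
      by (simp add: aug_monomial_def proj_powersum[OF n] proj_monomial_sym X_power e_def)
    also have "\<dots> = of_nat (c_part \<kappa>) * (\<Sum>i\<in>{1..N}. \<Sum>m'\<in>mon_exps N \<kappa>. Poly_Mapping.single (e i + m') 1)"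
      by (simp add: sum_product mult_single)
    finally show ?thesis
      by (simp add: lookup_of_nat_mult lookup_sum lookup_single when_def eq_commute[of m])
  qed
  also have "(\<Sum>i\<in>{1..N}. \<Sum>m'\<in>mon_exps N \<kappa>. if m = e i + m' then 1 else 0) =
     (\<Sum>i\<in>{1..N}. if m - e i \<in> mon_exps N \<kappa> \<and> n \<le> Poly_Mapping.lookup m i then 1 else 0 :: ratfun)"
  proof (intro sum.cong refl)
    fix i
    have "m = e i + m' \<longleftrightarrow> n \<le> Poly_Mapping.lookup m i \<and> m' = m - e i" for m'
      by (auto simp: poly_mapping_eq_iff fun_eq_iff lookup_add lookup_minus lookup_single when_def e_def)
    then show "(\<Sum>m'\<in>mon_exps N \<kappa>. if m = e i + m' then 1 else 0) =
      (if m - e i \<in> mon_exps N \<kappa> \<and> n \<le> Poly_Mapping.lookup m i then 1 else 0 :: ratfun)"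
      using finite_mon_exps[of N \<kappa>] by (cases "n \<le> Poly_Mapping.lookup m i") (simp_all add: sum.delta)
  qed
  also have "\<dots> = of_nat (\<Sum>i\<in>{1..N}. if m - e i \<in> mon_exps N \<kappa> \<and> n \<le> Poly_Mapping.lookup m i then 1 else 0)"
    unfolding of_nat_sum by (intro sum.cong refl) simp
  finally have L: "Poly_Mapping.lookup (proj N (powersum n * aug_monomial \<kappa>)) m = 
    of_nat (c_part \<kappa> * (\<Sum>i\<in>{1..N}. if m - e i \<in> mon_exps N \<kappa> \<and> n \<le> Poly_Mapping.lookup m i then 1 else 0))"
    by (simp only: of_nat_mult)
  have R: "Poly_Mapping.lookup (proj N (aug_monomial (add_mset n \<kappa>) + (\<Sum>a\<in>#\<kappa>. aug_monomial (add_mset (a + n) (\<kappa> - {#a#}))))) m = 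
    of_nat ((if m \<in> mon_exps N (add_mset n \<kappa>) then c_part (add_mset n \<kappa>) else 0)
     + (\<Sum>a\<in>#\<kappa>. if m \<in> mon_exps N (add_mset (a + n) (\<kappa> - {#a#})) then c_part (add_mset (a + n) (\<kappa> - {#a#})) else 0))"
  proof -
    have "Poly_Mapping.lookup (sum_mset A) m = (\<Sum>a\<in>#A. Poly_Mapping.lookup (a :: mpoly) m)" for A
      by (induction A) (simp_all add: lookup_add)
    moreover have "of_nat (sum_mset A) = (\<Sum>a\<in>#A. of_nat a :: ratfun)" for A
      by (induction A) simp_all
    ultimately show ?thesis
      by (simp add: lookup_add lookup_proj_aug_monomial proj_sum_mset multiset.map_comp o_def)
  qed
  show "Poly_Mapping.lookup (proj N (powersum n * aug_monomial \<kappa>)) m =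
     Poly_Mapping.lookup (proj N (aug_monomial (add_mset n \<kappa>) + (\<Sum>a\<in>#\<kappa>. aug_monomial (add_mset (a + n) (\<kappa> - {#a#}))))) m"
    unfolding L R
  proof (rule arg_cong[of _ _ of_nat], cases "Poly_Mapping.keys m \<subseteq> {1..N}")
    case False
    have A: "(\<Sum>i\<in>{1..N}. if m - e i \<in> mon_exps N \<kappa> \<and> n \<le> Poly_Mapping.lookup m i then 1 else 0) = (0::nat)"
    proof (intro sum.neutral ballI)
      fix i assume "i \<in> {1..N}"
      then have "\<not> (m - e i \<in> mon_exps N \<kappa> \<and> n \<le> Poly_Mapping.lookup m i)"
        using sub[of i] False by blast
      then show "(if m - e i \<in> mon_exps N \<kappa> \<and> n \<le> Poly_Mapping.lookup m i then 1 else 0) = (0::nat)"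
        by (rule if_not_P)
    qed
    have B: "(\<Sum>a\<in>#\<kappa>. if m \<in> mon_exps N (add_mset (a + n) (\<kappa> - {#a#})) then c_part (add_mset (a + n) (\<kappa> - {#a#})) else 0) = 0"
      using False by (auto simp: mon_exps_mtype)
    show "c_part \<kappa> * (\<Sum>i\<in>{1..N}. if m - e i \<in> mon_exps N \<kappa> \<and> n \<le> Poly_Mapping.lookup m i then 1 else 0)
     = (if m \<in> mon_exps N (add_mset n \<kappa>) then c_part (add_mset n \<kappa>) else 0)
     + (\<Sum>a\<in>#\<kappa>. if m \<in> mon_exps N (add_mset (a + n) (\<kappa> - {#a#})) then c_part (add_mset (a + n) (\<kappa> - {#a#})) else 0)"
      unfolding A B using False by (simp add: mon_exps_mtype)
  next
    case True
    let ?g = "\<lambda>b. if n \<le> b \<and> (if b = n then mtype m - {#b#} else add_mset (b - n) (mtype m - {#b#})) = \<kappa> then 1 else 0 :: nat"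
    have "(\<Sum>i\<in>{1..N}. if m - e i \<in> mon_exps N \<kappa> \<and> n \<le> Poly_Mapping.lookup m i then 1 else 0) =
      (\<Sum>i\<in>{1..N}. ?g (Poly_Mapping.lookup m i))"
      using sub True by (intro sum.cong refl) simp
    also have "\<dots> = (\<Sum>i\<in>Poly_Mapping.keys m. ?g (Poly_Mapping.lookup m i))"
      using n True by (intro sum.mono_neutral_right) (auto simp: in_keys_iff)
    also have "\<dots> = (\<Sum>b\<in>#mtype m. ?g b)"
      unfolding mtype_def[of m] sum_unfold_sum_mset by (simp add: multiset.map_comp o_def)
    finally have L2: "(\<Sum>i\<in>{1..N}. if m - e i \<in> mon_exps N \<kappa> \<and> n \<le> Poly_Mapping.lookup m i then 1 else 0) = (\<Sum>b\<in>#mtype m. ?g b)" .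
    have R2: "(\<Sum>a\<in>#\<kappa>. if m \<in> mon_exps N (add_mset (a + n) (\<kappa> - {#a#})) then c_part (add_mset (a + n) (\<kappa> - {#a#})) else 0)
      = (\<Sum>a\<in>#\<kappa>. if mtype m = add_mset (a + n) (\<kappa> - {#a#}) then c_part (mtype m) else 0)"
      using True by (intro arg_cong[of _ _ sum_mset] image_mset_cong) (auto simp: mon_exps_mtype)
    have R1: "(if m \<in> mon_exps N (add_mset n \<kappa>) then c_part (add_mset n \<kappa>) else 0) =
      (if mtype m = add_mset n \<kappa> then c_part (add_mset n \<kappa>) else 0)"
      using True by (simp add: mon_exps_mtype)
    show "c_part \<kappa> * (\<Sum>i\<in>{1..N}. if m - e i \<in> mon_exps N \<kappa> \<and> n \<le> Poly_Mapping.lookup m i then 1 else 0)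
     = (if m \<in> mon_exps N (add_mset n \<kappa>) then c_part (add_mset n \<kappa>) else 0)
     + (\<Sum>a\<in>#\<kappa>. if m \<in> mon_exps N (add_mset (a + n) (\<kappa> - {#a#})) then c_part (add_mset (a + n) (\<kappa> - {#a#})) else 0)"
      unfolding L2 R1 R2 by (rule aug_count_identity[OF n part])
  qed
qed

text \<open>The rule read on a representative: parts become positions in the support, and any r
  outside the support serves as the fresh variable. Exclusion sums need the positions and not only
  the type.\<close>

lemma powersum_times_aug_monomial_exps:
  assumes "n > 0" "r \<notin> Poly_Mapping.keys m"
  shows "powersum n * aug_monomial (mtype m) = aug_monomial (mtype (m + Poly_Mapping.single r n))
     + (\<Sum>a\<in>Poly_Mapping.keys m. aug_monomial (mtype (m + Poly_Mapping.single a n)))"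
proof -
  have "(\<Sum>a\<in>#mtype m. aug_monomial (add_mset (a + n) (mtype m - {#a#}))) =
    (\<Sum>a\<in>Poly_Mapping.keys m. aug_monomial (add_mset (Poly_Mapping.lookup m a + n) (mtype m - {#Poly_Mapping.lookup m a#})))"
    unfolding mtype_def sum_unfold_sum_mset by (simp add: multiset.map_comp o_def)
  also have "\<dots> = (\<Sum>a\<in>Poly_Mapping.keys m. aug_monomial (mtype (m + Poly_Mapping.single a n)))"
    by (intro sum.cong refl) (simp add: mtype_add_single_key)
  finally show ?thesis
    using assms by (simp add: powersum_times_aug_monomial is_partition_mtype mtype_add_single)
qed

section \<open>Power sums form a basis\<close>

lemma scale_mult_left: "scale c f * g = scale c (f * g)"
  by (rule proj_ext) (simp add: mult.assoc)

lemma scale_mult_right: "f * scale c g = scale c (f * g)"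
  by (rule proj_ext) (simp add: mult.left_commute)

lemma const_of_nat: "const (of_nat n) = of_nat n"
  by (induction n) (simp_all add: const_add)

lemma scale_of_nat: "scale (of_nat n) f = of_nat n * f"
  by (rule proj_ext) (simp add: const_of_nat)

lemma span_times:
  assumes "f \<in> symfun.span A" "\<And>a. a \<in> A \<Longrightarrow> g * a \<in> symfun.span B"
  shows "g * f \<in> symfun.span B"
  using assms(1)
proof (induction rule: symfun.span_induct_alt)
  case base then show ?case by (simp add: symfun.span_zero)
next
  case (step c x y)
  then show ?case
    by (simp add: distrib_left scale_mult_right assms(2) symfun.span_add symfun.span_scale)
qed

lemma powersum_part_empty [simp]: "powersum_part {#} = 1"
  by (simp add: powersum_part_def)

lemma powersum_part_add_mset [simp]: "powersum_part (add_mset n \<mu>) = powersum n * powersum_part \<mu>"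
  by (simp add: powersum_part_def)

lemma is_partition_add_mset [simp]: "is_partition (add_mset n \<mu>) \<longleftrightarrow> n > 0 \<and> is_partition \<mu>"
  by (auto simp: is_partition_def)

lemma is_partition_empty [simp]: "is_partition {#}"
  by (simp add: is_partition_def)

lemma is_partition_diff: "is_partition \<mu> \<Longrightarrow> is_partition (\<mu> - \<nu>)"
  by (auto simp: is_partition_def dest: in_diffD)

lemma c_part_pos: "c_part \<mu> > 0"
  by (auto simp: c_part_def intro!: prod_pos)

lemma aug_monomial_empty [simp]: "aug_monomial {#} = 1"
proof -
  have "mon_exps N {#} = {0}" for N
    by (auto simp: mon_exps_mtype mtype_def mset_set_empty_iff)
  then show ?thesis
    by (intro proj_ext) (simp add: aug_monomial_def c_part_def proj_monomial_sym)
qed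

lemma monomial_sym_eq: "monomial_sym \<mu> = scale (inverse (of_nat (c_part \<mu>))) (aug_monomial \<mu>)"
proof -
  have "of_nat (c_part \<mu>) \<noteq> (0 :: ratfun)" using c_part_pos[of \<mu>] by simp
  then show ?thesis by (simp add: aug_monomial_def scale_of_nat[symmetric])
qed

lemma size_shift_part: "a \<in># \<mu> \<Longrightarrow> size (add_mset b (\<mu> - {#a#})) = size \<mu>"
  by (metis insert_DiffM size_add_mset)

lemma sum_shift_part: "a \<in># \<mu> \<Longrightarrow> sum_mset (add_mset (a + n) (\<mu> - {#a#})) = n + sum_mset (\<mu> :: nat multiset)"
  by (metis add.assoc add.commute insert_DiffM sum_mset.add_mset)

text \<open>The product rule is solved for its longest term; all others have one part fewer, so
  induction on the length applies. The degree is the same throughout.\<close>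

lemma aug_monomial_in_span:
  assumes "is_partition \<mu>"
  shows "aug_monomial \<mu> \<in> symfun.span (powersum_part ` {\<nu>. is_partition \<nu> \<and> sum_mset \<nu> = sum_mset \<mu>})"
  using assms
proof (induction "size \<mu>" arbitrary: \<mu>)
  case 0
  then show ?case by (auto intro!: symfun.span_base image_eqI[of _ _ "{#}"])
next
  case (Suc k)
  obtain n \<kappa> where \<mu>: "\<mu> = add_mset n \<kappa>" using Suc.hyps(2) by (metis size_eq_Suc_imp_eq_union)
  have part: "n > 0" "is_partition \<kappa>" and k: "k = size \<kappa>" using Suc \<mu> by simp_all
  let ?B = "powersum_part ` {\<nu>. is_partition \<nu> \<and> sum_mset \<nu> = sum_mset \<mu>}"
  have "powersum n * aug_monomial \<kappa> \<in> symfun.span ?B"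
  proof (rule span_times[OF Suc.hyps(1)[OF k part(2)]])
    fix x assume "x \<in> powersum_part ` {\<nu>. is_partition \<nu> \<and> sum_mset \<nu> = sum_mset \<kappa>}"
    then obtain \<nu> where "is_partition \<nu>" "sum_mset \<nu> = sum_mset \<kappa>" "x = powersum_part \<nu>" by auto
    then show "powersum n * x \<in> symfun.span ?B" using part
      by (intro symfun.span_base image_eqI[of _ _ "add_mset n \<nu>"]) (auto simp: \<mu>)
  qed
  moreover have "aug_monomial (add_mset (a + n) (\<kappa> - {#a#})) \<in> symfun.span ?B" if "a \<in># \<kappa>" for a
  proof -
    have "sum_mset (add_mset (a + n) (\<kappa> - {#a#})) = sum_mset \<mu>"
      unfolding sum_shift_part[OF that] by (simp add: \<mu>)
    then show ?thesis
      using Suc.hyps(1)[of "add_mset (a + n) (\<kappa> - {#a#})"] part k size_shift_part[OF that, of "a + n"]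
      by (simp add: is_partition_diff)
  qed
  then have "(\<Sum>a\<in>#\<kappa>. aug_monomial (add_mset (a + n) (\<kappa> - {#a#}))) \<in> symfun.span ?B"
    unfolding sum_mset_sum_count by (intro symfun.span_sum) (auto simp: scale_of_nat[symmetric] intro!: symfun.span_scale)
  ultimately show ?case
    using powersum_times_aug_monomial[OF part] unfolding \<mu>
    by (metis (no_types, lifting) add_diff_cancel_right' symfun.span_diff)
qed

text \<open>Triangularity in the length: in a product of power sums, only the term where no two
  factors share a variable keeps all parts; every coincidence merges parts.\<close>

lemma powersum_part_leading:
  assumes "is_partition \<mu>"
  shows "powersum_part \<mu> - aug_monomial \<mu> \<in> symfun.span (aug_monomial ` {\<nu>. is_partition \<nu> \<and> size \<nu> < size \<mu>})"
  using assms
proof (induction \<mu>)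
  case empty then show ?case by (simp add: symfun.span_zero)
next
  case (add n \<kappa>)
  then have part: "n > 0" "is_partition \<kappa>" by simp_all
  let ?B = "aug_monomial ` {\<nu>. is_partition \<nu> \<and> size \<nu> < size (add_mset n \<kappa>)}"
  have sums: "(\<Sum>a\<in>#\<nu>. aug_monomial (add_mset (a + n) (\<nu> - {#a#}))) \<in> symfun.span ?B"
    if "is_partition \<nu>" "size \<nu> \<le> size \<kappa>" for \<nu>
    unfolding sum_mset_sum_count scale_of_nat[symmetric]
  proof (intro symfun.span_sum symfun.span_scale symfun.span_base imageI CollectI conjI)
    fix a assume a: "a \<in># \<nu>"
    show "is_partition (add_mset (a + n) (\<nu> - {#a#}))" using part(1) that by (simp add: is_partition_diff)
    show "size (add_mset (a + n) (\<nu> - {#a#})) < size (add_mset n \<kappa>)"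
      unfolding size_shift_part[OF a] using that by simp
  qed
  have "powersum n * (powersum_part \<kappa> - aug_monomial \<kappa>) \<in> symfun.span ?B"
  proof (rule span_times[OF add.IH[OF part(2)]])
    fix x assume "x \<in> aug_monomial ` {\<nu>. is_partition \<nu> \<and> size \<nu> < size \<kappa>}"
    then obtain \<nu> where \<nu>: "is_partition \<nu>" "size \<nu> < size \<kappa>" "x = aug_monomial \<nu>" by auto
    then show "powersum n * x \<in> symfun.span ?B" using part(1) sums[OF \<nu>(1)]
      by (simp add: powersum_times_aug_monomial)
        (rule symfun.span_add, rule symfun.span_base, auto)
  qed
  moreover have "powersum_part (add_mset n \<kappa>) - aug_monomial (add_mset n \<kappa>) =
     powersum n * (powersum_part \<kappa> - aug_monomial \<kappa>) + (\<Sum>a\<in>#\<kappa>. aug_monomial (add_mset (a + n) (\<kappa> - {#a#})))"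
    using powersum_times_aug_monomial[OF part] by (simp add: algebra_simps)
  ultimately show ?case using sums[OF part(2)] by (simp add: symfun.span_add)
qed

section \<open>Coefficients of symmetric functions\<close>

lemma ex_mon_exps:
  assumes "is_partition \<mu>" "size \<mu> \<le> N"
  shows "\<exists>m. m \<in> mon_exps N \<mu>"
  using assms
proof (induction \<mu> arbitrary: N)
  case empty
  then show ?case by (auto simp: mon_exps_mtype mtype_def intro: exI[of _ 0])
next
  case (add n \<mu>)
  then obtain m where m: "m \<in> mon_exps (N - 1) \<mu>" by force
  then have km: "Poly_Mapping.keys m \<subseteq> {1..N - 1}" by (simp add: mon_exps_mtype)
  also have "{1..N - 1} \<subseteq> {1..N}" by auto
  finally have "Poly_Mapping.keys m \<subseteq> {1..N}" .
  moreover have "N \<notin> Poly_Mapping.keys m" using km add.prems by auto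
  ultimately
  have "m + Poly_Mapping.single N n \<in> mon_exps N (add_mset n \<mu>)"
    using m add.prems by (auto simp: mon_exps_mtype mtype_add_single keys_add_nat)
  then show ?case ..
qed

lemma lookup_proj_Suc:
  assumes "Poly_Mapping.keys m \<subseteq> {1..N}"
  shows "Poly_Mapping.lookup (proj (Suc N) f) m = Poly_Mapping.lookup (proj N f) m"
proof -
  have ms: "mon_subst (X(Suc N := 0)) m' = (if Suc N \<in> Poly_Mapping.keys m' then 0 else Poly_Mapping.single m' 1)" for m'
  proof (cases "Suc N \<in> Poly_Mapping.keys m'")
    case True
    then show ?thesis by (auto simp: mon_subst_def in_keys_iff intro!: bexI[of _ "Suc N"])
  next
    case False
    then have "mon_subst (X(Suc N := 0)) m' = mon_subst X m'"
      unfolding mon_subst_def by (intro prod.cong) auto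
    with False show ?thesis by (simp add: mon_subst_X)
  qed
  have "proj N f = rho (Suc N) (proj (Suc N) f)"
    using proj_seq[of f] by (simp add: proj_def)
  then have "Poly_Mapping.lookup (proj N f) m = Poly_Mapping.lookup (rho (Suc N) (proj (Suc N) f)) m" by simp
  also have "\<dots> = (\<Sum>m'\<in>Poly_Mapping.keys (proj (Suc N) f). if m' = m then Poly_Mapping.lookup (proj (Suc N) f) m' else 0)"
    unfolding rho_def subst_def lookup_sum
  proof (intro sum.cong refl)
    fix m'
    show "Poly_Mapping.lookup (const (Poly_Mapping.lookup (proj (Suc N) f) m') * mon_subst (X(Suc N := 0)) m') m =
         (if m' = m then Poly_Mapping.lookup (proj (Suc N) f) m' else 0)"
      using assms by (auto simp: ms const_def mult_single lookup_single when_def)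
  qed
  also have "\<dots> = Poly_Mapping.lookup (proj (Suc N) f) m"
    by (simp add: in_keys_iff)
  finally show ?thesis by simp
qed

lemma lookup_proj_le:
  assumes "Poly_Mapping.keys m \<subseteq> {1..N}" "N \<le> N'"
  shows "Poly_Mapping.lookup (proj N' f) m = Poly_Mapping.lookup (proj N f) m"
  using assms(2)
proof (induction N' rule: dec_induct)
  case (step n)
  then have "Poly_Mapping.keys m \<subseteq> {1..n}" using assms(1) by auto
  with step show ?case by (simp add: lookup_proj_Suc)
qed simp

lemma lookup_map_key_inv:
  assumes "\<sigma> permutes A"
  shows "Poly_Mapping.lookup (Poly_Mapping.map_key (inv \<sigma>) m) i = Poly_Mapping.lookup m (inv \<sigma> i)"
  using permutes_inj[OF permutes_inv[OF assms]] by (simp add: map_key.rep_eq)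

lemma lookup_sym_poly_perm:
  assumes p: "p \<in> sym_polys N" and \<sigma>: "\<sigma> permutes {1..N}"
  shows "Poly_Mapping.lookup p (Poly_Mapping.map_key (inv \<sigma>) m) = Poly_Mapping.lookup p m"
proof -
  have inj: "Poly_Mapping.map_key (inv \<sigma>) m' = Poly_Mapping.map_key (inv \<sigma>) m \<longleftrightarrow> m' = m" for m'
  proof
    assume eq: "Poly_Mapping.map_key (inv \<sigma>) m' = Poly_Mapping.map_key (inv \<sigma>) m"
    show "m' = m"
    proof (rule poly_mapping_eqI)
      fix i
      show "Poly_Mapping.lookup m' i = Poly_Mapping.lookup m i"
        using arg_cong[OF eq, of "\<lambda>q. Poly_Mapping.lookup q (\<sigma> i)"] permutes_inverses(2)[OF \<sigma>]
        by (simp add: lookup_map_key_inv[OF \<sigma>])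
    qed
  qed simp
  have "p = subst (\<lambda>i. X (\<sigma> i)) p" using p \<sigma> by (simp add: sym_polys_def)
  then have "Poly_Mapping.lookup p (Poly_Mapping.map_key (inv \<sigma>) m) =
     Poly_Mapping.lookup (subst (\<lambda>i. X (\<sigma> i)) p) (Poly_Mapping.map_key (inv \<sigma>) m)" by simp
  also have "\<dots> = (\<Sum>m'\<in>Poly_Mapping.keys p. if m' = m then Poly_Mapping.lookup p m' else 0)"
    unfolding subst_def lookup_sum
    by (intro sum.cong refl)
       (simp add: mon_subst_perm[OF \<sigma>] const_def mult_single lookup_single when_def inj)
  also have "\<dots> = Poly_Mapping.lookup p m" by (simp add: in_keys_iff)
  finally show ?thesis .
qed

lemma image_lookup_interval:
  assumes "Poly_Mapping.keys m \<subseteq> {1..N}"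
  shows "image_mset (Poly_Mapping.lookup m) (mset_set {1..N}) = mtype m + replicate_mset (N - size (mtype m)) 0"
proof -
  let ?K = "Poly_Mapping.keys m"
  have "{1..N} = ?K \<union> ({1..N} - ?K)" using assms by auto
  then have "mset_set {1..N} = mset_set ?K + mset_set ({1..N} - ?K)"
    by (metis Diff_disjoint finite_Diff finite_atLeastAtMost finite_keys mset_set_Union)
  moreover have "image_mset (Poly_Mapping.lookup m) (mset_set ({1..N} - ?K)) = image_mset (\<lambda>_. 0) (mset_set ({1..N} - ?K))"
    by (intro image_mset_cong) (auto simp: in_keys_iff)
  moreover have "card ({1..N} - ?K) = N - size (mtype m)"
    using assms by (simp add: card_Diff_subset size_mtype)
  ultimately show ?thesis by (simp add: mtype_def image_mset_const_eq)
qed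

text \<open>Padded with zeros to N entries, two exponent vectors of the same type have the same
  multiset of values, so a permutation of the variables carries one to the other.\<close>

lemma lookup_sym_poly_mtype:
  assumes p: "p \<in> sym_polys N" and m: "Poly_Mapping.keys m \<subseteq> {1..N}" "Poly_Mapping.keys m' \<subseteq> {1..N}"
    and eq: "mtype m = mtype m'"
  shows "Poly_Mapping.lookup p m = Poly_Mapping.lookup p m'"
proof -
  have "image_mset (Poly_Mapping.lookup m) (mset_set {1..N}) = image_mset (Poly_Mapping.lookup m') (mset_set {1..N})"
    using image_lookup_interval[OF m(1)] image_lookup_interval[OF m(2)] eq by simp
  then obtain \<sigma> where \<sigma>: "\<sigma> permutes {1..N}" and l: "\<forall>x\<in>{1..N}. Poly_Mapping.lookup m x = Poly_Mapping.lookup m' (\<sigma> x)"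
    by (rule image_mset_eq_implies_permutes[rotated]) auto
  have l': "Poly_Mapping.lookup m x = Poly_Mapping.lookup m' (\<sigma> x)" for x
  proof (cases "x \<in> {1..N}")
    case False
    then have "x \<notin> Poly_Mapping.keys m" "x \<notin> Poly_Mapping.keys m'" using m by auto
    then show ?thesis using permutes_not_in[OF \<sigma> False] by (simp add: in_keys_iff)
  qed (use l in blast)
  have "m' = Poly_Mapping.map_key (inv \<sigma>) m"
    by (rule poly_mapping_eqI) (simp add: lookup_map_key_inv[OF \<sigma>] l' permutes_inverses(1)[OF \<sigma>])
  then show ?thesis using lookup_sym_poly_perm[OF p \<sigma>, of m] by simp
qed

lemma lookup_proj_mtype:
  assumes "Poly_Mapping.keys m \<subseteq> {1..N}" "Poly_Mapping.keys m' \<subseteq> {1..N'}" "mtype m = mtype m'"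
  shows "Poly_Mapping.lookup (proj N f) m = Poly_Mapping.lookup (proj N' f) m'"
proof -
  let ?M = "max N N'"
  have "proj ?M f \<in> sym_polys ?M" using proj_seq[of f] by (simp add: proj_def)
  moreover have "Poly_Mapping.keys m \<subseteq> {1..?M}" "Poly_Mapping.keys m' \<subseteq> {1..?M}"
    using order_trans[OF assms(1), of "{1..?M}"] order_trans[OF assms(2), of "{1..?M}"] by auto
  ultimately have "Poly_Mapping.lookup (proj ?M f) m = Poly_Mapping.lookup (proj ?M f) m'"
    using assms(3) by (intro lookup_sym_poly_mtype)
  then show ?thesis using lookup_proj_le[OF assms(1), of ?M f] lookup_proj_le[OF assms(2), of ?M f] by simp
qed

text \<open>The coefficient of \<open>monomial_sym \<mu>\<close>, read off in
  \<open>size \<mu>\<close> variables, the least number that admits a monomial of type \<mu>. By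
  \<open>mono_coeff_eq\<close> neither this number nor the chosen monomial matters.\<close>

definition mono_coeff :: "nat multiset \<Rightarrow> symfun \<Rightarrow> ratfun" where
  "mono_coeff \<mu> f = Poly_Mapping.lookup (proj (size \<mu>) f) (SOME m. m \<in> mon_exps (size \<mu>) \<mu>)"

lemma mono_coeff_eq:
  assumes "m \<in> mon_exps N \<mu>"
  shows "mono_coeff \<mu> f = Poly_Mapping.lookup (proj N f) m"
proof -
  have "is_partition \<mu>" using assms is_partition_mtype by (auto simp: mon_exps_mtype)
  then have "(SOME m. m \<in> mon_exps (size \<mu>) \<mu>) \<in> mon_exps (size \<mu>) \<mu>"
    using ex_mon_exps[of \<mu> "size \<mu>"] by (auto intro: someI_ex)
  with assms show ?thesis unfolding mono_coeff_def
    by (intro lookup_proj_mtype) (auto simp: mon_exps_mtype)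
qed

lemma lookup_const_mult: "Poly_Mapping.lookup (const c * p) m = c * Poly_Mapping.lookup (p :: mpoly) m"
proof -
  have "const c * p = const c * (\<Sum>m\<in>Poly_Mapping.keys p. Poly_Mapping.single m (Poly_Mapping.lookup p m))"
    using poly_mapping_sum_single[of p] by simp
  also have "\<dots> = (\<Sum>m\<in>Poly_Mapping.keys p. Poly_Mapping.single m (c * Poly_Mapping.lookup p m))"
    by (simp add: sum_distrib_left const_def mult_single)
  finally show ?thesis
    by (simp add: lookup_sum lookup_single when_def in_keys_iff)
qed

lemma mono_coeff_simps [simp]:
  "mono_coeff \<mu> (f + g) = mono_coeff \<mu> f + mono_coeff \<mu> g"
  "mono_coeff \<mu> (f - g) = mono_coeff \<mu> f - mono_coeff \<mu> g"
  "mono_coeff \<mu> (scale c f) = c * mono_coeff \<mu> f" "mono_coeff \<mu> 0 = 0"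
  by (simp_all add: mono_coeff_def lookup_add lookup_minus lookup_const_mult)

lemma mono_coeff_sum: "mono_coeff \<mu> (sum f A) = (\<Sum>a\<in>A. mono_coeff \<mu> (f a))"
  by (induction A rule: infinite_finite_induct) simp_all

lemma mono_coeff_aug_monomial:
  assumes "is_partition \<mu>"
  shows "mono_coeff \<mu> (aug_monomial \<nu>) = (if \<mu> = \<nu> then of_nat (c_part \<mu>) else 0)"
proof -
  obtain m where m: "m \<in> mon_exps (size \<mu>) \<mu>" using ex_mon_exps[OF assms] by auto
  show ?thesis
    unfolding mono_coeff_eq[OF m] lookup_proj_aug_monomial using m by (auto simp: mon_exps_mtype)
qed

lemma mono_coeff_powersum_part:
  assumes "is_partition \<mu>" "is_partition \<nu>" "size \<nu> \<le> size \<mu>"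
  shows "mono_coeff \<mu> (powersum_part \<nu>) = (if \<mu> = \<nu> then of_nat (c_part \<mu>) else 0)"
proof -
  have "mono_coeff \<mu> x = 0" if "x \<in> symfun.span (aug_monomial ` {\<nu>'. is_partition \<nu>' \<and> size \<nu>' < size \<nu>})" for x
    using that
  proof (induction rule: symfun.span_induct_alt)
    case (step c x y)
    then obtain \<nu>' where \<nu>': "x = aug_monomial \<nu>'" "size \<nu>' < size \<nu>" by auto
    then have "\<mu> \<noteq> \<nu>'" using assms(3) by auto
    then show ?case using step.IH assms(1) \<nu>'(1) by (simp add: mono_coeff_aug_monomial)
  qed simp
  from this[OF powersum_part_leading[OF assms(2)]]
  have "mono_coeff \<mu> (powersum_part \<nu>) = mono_coeff \<mu> (aug_monomial \<nu>)" by simp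
  then show ?thesis using assms by (simp add: mono_coeff_aug_monomial)
qed

text \<open>Among the partitions with nonzero coefficient, take one of maximal length. By
  triangularity its monomial occurs in no other product of power sums that contributes, so its
  coefficient vanishes after all.\<close>

lemma powersum_part_independent_family:
  assumes fin: "finite F" and part: "\<And>\<nu>. \<nu> \<in> F \<Longrightarrow> is_partition \<nu>"
    and zero: "(\<Sum>\<nu>\<in>F. scale (a \<nu>) (powersum_part \<nu>)) = 0" and \<mu>: "\<mu> \<in> F"
  shows "a \<mu> = 0"
proof (rule ccontr)
  assume "a \<mu> \<noteq> 0"
  let ?G = "{\<nu>\<in>F. a \<nu> \<noteq> 0}"
  have "finite ?G" "?G \<noteq> {}" using fin \<mu> \<open>a \<mu> \<noteq> 0\<close> by auto
  then have "Max (size ` ?G) \<in> size ` ?G" by (intro Max_in) auto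
  then obtain \<kappa> where \<kappa>: "\<kappa> \<in> ?G" and "size \<kappa> = Max (size ` ?G)" by force
  then have max: "size \<nu> \<le> size \<kappa>" if "\<nu> \<in> ?G" for \<nu>
    using that \<open>finite ?G\<close> by (metis (no_types, lifting) Max_ge finite_imageI imageI)
  have "0 = mono_coeff \<kappa> (\<Sum>\<nu>\<in>F. scale (a \<nu>) (powersum_part \<nu>))" by (simp add: zero)
  also have "\<dots> = (\<Sum>\<nu>\<in>F. if \<nu> = \<kappa> then a \<kappa> * of_nat (c_part \<kappa>) else 0)"
    unfolding mono_coeff_sum
  proof (intro sum.cong refl)
    fix \<nu> assume \<nu>: "\<nu> \<in> F"
    show "mono_coeff \<kappa> (scale (a \<nu>) (powersum_part \<nu>)) = (if \<nu> = \<kappa> then a \<kappa> * of_nat (c_part \<kappa>) else 0)"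
      using \<nu> \<kappa> part max[of \<nu>] by (cases "a \<nu> = 0") (auto simp: mono_coeff_powersum_part)
  qed
  also have "\<dots> = a \<kappa> * of_nat (c_part \<kappa>)" using fin \<kappa> by simp
  finally show False using \<kappa> c_part_pos[of \<kappa>] by simp
qed

lemma inj_on_powersum_part: "inj_on powersum_part {\<mu>. is_partition \<mu>}"
proof (rule inj_onI, rule ccontr)
  fix \<mu> \<nu> assume p: "\<mu> \<in> {\<mu>. is_partition \<mu>}" "\<nu> \<in> {\<mu>. is_partition \<mu>}"
    and eq: "powersum_part \<mu> = powersum_part \<nu>" and ne: "\<mu> \<noteq> \<nu>"
  have "(\<Sum>\<kappa>\<in>{\<mu>,\<nu>}. scale (if \<kappa> = \<mu> then 1 else - 1) (powersum_part \<kappa>)) = 0"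
    using ne eq by simp
  from powersum_part_independent_family[OF _ _ this, of \<mu>] p show False by auto
qed

lemma independent_powersum_part: "symfun.independent (powersum_part ` {\<mu>. is_partition \<mu>})"
  unfolding symfun.independent_explicit_finite_subsets
proof (intro allI impI ballI)
  fix S u v
  assume S: "S \<subseteq> powersum_part ` {\<mu>. is_partition \<mu>}" "finite S" and z: "(\<Sum>v\<in>S. scale (u v) v) = 0" and v: "v \<in> S"
  define F where "F = {\<mu>. is_partition \<mu> \<and> powersum_part \<mu> \<in> S}"
  have SF: "S = powersum_part ` F" using S by (auto simp: F_def)
  have inj: "inj_on powersum_part F" using inj_on_powersum_part by (rule inj_on_subset) (auto simp: F_def)
  have fin: "finite F" using S(2) inj unfolding SF by (rule finite_imageD)
  obtain \<mu> where \<mu>: "\<mu> \<in> F" "v = powersum_part \<mu>" using v SF by auto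
  have "(\<Sum>\<nu>\<in>F. scale (u (powersum_part \<nu>)) (powersum_part \<nu>)) = 0"
    using z unfolding SF by (subst (asm) sum.reindex[OF inj]) (simp add: o_def)
  from powersum_part_independent_family[OF fin _ this \<mu>(1)] show "u v = 0"
    by (simp add: F_def \<mu>(2))
qed

lemma finite_partitions_bounded: "finite {\<mu>. is_partition \<mu> \<and> sum_mset \<mu> \<le> (d::nat)}"
proof -
  have "size \<mu> \<le> sum_mset \<mu>" if "is_partition \<mu>" for \<mu>
    using that by (induction \<mu>) auto
  moreover have "set_mset \<mu> \<subseteq> {..d}" if "sum_mset \<mu> \<le> d" for \<mu> :: "nat multiset"
  proof
    fix x assume "x \<in># \<mu>"
    then have "sum_mset \<mu> = x + sum_mset (\<mu> - {#x#})" by (metis insert_DiffM sum_mset.add_mset)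
    then show "x \<in> {..d}" using that by simp
  qed
  ultimately have "{\<mu>. is_partition \<mu> \<and> sum_mset \<mu> \<le> d} \<subseteq> (\<Union>n\<le>d. {\<mu>. set_mset \<mu> \<subseteq> {..d} \<and> size \<mu> = n})"
    by fastforce
  moreover have "finite {\<mu>. set_mset \<mu> \<subseteq> {..d} \<and> size \<mu> = n}" for n
  proof -
    have "{\<mu>. set_mset \<mu> \<subseteq> {..d} \<and> size \<mu> = n} \<subseteq> mset ` {xs. set xs \<subseteq> {..d} \<and> length xs = n}"
      by (metis (mono_tags, lifting) ex_mset image_eqI mem_Collect_eq set_mset_mset size_mset subsetI)
    then show ?thesis by (rule finite_subset) (simp add: finite_lists_length_eq)
  qed
  ultimately show ?thesis by (meson finite_UN finite_atMost finite_subset)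
qed

text \<open>The degree bound built into the type \<open>symfun\<close> leaves only finitely many
  types of monomials, uniformly in the number of variables.\<close>

lemma symfun_expansion:
  "\<exists>d. f = (\<Sum>\<mu> | is_partition \<mu> \<and> sum_mset \<mu> \<le> d. scale (mono_coeff \<mu> f) (monomial_sym \<mu>))"
proof -
  obtain d where d: "\<And>N. deg_le d (proj N f)" using proj_seq[of f] by (auto simp: proj_def)
  let ?Q = "{\<mu>. is_partition \<mu> \<and> sum_mset \<mu> \<le> d}"
  have "f = (\<Sum>\<mu>\<in>?Q. scale (mono_coeff \<mu> f) (monomial_sym \<mu>))"
  proof (rule proj_ext, rule poly_mapping_eqI)
    fix N m
    have lm: "Poly_Mapping.lookup (proj N (monomial_sym \<mu>)) m = (if m \<in> mon_exps N \<mu> then 1 else 0)" for \<mu>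
      using finite_mon_exps[of N \<mu>] by (auto simp: proj_monomial_sym lookup_sum lookup_single when_def)
    have "Poly_Mapping.lookup (proj N (\<Sum>\<mu>\<in>?Q. scale (mono_coeff \<mu> f) (monomial_sym \<mu>))) m =
       (\<Sum>\<mu>\<in>?Q. mono_coeff \<mu> f * (if m \<in> mon_exps N \<mu> then 1 else 0))"
      by (simp add: proj_sum lookup_sum lookup_const_mult lm)
    also have "\<dots> = (\<Sum>\<mu>\<in>?Q. if \<mu> = mtype m then Poly_Mapping.lookup (proj N f) m else 0)"
    proof (intro sum.cong refl)
      fix \<mu>
      show "mono_coeff \<mu> f * (if m \<in> mon_exps N \<mu> then 1 else 0) = (if \<mu> = mtype m then Poly_Mapping.lookup (proj N f) m else 0)"
      proof (cases "Poly_Mapping.keys m \<subseteq> {1..N}")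
        case False
        then have "m \<notin> Poly_Mapping.keys (proj N f)" using proj_seq[of f] by (auto simp: proj_def sym_polys_def)
        then show ?thesis using False by (simp add: mon_exps_mtype in_keys_iff)
      next
        case True
        then show ?thesis by (auto simp: mon_exps_mtype mono_coeff_eq)
      qed
    qed
    also have "\<dots> = Poly_Mapping.lookup (proj N f) m"
    proof (cases "mdeg m \<le> d")
      case True
      then show ?thesis using finite_partitions_bounded[of d] by (simp add: is_partition_mtype sum_mset_mtype)
    next
      case False
      then have "Poly_Mapping.lookup (proj N f) m = 0" using d[of N] by (auto simp: deg_le_def in_keys_iff)
      then show ?thesis by (simp cong: if_cong)
    qed
    finally show "Poly_Mapping.lookup (proj N f) m =
      Poly_Mapping.lookup (proj N (\<Sum>\<mu>\<in>?Q. scale (mono_coeff \<mu> f) (monomial_sym \<mu>))) m" by simp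
  qed
  then show ?thesis ..
qed

text \<open>The filtration by degree. It is spanned by products of power sums because the adjoints
  of power sums act on these by deleting a part.\<close>

definition deg_filt :: "nat \<Rightarrow> symfun set" where
  "deg_filt d = symfun.span (powersum_part ` {\<mu>. is_partition \<mu> \<and> sum_mset \<mu> \<le> d})"

lemma aug_monomial_deg_filt:
  assumes "is_partition \<mu>" "sum_mset \<mu> \<le> d"
  shows "aug_monomial \<mu> \<in> deg_filt d"
  unfolding deg_filt_def
  by (rule subsetD[OF symfun.span_mono aug_monomial_in_span[OF assms(1)]]) (use assms(2) in auto)

lemma ex_deg_filt: "\<exists>d. f \<in> deg_filt d"
proof -
  obtain d where f: "f = (\<Sum>\<mu> | is_partition \<mu> \<and> sum_mset \<mu> \<le> d. scale (mono_coeff \<mu> f) (monomial_sym \<mu>))"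
    using symfun_expansion by blast
  have "(\<Sum>\<mu> | is_partition \<mu> \<and> sum_mset \<mu> \<le> d. scale (mono_coeff \<mu> f) (monomial_sym \<mu>)) \<in> deg_filt d"
    using aug_monomial_deg_filt unfolding deg_filt_def
    by (intro symfun.span_sum symfun.span_scale) (simp add: monomial_sym_eq symfun.span_scale)
  with f show ?thesis by metis
qed

lemma span_powersum_part: "symfun.span (powersum_part ` {\<mu>. is_partition \<mu>}) = UNIV"
proof -
  have "deg_filt d \<subseteq> symfun.span (powersum_part ` {\<mu>. is_partition \<mu>})" for d
    unfolding deg_filt_def by (rule symfun.span_mono) auto
  then show ?thesis using ex_deg_filt by blast
qed

lemma vector_space_ratfun: "vector_space ((*) :: ratfun \<Rightarrow> ratfun \<Rightarrow> ratfun)"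
  by standard (simp_all add: algebra_simps)

lemma symfun_pair: "vector_space_pair scale scale"
  by (intro vector_space_pair.intro symfun.vector_space_axioms)

lemma symfun_dual: "vector_space_pair scale ((*) :: ratfun \<Rightarrow> ratfun \<Rightarrow> ratfun)"
  by (intro vector_space_pair.intro symfun.vector_space_axioms vector_space_ratfun)

lemma ex_linear_on_powersum_part:
  fixes s :: "ratfun \<Rightarrow> 'b::ab_group_add \<Rightarrow> 'b"
  assumes "vector_space_pair scale s"
  shows "\<exists>T. Vector_Spaces.linear scale s T \<and> (\<forall>\<mu>. is_partition \<mu> \<longrightarrow> T (powersum_part \<mu>) = g \<mu>)"
proof -
  obtain T where "Vector_Spaces.linear scale s T"
    "\<forall>x\<in>powersum_part ` {\<mu>. is_partition \<mu>}. T x = g (the_inv_into {\<mu>. is_partition \<mu>} powersum_part x)"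
    using vector_space_pair.linear_independent_extend[OF assms independent_powersum_part,
      of "\<lambda>x. g (the_inv_into {\<mu>. is_partition \<mu>} powersum_part x)"] by auto
  then show ?thesis by (auto simp: the_inv_into_f_f[OF inj_on_powersum_part] intro!: exI[of _ T])
qed

lemma linear_eq_on_powersum_part:
  fixes s :: "ratfun \<Rightarrow> 'b::ab_group_add \<Rightarrow> 'b"
  assumes "Vector_Spaces.linear scale s T" "Vector_Spaces.linear scale s T'"
    "\<And>\<mu>. is_partition \<mu> \<Longrightarrow> T (powersum_part \<mu>) = T' (powersum_part \<mu>)"
  shows "T f = T' f"
proof -
  have P: "vector_space_pair scale s"
    using assms(1) by (simp add: Vector_Spaces.linear_iff vector_space_pair_def)
  show ?thesis
    using span_powersum_part assms(3) by (intro vector_space_pair.linear_eq_on[OF P assms(1,2), of f "powersum_part ` {\<mu>. is_partition \<mu>}"]) auto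
qed

lemma linear_symfun_iff:
  "Vector_Spaces.linear scale scale T \<longleftrightarrow> (\<forall>f g. T (f + g) = T f + T g) \<and> (\<forall>c f. T (scale c f) = scale c (T f))"
  by (simp add: Vector_Spaces.linear_iff symfun.vector_space_axioms)

lemma linear_functional_iff:
  "Vector_Spaces.linear scale (*) T \<longleftrightarrow> (\<forall>f g. T (f + g) = T f + T g) \<and> (\<forall>c f. T (scale c f) = c * T f)"
  by (simp add: Vector_Spaces.linear_iff symfun.vector_space_axioms vector_space_ratfun)

lemma ex_powersum_coordinates:
  "\<exists>pc :: symfun \<Rightarrow> nat multiset \<Rightarrow> ratfun.
     (\<forall>f g \<mu>. pc (f + g) \<mu> = pc f \<mu> + pc g \<mu>) \<and> (\<forall>c f \<mu>. pc (scale c f) \<mu> = c * pc f \<mu>) \<and>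
     (\<forall>\<mu> \<nu>. is_partition \<nu> \<longrightarrow> pc (powersum_part \<nu>) \<mu> = (if \<mu> = \<nu> then 1 else 0))"
proof -
  have "\<exists>T. Vector_Spaces.linear scale (*) T \<and>
      (\<forall>\<nu>. is_partition \<nu> \<longrightarrow> T (powersum_part \<nu>) = (if \<mu> = \<nu> then 1 else 0 :: ratfun))" for \<mu>
    by (rule ex_linear_on_powersum_part) (rule symfun_dual)
  then obtain T where T: "\<And>\<mu>. Vector_Spaces.linear scale (*) (T \<mu>)"
     "\<And>\<mu> \<nu>. is_partition \<nu> \<Longrightarrow> T \<mu> (powersum_part \<nu>) = (if \<mu> = \<nu> then 1 else 0 :: ratfun)" by metis
  then show ?thesis
    by (intro exI[of _ "\<lambda>f \<mu>. T \<mu> f"]) (auto simp: linear_functional_iff)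
qed

section \<open>The bilinear form\<close>

text \<open>The predicate inside the definite description of \<open>jack_form\<close>, named so that
  existence and uniqueness can be settled first.\<close>

definition jack_spec :: "(symfun \<Rightarrow> symfun \<Rightarrow> ratfun) \<Rightarrow> bool" where
  "jack_spec B \<longleftrightarrow> bilinear_form B \<and>
     (\<forall>\<mu> \<nu>. is_partition \<mu> \<longrightarrow> is_partition \<nu> \<longrightarrow>
        B (powersum_part \<mu>) (powersum_part \<nu>) =
          (if \<mu> = \<nu> then alpha ^ size \<mu> * of_nat (z_part \<mu>) else 0))"

text \<open>Linearity in the second argument holds by construction on the basis; in the first it is
  inherited from the coordinates \<open>pc\<close>.\<close>

lemma ex_jack_spec: "\<exists>B. jack_spec B"
proof -
  obtain pc :: "symfun \<Rightarrow> nat multiset \<Rightarrow> ratfun" where pc: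
    "\<And>f g \<mu>. pc (f + g) \<mu> = pc f \<mu> + pc g \<mu>" "\<And>c f \<mu>. pc (scale c f) \<mu> = c * pc f \<mu>"
    "\<And>\<mu> \<nu>. is_partition \<nu> \<Longrightarrow> pc (powersum_part \<nu>) \<mu> = (if \<mu> = \<nu> then 1 else 0)"
    using ex_powersum_coordinates by metis
  have "\<exists>T. Vector_Spaces.linear scale (*) T \<and>
      (\<forall>\<mu>. is_partition \<mu> \<longrightarrow> T (powersum_part \<mu>) = alpha ^ size \<mu> * of_nat (z_part \<mu>) * pc f \<mu>)" for f
    by (rule ex_linear_on_powersum_part) (rule symfun_dual)
  then obtain B where B: "\<And>f. Vector_Spaces.linear scale (*) (B f)"
    "\<And>f \<mu>. is_partition \<mu> \<Longrightarrow> B f (powersum_part \<mu>) = alpha ^ size \<mu> * of_nat (z_part \<mu>) * pc f \<mu>" by metis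
  have Badd: "B (f + g) h = B f h + B g h" for f g h
    by (rule linear_eq_on_powersum_part[of "(*)" "B (f + g)" "\<lambda>h. B f h + B g h"])
      (use B in \<open>simp_all add: linear_functional_iff pc algebra_simps\<close>)
  have Bscale: "B (scale c f) h = c * B f h" for c f h
    by (rule linear_eq_on_powersum_part[of "(*)" "B (scale c f)" "\<lambda>h. c * B f h"])
      (use B in \<open>simp_all add: linear_functional_iff pc algebra_simps\<close>)
  have "jack_spec B"
    using B unfolding jack_spec_def bilinear_form_def by (simp add: linear_functional_iff Badd Bscale pc)
  then show ?thesis by blast
qed

lemma jack_spec_unique:
  assumes "jack_spec B" "jack_spec B'"
  shows "B = B'"
proof (intro ext)
  fix f g
  have l: "Vector_Spaces.linear scale (*) (B f)" "Vector_Spaces.linear scale (*) (\<lambda>f. B f g)"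
    "Vector_Spaces.linear scale (*) (B' f)" "Vector_Spaces.linear scale (*) (\<lambda>f. B' f g)" for f g
    using assms by (simp_all add: jack_spec_def bilinear_form_def)
  show "B f g = B' f g"
  proof (rule linear_eq_on_powersum_part[OF l(1) l(3)])
    fix \<nu> assume \<nu>: "is_partition \<nu>"
    show "B f (powersum_part \<nu>) = B' f (powersum_part \<nu>)"
      by (rule linear_eq_on_powersum_part[OF l(2) l(4)]) (use assms \<nu> in \<open>simp add: jack_spec_def\<close>)
  qed
qed

lemma jack_spec_jack_form: "jack_spec jack_form"
  unfolding jack_form_def jack_spec_def[symmetric]
  using theI'[of jack_spec] ex_jack_spec jack_spec_unique by blast

lemma jack_form_simps [simp]:
  "jack_form (f + g) h = jack_form f h + jack_form g h"
  "jack_form h (f + g) = jack_form h f + jack_form h g"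
  "jack_form (scale c f) h = c * jack_form f h"
  "jack_form h (scale c f) = c * jack_form h f"
  using jack_spec_jack_form by (simp_all add: jack_spec_def bilinear_form_def linear_functional_iff)

lemma jack_form_powersum_part:
  "is_partition \<mu> \<Longrightarrow> is_partition \<nu> \<Longrightarrow> jack_form (powersum_part \<mu>) (powersum_part \<nu>) =
     (if \<mu> = \<nu> then alpha ^ size \<mu> * of_nat (z_part \<mu>) else 0)"
  using jack_spec_jack_form by (simp add: jack_spec_def)

lemma jack_form_0 [simp]: "jack_form 0 h = 0" "jack_form h 0 = 0"
  by (metis jack_form_simps(3,4) mult_zero_left symfun.scale_zero_left)+

lemma alpha_nonzero: "alpha \<noteq> 0"
  by (simp add: alpha_def Zero_fract_def eq_fract)

lemma z_part_pos: "is_partition \<mu> \<Longrightarrow> z_part \<mu> > 0"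
  by (auto simp: z_part_def is_partition_def intro!: prod_pos gr0I)

text \<open>Nondegeneracy: products of power sums are orthogonal with nonzero norms, so pairing with
  them recovers every coordinate. It makes adjoints unique and lets identities between them be
  checked inside the form.\<close>

lemma jack_form_eqI:
  assumes "\<And>h. jack_form f h = jack_form g h"
  shows "f = g"
proof -
  obtain pc :: "symfun \<Rightarrow> nat multiset \<Rightarrow> ratfun" where pc:
    "\<And>f g \<mu>. pc (f + g) \<mu> = pc f \<mu> + pc g \<mu>" "\<And>c f \<mu>. pc (scale c f) \<mu> = c * pc f \<mu>"
    "\<And>\<mu> \<nu>. is_partition \<nu> \<Longrightarrow> pc (powersum_part \<nu>) \<mu> = (if \<mu> = \<nu> then 1 else 0)"
    using ex_powersum_coordinates by metis
  have jpc: "jack_form f (powersum_part \<mu>) = alpha ^ size \<mu> * of_nat (z_part \<mu>) * pc f \<mu>"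
    if "is_partition \<mu>" for f \<mu>
    by (rule linear_eq_on_powersum_part[of "(*)" "\<lambda>f. jack_form f (powersum_part \<mu>)"])
      (use that in \<open>auto simp: linear_functional_iff pc jack_form_powersum_part algebra_simps\<close>)
  have pceq: "pc f \<mu> = pc g \<mu>" if "is_partition \<mu>" for \<mu>
    using assms[of "powersum_part \<mu>"] jpc[OF that] alpha_nonzero z_part_pos[OF that] by simp
  define d where "d = f - g"
  have pc0: "pc d \<mu> = 0" if "is_partition \<mu>" for \<mu>
    using pc(1)[of d g \<mu>] pceq[OF that] by (simp add: d_def)
  have "d \<in> symfun.span (powersum_part ` {\<mu>. is_partition \<mu>})" by (simp add: span_powersum_part)
  then obtain S r where S: "finite S" "S \<subseteq> powersum_part ` {\<mu>. is_partition \<mu>}" and d: "d = (\<Sum>a\<in>S. scale (r a) a)"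
    unfolding symfun.span_explicit by auto
  have "pc (sum h A) \<mu> = (\<Sum>a\<in>A. pc (h a) \<mu>)" if "finite A" for h :: "symfun \<Rightarrow> symfun" and A \<mu>
    using that pc(2)[of 0 0] by (induction A) (simp_all add: pc(1) symfun.scale_zero_left)
  then have "pc d \<mu> = (\<Sum>a\<in>S. r a * pc a \<mu>)" for \<mu>
    by (simp add: d S pc(2))
  then have eq: "(\<Sum>a\<in>S. r a * pc a \<mu>) = 0" if "is_partition \<mu>" for \<mu>
    using pc0[OF that] by simp
  have "r a = 0" if a: "a \<in> S" for a
  proof -
    obtain \<mu> where \<mu>: "is_partition \<mu>" "a = powersum_part \<mu>" using S a by auto
    have "(\<Sum>b\<in>S. r b * pc b \<mu>) = (\<Sum>b\<in>S. if b = a then r a else 0)"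
    proof (intro sum.cong refl)
      fix b assume "b \<in> S"
      then obtain \<nu> where \<nu>: "is_partition \<nu>" "b = powersum_part \<nu>" using S by auto
      then have "b = a \<longleftrightarrow> \<mu> = \<nu>" using inj_on_powersum_part \<mu> by (auto simp: inj_on_def)
      then show "r b * pc b \<mu> = (if b = a then r a else 0)" using pc(3)[OF \<nu>(1)] \<nu> by auto
    qed
    then show ?thesis using eq[OF \<mu>(1)] S a by simp
  qed
  then have "d = 0" by (simp add: d symfun.scale_zero_left)
  then show ?thesis by (simp add: d_def)
qed

section \<open>Adjoint operators\<close>

definition is_adjoint :: "symfun \<Rightarrow> (symfun \<Rightarrow> symfun) \<Rightarrow> bool" where
  "is_adjoint f T \<longleftrightarrow> (\<forall>g h. jack_form (T g) h = jack_form g (f * h))"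

lemma is_adjoint_unique: "is_adjoint f T \<Longrightarrow> is_adjoint f T' \<Longrightarrow> T = T'"
  by (rule ext, rule jack_form_eqI) (simp add: is_adjoint_def)

lemma z_part_superset:
  assumes "finite A" "set_mset \<mu> \<subseteq> A"
  shows "z_part \<mu> = (\<Prod>r\<in>A. r ^ count \<mu> r * fact (count \<mu> r))"
  unfolding z_part_def
  by (rule prod.mono_neutral_left) (use assms in \<open>auto simp: not_in_iff\<close>)

lemma z_part_add_mset: "z_part (add_mset a \<mu>) = z_part \<mu> * (a * (count \<mu> a + 1))"
proof -
  let ?A = "insert a (set_mset \<mu>)"
  have "z_part (add_mset a \<mu>) = (\<Prod>r\<in>?A. r ^ count (add_mset a \<mu>) r * fact (count (add_mset a \<mu>) r))"
    by (rule z_part_superset) auto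
  also have "\<dots> = a ^ (count \<mu> a + 1) * fact (count \<mu> a + 1) * (\<Prod>r\<in>?A - {a}. r ^ count \<mu> r * fact (count \<mu> r))"
    by (subst prod.remove[of _ a]) auto
  also have "\<dots> = a * (count \<mu> a + 1) * (\<Prod>r\<in>?A. r ^ count \<mu> r * fact (count \<mu> r))"
    by (subst (2) prod.remove[of _ a]) (auto simp: algebra_simps)
  also have "(\<Prod>r\<in>?A. r ^ count \<mu> r * fact (count \<mu> r)) = z_part \<mu>"
    by (rule z_part_superset[symmetric]) auto
  finally show ?thesis by (simp add: mult.commute)
qed

text \<open>The operator is \<alpha> n times differentiation with respect to p_n in the polynomial
  ring of the power sums. The scalar is the ratio of the norms before and after the deletion of a
  part n.\<close>

lemma ex_adjoint_powersum:
  assumes "n > 0"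
  shows "\<exists>T. is_adjoint (powersum n) T \<and> Vector_Spaces.linear scale scale T \<and>
    (\<forall>\<mu>. is_partition \<mu> \<longrightarrow> T (powersum_part \<mu>) =
      scale (alpha * of_nat (n * count \<mu> n)) (powersum_part (\<mu> - {#n#})))"
proof -
  obtain T where T: "Vector_Spaces.linear scale scale T"
    "\<And>\<mu>. is_partition \<mu> \<Longrightarrow> T (powersum_part \<mu>) =
      scale (alpha * of_nat (n * count \<mu> n)) (powersum_part (\<mu> - {#n#}))"
    using ex_linear_on_powersum_part[OF symfun_pair,
      of "\<lambda>\<mu>. scale (alpha * of_nat (n * count \<mu> n)) (powersum_part (\<mu> - {#n#}))"] by auto
  have "jack_form (T g) h = jack_form g (powersum n * h)" for g h
  proof (rule linear_eq_on_powersum_part[of "(*)" "\<lambda>g. jack_form (T g) h" "\<lambda>g. jack_form g (powersum n * h)" g])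
    show "Vector_Spaces.linear scale (*) (\<lambda>g. jack_form (T g) h)"
      "Vector_Spaces.linear scale (*) (\<lambda>g. jack_form g (powersum n * h))"
      using T(1) by (simp_all add: linear_functional_iff linear_symfun_iff)
    fix \<mu> assume \<mu>: "is_partition \<mu>"
    show "jack_form (T (powersum_part \<mu>)) h = jack_form (powersum_part \<mu>) (powersum n * h)"
    proof (rule linear_eq_on_powersum_part[of "(*)" "\<lambda>h. jack_form (T (powersum_part \<mu>)) h" "\<lambda>h. jack_form (powersum_part \<mu>) (powersum n * h)"])
      show "Vector_Spaces.linear scale (*) (\<lambda>h. jack_form (T (powersum_part \<mu>)) h)"
        "Vector_Spaces.linear scale (*) (\<lambda>h. jack_form (powersum_part \<mu>) (powersum n * h))"
        by (simp_all add: linear_functional_iff distrib_left scale_mult_right)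
      fix \<nu> assume \<nu>: "is_partition \<nu>"
      have "jack_form (T (powersum_part \<mu>)) (powersum_part \<nu>) =
        alpha * of_nat (n * count \<mu> n) * jack_form (powersum_part (\<mu> - {#n#})) (powersum_part \<nu>)"
        by (simp add: T(2)[OF \<mu>])
      also have "\<dots> = jack_form (powersum_part \<mu>) (powersum_part (add_mset n \<nu>))"
      proof (cases "n \<in># \<mu>")
        case False
        then have "\<mu> \<noteq> add_mset n \<nu>" by auto
        then show ?thesis using False \<mu> \<nu> assms jack_form_powersum_part[of \<mu> "add_mset n \<nu>"] by (simp add: not_in_iff)
      next
        case True
        then obtain \<kappa> where \<kappa>: "\<mu> = add_mset n \<kappa>" by (metis multi_member_split)
        then have "is_partition \<kappa>" using \<mu> by simp
        then show ?thesis using jack_form_powersum_part[of \<mu> "add_mset n \<nu>"] \<mu> \<nu> assms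
          by (auto simp: \<kappa> jack_form_powersum_part z_part_add_mset mult_ac)
      qed
      finally show "jack_form (T (powersum_part \<mu>)) (powersum_part \<nu>) = jack_form (powersum_part \<mu>) (powersum n * powersum_part \<nu>)"
        by simp
    qed
  qed
  with T show ?thesis by (auto simp: is_adjoint_def)
qed

text \<open>Adjoints of products compose and adjoints of sums add, so the basis reduces existence to
  single power sums.\<close>

lemma ex_adjoint: "\<exists>T. is_adjoint f T"
proof -
  have "\<exists>T. is_adjoint (powersum_part \<mu>) T" if "is_partition \<mu>" for \<mu>
    using that
  proof (induction \<mu>)
    case empty
    show ?case by (rule exI[of _ id]) (simp add: is_adjoint_def)
  next
    case (add n \<mu>)
    then obtain T where "is_adjoint (powersum_part \<mu>) T" by auto
    moreover have "n > 0" using add.prems by simp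
    then obtain T' where "is_adjoint (powersum n) T'" using ex_adjoint_powersum by blast
    ultimately show ?case by (intro exI[of _ "T \<circ> T'"]) (simp add: is_adjoint_def mult.assoc)
  qed
  note basis = this
  have "f \<in> symfun.span (powersum_part ` {\<mu>. is_partition \<mu>})" by (simp add: span_powersum_part)
  then show ?thesis
  proof (induction rule: symfun.span_induct_alt)
    case base
    show ?case by (rule exI[of _ "\<lambda>_. 0"]) (simp add: is_adjoint_def)
  next
    case (step c x y)
    then obtain Tx Ty where "is_adjoint x Tx" "is_adjoint y Ty" using basis by blast
    then show ?case
      by (intro exI[of _ "\<lambda>g. scale c (Tx g) + Ty g"]) (simp add: is_adjoint_def distrib_right scale_mult_left)
  qed
qed

lemma is_adjoint_adjoint_op: "is_adjoint f (adjoint_op f)"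
  unfolding adjoint_op_def is_adjoint_def[symmetric]
  using theI'[of "is_adjoint f"] ex_adjoint is_adjoint_unique by blast

lemma jack_form_adjoint_op: "jack_form (adjoint_op f g) h = jack_form g (f * h)"
  using is_adjoint_adjoint_op[of f] by (simp add: is_adjoint_def)

lemma adjoint_op_add: "adjoint_op f (g + h) = adjoint_op f g + adjoint_op f h"
  by (rule jack_form_eqI) (simp add: jack_form_adjoint_op)

lemma adjoint_op_scale: "adjoint_op f (scale c g) = scale c (adjoint_op f g)"
  by (rule jack_form_eqI) (simp add: jack_form_adjoint_op)

lemma adjoint_op_0: "adjoint_op f 0 = 0"
  by (rule jack_form_eqI) (simp add: jack_form_adjoint_op)

lemma adjoint_op_times: "adjoint_op (f * f') g = adjoint_op f (adjoint_op f' g)"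
  by (rule jack_form_eqI) (simp add: jack_form_adjoint_op mult_ac)

lemma adjoint_op_plus: "adjoint_op (f + f') g = adjoint_op f g + adjoint_op f' g"
  by (rule jack_form_eqI) (simp add: jack_form_adjoint_op distrib_right)

lemma adjoint_op_scale_left: "adjoint_op (scale c f) g = scale c (adjoint_op f g)"
  by (rule jack_form_eqI) (simp add: jack_form_adjoint_op scale_mult_left)

lemma adjoint_op_zero: "adjoint_op 0 g = 0"
  by (rule jack_form_eqI) (simp add: jack_form_adjoint_op)

lemma adjoint_op_one: "adjoint_op 1 g = g"
  by (rule jack_form_eqI) (simp add: jack_form_adjoint_op)

lemma adjoint_op_sum: "adjoint_op (sum f A) g = (\<Sum>a\<in>A. adjoint_op (f a) g)"
  by (induction A rule: infinite_finite_induct) (simp_all add: adjoint_op_plus adjoint_op_zero)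

lemma adjoint_op_powersum:
  assumes "n > 0" "is_partition \<mu>"
  shows "adjoint_op (powersum n) (powersum_part \<mu>) =
    scale (alpha * of_nat (n * count \<mu> n)) (powersum_part (\<mu> - {#n#}))"
proof -
  obtain T where T: "is_adjoint (powersum n) T" "T (powersum_part \<mu>) =
      scale (alpha * of_nat (n * count \<mu> n)) (powersum_part (\<mu> - {#n#}))"
    using ex_adjoint_powersum[OF assms(1)] assms(2) by blast
  then show ?thesis using is_adjoint_unique[OF T(1) is_adjoint_adjoint_op] by simp
qed

text \<open>Each factor p_n of the operator lowers the degree by n, and a missing part n gives the
  scalar 0.\<close>

lemma adjoint_powersum_part_vanish:
  assumes "is_partition \<nu>" "is_partition \<mu>" "sum_mset \<mu> < sum_mset \<nu>"
  shows "adjoint_op (powersum_part \<nu>) (powersum_part \<mu>) = 0"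
  using assms
proof (induction \<nu> arbitrary: \<mu>)
  case (add n \<nu>)
  have "adjoint_op (powersum_part (add_mset n \<nu>)) (powersum_part \<mu>) =
    adjoint_op (powersum_part \<nu>) (adjoint_op (powersum n) (powersum_part \<mu>))"
    by (simp add: adjoint_op_times[symmetric] mult.commute)
  also have "\<dots> = scale (alpha * of_nat (n * count \<mu> n)) (adjoint_op (powersum_part \<nu>) (powersum_part (\<mu> - {#n#})))"
    using add.prems by (simp add: adjoint_op_powersum adjoint_op_scale)
  also have "\<dots> = 0"
  proof (cases "n \<in># \<mu>")
    case True
    then have "sum_mset \<mu> = n + sum_mset (\<mu> - {#n#})" by (metis insert_DiffM sum_mset.add_mset)
    then have "adjoint_op (powersum_part \<nu>) (powersum_part (\<mu> - {#n#})) = 0"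
      using add.prems by (intro add.IH) (auto simp: is_partition_diff)
    then show ?thesis by simp
  next
    case False
    then show ?thesis by (simp add: not_in_iff symfun.scale_zero_left)
  qed
  finally show ?case .
qed simp

lemma adjoint_vanish_span:
  assumes "f \<in> symfun.span A" "g \<in> symfun.span B" "\<And>a b. a \<in> A \<Longrightarrow> b \<in> B \<Longrightarrow> adjoint_op a b = 0"
  shows "adjoint_op f g = 0"
  using assms(1)
proof (induction rule: symfun.span_induct_alt)
  case (step c x y)
  from assms(2) have "adjoint_op x g = 0"
    by (induction rule: symfun.span_induct_alt)
       (simp_all add: adjoint_op_0 adjoint_op_add adjoint_op_scale assms(3)[OF step(1)])
  with step show ?case by (simp add: adjoint_op_plus adjoint_op_scale_left)
qed (simp add: adjoint_op_zero)

text \<open>This makes all later sums finite: on \<open>deg_filt d\<close> only partitions of at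
  most d act nontrivially.\<close>

lemma adjoint_aug_monomial_vanish:
  assumes "f \<in> deg_filt d" "is_partition \<mu>" "d < sum_mset \<mu>"
  shows "adjoint_op (aug_monomial \<mu>) f = 0"
  by (rule adjoint_vanish_span[OF aug_monomial_in_span[OF assms(2)] assms(1)[unfolded deg_filt_def]])
     (use assms(3) in \<open>auto intro!: adjoint_powersum_part_vanish\<close>)

text \<open>Adjoints never raise the degree, so a bound chosen for f also serves for the adjoints
  applied to f, which \<open>euler_proj\<close> is applied to later.\<close>

lemma adjoint_deg_filt:
  assumes "g \<in> deg_filt d"
  shows "adjoint_op f g \<in> deg_filt d"
proof -
  have ps: "adjoint_op (powersum n) g \<in> deg_filt d" if "n > 0" "g \<in> deg_filt d" for n g
    using that(2) unfolding deg_filt_def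
  proof (induction rule: symfun.span_induct_alt)
    case base
    then show ?case by (simp add: adjoint_op_0 symfun.span_zero)
  next
    case (step c x y)
    then obtain \<mu> where \<mu>: "is_partition \<mu>" "sum_mset \<mu> \<le> d" "x = powersum_part \<mu>" by auto
    have "sum_mset (\<mu> - {#n#}) \<le> sum_mset \<mu>"
      by (cases "n \<in># \<mu>") (metis insert_DiffM le_add2 sum_mset.add_mset, simp add: diff_single_trivial)
    with \<mu> have "powersum_part (\<mu> - {#n#}) \<in> symfun.span (powersum_part ` {\<mu>. is_partition \<mu> \<and> sum_mset \<mu> \<le> d})"
      by (intro symfun.span_base imageI) (auto simp: is_partition_diff)
    with \<mu> that(1) have "adjoint_op (powersum n) x \<in> symfun.span (powersum_part ` {\<mu>. is_partition \<mu> \<and> sum_mset \<mu> \<le> d})"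
      by (simp add: adjoint_op_powersum symfun.span_scale)
    with step show ?case by (simp add: adjoint_op_add adjoint_op_scale symfun.span_add symfun.span_scale)
  qed
  have part: "adjoint_op (powersum_part \<mu>) g \<in> deg_filt d" if "is_partition \<mu>" "g \<in> deg_filt d" for \<mu> g
    using that
    by (induction \<mu> arbitrary: g) (simp_all add: adjoint_op_one adjoint_op_times ps)
  have "f \<in> symfun.span (powersum_part ` {\<mu>. is_partition \<mu>})" by (simp add: span_powersum_part)
  then show ?thesis
  proof (induction rule: symfun.span_induct_alt)
    case base
    then show ?case by (simp add: adjoint_op_zero deg_filt_def symfun.span_zero)
  next
    case (step c x y)
    then obtain \<mu> where "is_partition \<mu>" "x = powersum_part \<mu>" by auto
    with step part[OF _ assms] show ?case
      unfolding deg_filt_def by (simp add: adjoint_op_plus adjoint_op_scale_left symfun.span_add symfun.span_scale)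
  qed
qed

section \<open>Euler operators on restricted symmetric functions\<close>

definition euler :: "nat \<Rightarrow> mpoly \<Rightarrow> mpoly" where
  "euler i p = X i * partial_deriv i p"

lemma euler_eq: "euler i p = (\<Sum>m\<in>Poly_Mapping.keys p.
    Poly_Mapping.single m (of_nat (Poly_Mapping.lookup m i) * Poly_Mapping.lookup p m))"
  unfolding euler_def partial_deriv_def sum_distrib_left
proof (intro sum.cong refl)
  fix m
  show "X i * Poly_Mapping.single (m - Poly_Mapping.single i 1) (of_nat (Poly_Mapping.lookup m i) * Poly_Mapping.lookup p m) =
    Poly_Mapping.single m (of_nat (Poly_Mapping.lookup m i) * Poly_Mapping.lookup p m)"
  proof (cases "Poly_Mapping.lookup m i = 0")
    case False
    then have "Poly_Mapping.single i 1 + (m - Poly_Mapping.single i 1) = m"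
      by (intro poly_mapping_eqI) (auto simp: lookup_add lookup_minus lookup_single when_def)
    then show ?thesis by (simp add: X_def mult_single)
  qed simp
qed

lemma lookup_euler: "Poly_Mapping.lookup (euler i p) m = of_nat (Poly_Mapping.lookup m i) * Poly_Mapping.lookup p m"
  by (simp add: euler_eq lookup_sum lookup_single when_def in_keys_iff)

lemma euler_add: "euler i (p + q) = euler i p + euler i q"
  by (rule poly_mapping_eqI) (simp add: lookup_euler lookup_add distrib_left)

lemma euler_0 [simp]: "euler i 0 = 0"
  by (rule poly_mapping_eqI) (simp add: lookup_euler)

lemma euler_sum: "euler i (sum f A) = (\<Sum>a\<in>A. euler i (f a))"
  by (induction A rule: infinite_finite_induct) (simp_all add: euler_add)

lemma euler_uminus: "euler i (- p) = - euler i p"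
  by (rule poly_mapping_eqI) (simp add: lookup_euler)

lemma euler_single: "euler i (Poly_Mapping.single m c) = Poly_Mapping.single m (of_nat (Poly_Mapping.lookup m i) * c)"
  by (rule poly_mapping_eqI) (simp add: lookup_euler lookup_single when_def)

lemma euler_mult: "euler i (p * q) = euler i p * q + p * euler i q"
proof -
  let ?l = "Poly_Mapping.lookup"
  have 1: "euler i (Poly_Mapping.single a c * Poly_Mapping.single b d) =
      euler i (Poly_Mapping.single a c) * Poly_Mapping.single b d + Poly_Mapping.single a c * euler i (Poly_Mapping.single b d)" for a b c d
    by (simp add: mult_single euler_single lookup_add single_add[symmetric] algebra_simps)
  have 2: "euler i (Poly_Mapping.single a c * q) =
      euler i (Poly_Mapping.single a c) * q + Poly_Mapping.single a c * euler i q" for a c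
  proof -
    have "euler i (Poly_Mapping.single a c * (\<Sum>b\<in>Poly_Mapping.keys q. Poly_Mapping.single b (?l q b))) =
      euler i (Poly_Mapping.single a c) * (\<Sum>b\<in>Poly_Mapping.keys q. Poly_Mapping.single b (?l q b)) +
      Poly_Mapping.single a c * euler i (\<Sum>b\<in>Poly_Mapping.keys q. Poly_Mapping.single b (?l q b))"
      unfolding sum_distrib_left euler_sum 1 sum.distrib ..
    then show ?thesis by (simp only: poly_mapping_sum_single[symmetric])
  qed
  have "euler i ((\<Sum>a\<in>Poly_Mapping.keys p. Poly_Mapping.single a (?l p a)) * q) =
     euler i (\<Sum>a\<in>Poly_Mapping.keys p. Poly_Mapping.single a (?l p a)) * q +
     (\<Sum>a\<in>Poly_Mapping.keys p. Poly_Mapping.single a (?l p a)) * euler i q"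
    unfolding sum_distrib_right euler_sum 2 sum.distrib ..
  then show ?thesis by (simp only: poly_mapping_sum_single[symmetric])
qed

lemma euler_const [simp]: "euler i (const c) = 0"
  by (simp add: const_def euler_single)

lemma euler_1 [simp]: "euler i 1 = 0"
  using euler_const[of i 1] by simp

lemma euler_const_mult: "euler i (const c * p) = const c * euler i p"
  by (simp add: euler_mult)

lemma euler_X_power: "euler i (X j ^ n) = (if i = j then of_nat n * X j ^ n else 0)"
  by (rule poly_mapping_eqI) (auto simp: lookup_euler lookup_of_nat_mult X_power lookup_single when_def)

lemma euler_powersum:
  assumes "n > 0" "r \<in> {1..N}"
  shows "euler r (proj N (powersum n)) = of_nat n * X r ^ n"
  using assms by (simp add: proj_powersum euler_sum euler_X_power)

text \<open>The Leibniz rule for \<alpha> n times differentiation by p_n, with one factor p_a split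
  off.\<close>

lemma adjoint_op_powersum_leibniz:
  assumes n: "n > 0" and part: "is_partition \<mu>" "a > 0"
  shows "adjoint_op (powersum n) (powersum_part (add_mset a \<mu>)) =
    powersum a * adjoint_op (powersum n) (powersum_part \<mu>) +
    (if n = a then scale (alpha * of_nat a) (powersum_part \<mu>) else 0)"
proof (cases "n = a")
  case False
  then have "n \<in># \<mu> \<Longrightarrow> add_mset a \<mu> - {#n#} = add_mset a (\<mu> - {#n#})" by simp
  then have "scale (alpha * of_nat (n * count \<mu> n)) (powersum_part (add_mset a \<mu> - {#n#})) =
    scale (alpha * of_nat (n * count \<mu> n)) (powersum a * powersum_part (\<mu> - {#n#}))"
    by (cases "n \<in># \<mu>") (simp_all add: not_in_iff)
  then show ?thesis using False adjoint_op_powersum[OF n, of "add_mset a \<mu>"] adjoint_op_powersum[OF n, of \<mu>] part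
    by (simp add: scale_mult_right)
next
  case True
  have "scale (alpha * of_nat (n * count \<mu> n)) (powersum_part \<mu>) =
    scale (alpha * of_nat (n * count \<mu> n)) (powersum n * powersum_part (\<mu> - {#n#}))"
  proof (cases "n \<in># \<mu>")
    case True
    then obtain \<kappa> where "\<mu> = add_mset n \<kappa>" by (metis multi_member_split)
    then show ?thesis by simp
  next
    case False
    then show ?thesis by (simp add: not_in_iff)
  qed
  then show ?thesis using True adjoint_op_powersum[OF n, of "add_mset a \<mu>"] adjoint_op_powersum[OF n, of \<mu>] part
    by (simp add: scale_mult_right distrib_left symfun.scale_left_distrib add.commute)
qed

text \<open>Both sides obey the Leibniz rule, and on a single p_a both are \<alpha> a times the a-th
  power of \<open>X r\<close>.\<close>

lemma euler_proj_powersum_part: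
  assumes r: "r \<in> {1..N}" and part: "is_partition \<mu>" "sum_mset \<mu> \<le> D"
  shows "const alpha * euler r (proj N (powersum_part \<mu>)) =
    (\<Sum>n\<in>{1..D}. X r ^ n * proj N (adjoint_op (powersum n) (powersum_part \<mu>)))"
  using part
proof (induction \<mu>)
  case empty
  have "(\<Sum>n\<in>{1..D}. X r ^ n * proj N (adjoint_op (powersum n) (powersum_part {#}))) = 0"
  proof (intro sum.neutral ballI)
    fix n assume "n \<in> {1..D}"
    then show "X r ^ n * proj N (adjoint_op (powersum n) (powersum_part {#})) = 0"
      using adjoint_op_powersum[of n "{#}"] by simp
  qed
  then show ?case by simp
next
  case (add a \<mu>)
  then have a: "a > 0" "is_partition \<mu>" "a \<in> {1..D}" by auto
  have "(\<Sum>n\<in>{1..D}. X r ^ n * proj N (adjoint_op (powersum n) (powersum_part (add_mset a \<mu>)))) =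
    (\<Sum>n\<in>{1..D}. proj N (powersum a) * (X r ^ n * proj N (adjoint_op (powersum n) (powersum_part \<mu>))) +
      (if n = a then X r ^ a * (const (alpha * of_nat a) * proj N (powersum_part \<mu>)) else 0))"
  proof (intro sum.cong refl)
    fix n assume "n \<in> {1..D}"
    then have n: "n > 0" by simp
    show "X r ^ n * proj N (adjoint_op (powersum n) (powersum_part (add_mset a \<mu>))) =
      proj N (powersum a) * (X r ^ n * proj N (adjoint_op (powersum n) (powersum_part \<mu>))) +
      (if n = a then X r ^ a * (const (alpha * of_nat a) * proj N (powersum_part \<mu>)) else 0)"
      unfolding adjoint_op_powersum_leibniz[OF n a(2,1)] by (simp add: algebra_simps)
  qed
  also have "\<dots> = proj N (powersum a) * (\<Sum>n\<in>{1..D}. X r ^ n * proj N (adjoint_op (powersum n) (powersum_part \<mu>))) +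
     X r ^ a * (const (alpha * of_nat a) * proj N (powersum_part \<mu>))"
    using a(3) by (simp add: sum.distrib sum_distrib_left)
  also have "\<dots> = proj N (powersum a) * (const alpha * euler r (proj N (powersum_part \<mu>))) +
     X r ^ a * (const (alpha * of_nat a) * proj N (powersum_part \<mu>))"
    using add by simp
  also have "\<dots> = const alpha * euler r (proj N (powersum_part (add_mset a \<mu>)))"
    by (simp add: euler_mult euler_powersum[OF a(1) r] const_mult const_of_nat algebra_simps)
  finally show ?case by simp
qed

text \<open>This is where the adjoints of the power sums enter: \<open>\<alpha> x\<^sub>r \<partial>\<^sub>r\<close> is the operator \<open>\<Sum>\<^sub>n x\<^sub>r\<^sup>n p\<^sub>n\<^sup>*\<close>.\<close>

lemma euler_proj:
  assumes r: "r \<in> {1..N}" and f: "f \<in> deg_filt D"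
  shows "const alpha * euler r (proj N f) = (\<Sum>n\<in>{1..D}. X r ^ n * proj N (adjoint_op (powersum n) f))"
  using f unfolding deg_filt_def
proof (induction rule: symfun.span_induct_alt)
  case base
  then show ?case by (simp add: adjoint_op_0)
next
  case (step c x y)
  then obtain \<mu> where \<mu>: "is_partition \<mu>" "sum_mset \<mu> \<le> D" "x = powersum_part \<mu>" by auto
  have "const alpha * euler r (proj N (scale c x + y)) =
     const c * (const alpha * euler r (proj N x)) + const alpha * euler r (proj N y)"
    by (simp add: euler_add euler_const_mult algebra_simps)
  then show ?case
    using step.IH euler_proj_powersum_part[OF r \<mu>(1,2)] \<mu>(3)
    by (simp add: adjoint_op_add adjoint_op_scale sum_distrib_left sum.distrib algebra_simps)
qed

section \<open>Exclusion sums\<close>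

text \<open>Exponents are bounded one by one and not by their total, which makes the set a product
  over \<open>I\<close> and lets one variable be split off by \<open>exp_box_insert\<close>.\<close>

definition exp_box :: "nat set \<Rightarrow> nat \<Rightarrow> (nat \<Rightarrow>\<^sub>0 nat) set" where
  "exp_box I D = {m. Poly_Mapping.keys m = I \<and> (\<forall>i. Poly_Mapping.lookup m i \<le> D)}"

lemma exp_box_empty [simp]: "exp_box {} D = {0}"
  by (auto simp: exp_box_def)

lemma exp_box_insert:
  assumes "r \<notin> I"
  shows "exp_box (insert r I) D = (\<lambda>(m,t). m + Poly_Mapping.single r t) ` (exp_box I D \<times> {1..D})"
proof (intro equalityI subsetI)
  fix m assume m: "m \<in> exp_box (insert r I) D"
  define m0 where "m0 = m - Poly_Mapping.single r (Poly_Mapping.lookup m r)"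
  have "m = m0 + Poly_Mapping.single r (Poly_Mapping.lookup m r)" "Poly_Mapping.keys m0 = Poly_Mapping.keys m - {r}"
    using remove_key[of m r] by (simp_all add: m0_def)
  moreover have "Poly_Mapping.lookup m0 i \<le> D" for i
    using m by (auto simp: m0_def lookup_minus exp_box_def intro: order_trans[OF diff_le_self])
  moreover have "r \<in> Poly_Mapping.keys m" using m by (simp add: exp_box_def)
  ultimately have "(m0, Poly_Mapping.lookup m r) \<in> exp_box I D \<times> {1..D}"
    using m assms by (auto simp: exp_box_def in_keys_iff)
  then show "m \<in> (\<lambda>(m,t). m + Poly_Mapping.single r t) ` (exp_box I D \<times> {1..D})"
    using \<open>m = m0 + _\<close> by (intro image_eqI[of _ _ "(m0, Poly_Mapping.lookup m r)"]) auto
next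
  fix m assume "m \<in> (\<lambda>(m,t). m + Poly_Mapping.single r t) ` (exp_box I D \<times> {1..D})"
  then show "m \<in> exp_box (insert r I) D"
    using assms by (auto simp: exp_box_def keys_add_nat lookup_add lookup_single when_def in_keys_iff)
qed

lemma inj_on_exp_box_insert:
  assumes "r \<notin> I"
  shows "inj_on (\<lambda>(m,t). m + Poly_Mapping.single r t) (exp_box I D \<times> {1..D})"
proof (rule inj_onI, clarify)
  fix m t m' t'
  assume m: "m \<in> exp_box I D" "m' \<in> exp_box I D" and eq: "m + Poly_Mapping.single r t = m' + Poly_Mapping.single r t'"
  have "r \<notin> Poly_Mapping.keys m" "r \<notin> Poly_Mapping.keys m'" using m assms by (auto simp: exp_box_def)
  then have "t = t'" using arg_cong[OF eq, of "\<lambda>m. Poly_Mapping.lookup m r"] by (simp add: lookup_add in_keys_iff)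
  with eq show "m = m' \<and> t = t'" by simp
qed

lemma finite_exp_box: "finite I \<Longrightarrow> finite (exp_box I D)"
  by (induction I rule: finite_induct) (simp_all add: exp_box_insert)

lemma sum_exp_box_insert:
  assumes "r \<notin> I"
  shows "sum g (exp_box (insert r I) D) = (\<Sum>m\<in>exp_box I D. \<Sum>t\<in>{1..D}. g (m + Poly_Mapping.single r t))"
  unfolding exp_box_insert[OF assms]
  by (subst sum.reindex[OF inj_on_exp_box_insert[OF assms]])
     (simp add: o_def case_prod_unfold sum.cartesian_product)

text \<open>The partial fraction decomposition in finite form. Along an antidiagonal s + n = t the
  sum telescopes to \<open>y * x ^ t - x * y ^ t\<close>; the vanishing of \<open>h\<close> beyond D
  lets the square of indices replace the triangle of complete antidiagonals.\<close>

lemma telescoping_exchange: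
  fixes x y :: "'a::comm_ring_1"
  assumes h: "\<And>t. t > D \<Longrightarrow> h t = 0"
  shows "(x - y) * (\<Sum>s\<in>{1..D}. \<Sum>n\<in>{1..D}. x ^ s * y ^ n * h (s + n)) =
    (\<Sum>t\<in>{1..D}. (y * x ^ t - x * y ^ t) * h t)"
proof (cases "D = 0")
  case False
  \<comment> \<open>The index s + n - 1 is chosen so that multiplication by \<open>x\<close> shifts
    s and multiplication by \<open>y\<close> shifts n within the same family, whose two shifted sums
    then cancel up to the first row and column.\<close>
  define c where "c s n = x ^ s * y ^ n * h (s + n - 1)" for s n
  have sh: "(\<Sum>s\<in>{1..D}. f (Suc s)) = (\<Sum>s\<in>{2..D}. f s) + f (Suc D)" for f :: "nat \<Rightarrow> 'a"
  proof -
    have "(\<Sum>s\<in>{1..D}. f (Suc s)) = (\<Sum>s\<in>{Suc 1..Suc D}. f s)"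
      by (subst sum.shift_bounds_cl_Suc_ivl) simp
    also have "\<dots> = (\<Sum>s\<in>{2..D}. f s) + f (Suc D)"
      using False by (simp add: numeral_2_eq_2)
    finally show ?thesis .
  qed
  have first: "(\<Sum>s\<in>{1..D}. f s) = f 1 + (\<Sum>s\<in>{2..D}. f s)" for f :: "nat \<Rightarrow> 'a"
    using False by (subst sum.atLeast_Suc_atMost) (simp_all add: numeral_2_eq_2)
  have c0: "c (Suc D) n = 0" "c n (Suc D) = 0" if "n \<in> {1..D}" for n
    using that by (simp_all add: c_def h)
  have "(x - y) * (\<Sum>s\<in>{1..D}. \<Sum>n\<in>{1..D}. x ^ s * y ^ n * h (s + n)) =
     (\<Sum>s\<in>{1..D}. \<Sum>n\<in>{1..D}. c (Suc s) n) - (\<Sum>s\<in>{1..D}. \<Sum>n\<in>{1..D}. c s (Suc n))"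
    unfolding sum_distrib_left sum_subtractf[symmetric] by (intro sum.cong refl) (simp add: c_def algebra_simps)
  also have "(\<Sum>s\<in>{1..D}. \<Sum>n\<in>{1..D}. c (Suc s) n) = (\<Sum>s\<in>{2..D}. \<Sum>n\<in>{1..D}. c s n)"
    using sh[of "\<lambda>s. \<Sum>n\<in>{1..D}. c s n"] c0(1) by simp
  also have "(\<Sum>s\<in>{1..D}. \<Sum>n\<in>{1..D}. c s (Suc n)) = (\<Sum>s\<in>{1..D}. \<Sum>n\<in>{2..D}. c s n)"
    using sh c0(2) by simp
  also have "(\<Sum>s\<in>{2..D}. \<Sum>n\<in>{1..D}. c s n) - (\<Sum>s\<in>{1..D}. \<Sum>n\<in>{2..D}. c s n) =
     (\<Sum>s\<in>{2..D}. c s 1) - (\<Sum>n\<in>{2..D}. c 1 n)"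
    unfolding first by (simp add: sum.distrib)
  also have "\<dots> = (\<Sum>t\<in>{1..D}. c t 1) - (\<Sum>t\<in>{1..D}. c 1 t)"
    unfolding first by simp
  also have "\<dots> = (\<Sum>t\<in>{1..D}. (y * x ^ t - x * y ^ t) * h t)"
    unfolding sum_subtractf[symmetric] by (intro sum.cong refl) (simp add: c_def algebra_simps)
  finally show ?thesis .
qed simp

text \<open>With \<open>p\<^sub>n\<^sup>*\<close> read as the power sums of further variables \<open>y\<close>, this is the sum over injective
  \<open>j\<close> on \<open>I\<close> of the products over \<open>i \<in> I\<close> of \<open>x i * y (j i) / (1 - x i * y (j i))\<close>; injectivity is what
  makes \<open>aug_monomial\<close> appear. If \<open>f \<in> deg_filt D\<close>, the bound \<open>D\<close> only discards vanishing terms.\<close>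

definition excl_sum :: "nat \<Rightarrow> nat \<Rightarrow> symfun \<Rightarrow> nat set \<Rightarrow> mpoly" where
  "excl_sum N D f I = (\<Sum>m\<in>exp_box I D. Poly_Mapping.single m 1 * proj N (adjoint_op (aug_monomial (mtype m)) f))"

lemma excl_sum_empty: "excl_sum N D f {} = proj N f"
  by (simp add: excl_sum_def mtype_def adjoint_op_one)

lemma single_mult_X_power: "Poly_Mapping.single m (1 :: ratfun) * X r ^ n = Poly_Mapping.single (m + Poly_Mapping.single r n) 1"
  by (simp add: X_power mult_single)

text \<open>\<open>Z a\<close> collects the terms in which the power sum raises the exponent at a.
  It is characterised with the denominator cleared, since \<open>mpoly\<close> admits no
  division.\<close>

lemma euler_excl_sum:
  assumes r: "r \<in> {1..N}" "r \<notin> I" and I: "I \<subseteq> {1..N}" and f: "f \<in> deg_filt D"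
  shows "\<exists>Z. const alpha * euler r (excl_sum N D f I) = excl_sum N D f (insert r I) + (\<Sum>a\<in>I. Z a) \<and>
    (\<forall>a\<in>I. (X a - X r) * Z a = X r * excl_sum N D f I - X a * excl_sum N D f (insert r (I - {a})))"
proof -
  define h where "h m = proj N (adjoint_op (aug_monomial (mtype m)) f)" for m
  define x where "x m = (Poly_Mapping.single m 1 :: mpoly)" for m
  define Z where "Z a = (\<Sum>m\<in>exp_box I D. \<Sum>n\<in>{1..D}. x m * X r ^ n * h (m + Poly_Mapping.single a n))" for a
  have finI: "finite I" using I finite_subset by blast
  have h0: "h m = 0" if "mdeg m > D" for m
    using adjoint_aug_monomial_vanish[OF f is_partition_mtype] that by (simp add: h_def sum_mset_mtype)
  have E: "excl_sum N D f J = (\<Sum>m\<in>exp_box J D. x m * h m)" for J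
    by (simp add: excl_sum_def h_def x_def)
  have xadd: "x m * X a ^ n = x (m + Poly_Mapping.single a n)" for m a n
    by (simp add: x_def single_mult_X_power)
  have "const alpha * euler r (excl_sum N D f I) = (\<Sum>m\<in>exp_box I D. x m * (const alpha * euler r (h m)))"
  proof -
    \<comment> \<open>The monomial has support \<open>I\<close>, which omits r, so the Euler
      operator passes to the projected adjoint.\<close>
    have "euler r (x m) = 0" if "m \<in> exp_box I D" for m
      using that r(2) by (auto simp: x_def euler_single exp_box_def in_keys_iff)
    then show ?thesis
      unfolding E euler_sum sum_distrib_left by (intro sum.cong refl) (simp add: euler_mult mult_ac)
  qed
  also have "\<dots> = (\<Sum>m\<in>exp_box I D. \<Sum>n\<in>{1..D}. x m * X r ^ n * h (m + Poly_Mapping.single r n) +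
      (\<Sum>a\<in>I. x m * X r ^ n * h (m + Poly_Mapping.single a n)))"
  proof (rule sum.cong[OF refl])
    fix m assume m: "m \<in> exp_box I D"
    then have km: "Poly_Mapping.keys m = I" by (simp add: exp_box_def)
    have "const alpha * euler r (h m) = (\<Sum>n\<in>{1..D}. X r ^ n * proj N (adjoint_op (powersum n) (adjoint_op (aug_monomial (mtype m)) f)))"
      unfolding h_def by (rule euler_proj[OF r(1) adjoint_deg_filt[OF f]])
    also have "\<dots> = (\<Sum>n\<in>{1..D}. X r ^ n * (h (m + Poly_Mapping.single r n) + (\<Sum>a\<in>I. h (m + Poly_Mapping.single a n))))"
    proof (rule sum.cong[OF refl])
      fix n assume "n \<in> {1..D}"
      then have n: "n > 0" by simp
      have "adjoint_op (powersum n) (adjoint_op (aug_monomial (mtype m)) f) =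
        adjoint_op (powersum n * aug_monomial (mtype m)) f" by (simp add: adjoint_op_times)
      also have "\<dots> = adjoint_op (aug_monomial (mtype (m + Poly_Mapping.single r n))) f +
         (\<Sum>a\<in>I. adjoint_op (aug_monomial (mtype (m + Poly_Mapping.single a n))) f)"
        using powersum_times_aug_monomial_exps[OF n, of r m] km r(2) by (simp add: adjoint_op_plus adjoint_op_sum)
      finally show "X r ^ n * proj N (adjoint_op (powersum n) (adjoint_op (aug_monomial (mtype m)) f)) =
         X r ^ n * (h (m + Poly_Mapping.single r n) + (\<Sum>a\<in>I. h (m + Poly_Mapping.single a n)))"
        by (simp add: h_def proj_sum)
    qed
    finally show "x m * (const alpha * euler r (h m)) = (\<Sum>n\<in>{1..D}. x m * X r ^ n * h (m + Poly_Mapping.single r n) +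
      (\<Sum>a\<in>I. x m * X r ^ n * h (m + Poly_Mapping.single a n)))"
      by (simp add: sum_distrib_left distrib_left mult.assoc)
  qed
  also have "\<dots> = excl_sum N D f (insert r I) + (\<Sum>a\<in>I. Z a)"
  proof -
    have "(\<Sum>m\<in>exp_box I D. \<Sum>n\<in>{1..D}. \<Sum>a\<in>I. x m * X r ^ n * h (m + Poly_Mapping.single a n)) = (\<Sum>a\<in>I. Z a)"
      unfolding Z_def by (rule trans[OF sum.cong[OF refl sum.swap] sum.swap])
    then show ?thesis
      by (simp add: E sum_exp_box_insert[OF r(2)] xadd sum.distrib)
  qed
  finally have 1: "const alpha * euler r (excl_sum N D f I) = excl_sum N D f (insert r I) + (\<Sum>a\<in>I. Z a)" .
  have 2: "(X a - X r) * Z a = X r * excl_sum N D f I - X a * excl_sum N D f (insert r (I - {a}))" if a: "a \<in> I" for a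
  proof -
    define I0 where "I0 = I - {a}"
    have I: "I = insert a I0" "a \<notin> I0" "r \<notin> I0" using a r(2) by (auto simp: I0_def)
    \<comment> \<open>Both r and a lie outside the support of m, so placing t at either gives the
      same type. This is how a set with a exchanged for r enters.\<close>
    have hr: "h (m + Poly_Mapping.single r t) = h (m + Poly_Mapping.single a t)" if "m \<in> exp_box I0 D" "t \<in> {1..D}" for m t
      using that I by (simp add: h_def mtype_add_single exp_box_def)
    have "Z a = (\<Sum>m\<in>exp_box I0 D. \<Sum>s\<in>{1..D}. \<Sum>n\<in>{1..D}.
       x (m + Poly_Mapping.single a s) * X r ^ n * h (m + Poly_Mapping.single a s + Poly_Mapping.single a n))"
      unfolding Z_def I(1) sum_exp_box_insert[OF I(2)] ..
    also have "\<dots> = (\<Sum>m\<in>exp_box I0 D. x m * (\<Sum>s\<in>{1..D}. \<Sum>n\<in>{1..D}.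
       X a ^ s * X r ^ n * h (m + Poly_Mapping.single a (s + n))))"
      unfolding xadd[symmetric] sum_distrib_left by (simp add: single_add add.assoc mult.assoc)
    finally have Z': "Z a = (\<Sum>m\<in>exp_box I0 D. x m * (\<Sum>s\<in>{1..D}. \<Sum>n\<in>{1..D}.
       X a ^ s * X r ^ n * h (m + Poly_Mapping.single a (s + n))))" .
    have "(X a - X r) * Z a = (\<Sum>m\<in>exp_box I0 D. x m * ((X a - X r) * (\<Sum>s\<in>{1..D}. \<Sum>n\<in>{1..D}.
       X a ^ s * X r ^ n * h (m + Poly_Mapping.single a (s + n)))))"
      unfolding Z' by (subst sum_distrib_left) (simp only: mult.left_commute)
    also have "\<dots> = (\<Sum>m\<in>exp_box I0 D. x m * (\<Sum>t\<in>{1..D}. (X r * X a ^ t - X a * X r ^ t) * h (m + Poly_Mapping.single a t)))"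
    proof (rule sum.cong[OF refl])
      fix m
      have "(X a - X r) * (\<Sum>s\<in>{1..D}. \<Sum>n\<in>{1..D}. X a ^ s * X r ^ n * h (m + Poly_Mapping.single a (s + n))) =
        (\<Sum>t\<in>{1..D}. (X r * X a ^ t - X a * X r ^ t) * h (m + Poly_Mapping.single a t))"
      proof (rule telescoping_exchange)
        fix t assume "t > D"
        then have "mdeg (m + Poly_Mapping.single a t) > D" by (simp add: mdeg_add mdeg_def[of "Poly_Mapping.single a t"])
        then show "h (m + Poly_Mapping.single a t) = 0" by (rule h0)
      qed
      then show "x m * ((X a - X r) * (\<Sum>s\<in>{1..D}. \<Sum>n\<in>{1..D}. X a ^ s * X r ^ n * h (m + Poly_Mapping.single a (s + n)))) =
        x m * (\<Sum>t\<in>{1..D}. (X r * X a ^ t - X a * X r ^ t) * h (m + Poly_Mapping.single a t))"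
        by (rule arg_cong)
    qed
    also have "\<dots> = X r * (\<Sum>m\<in>exp_box I0 D. \<Sum>t\<in>{1..D}. x (m + Poly_Mapping.single a t) * h (m + Poly_Mapping.single a t))
        - X a * (\<Sum>m\<in>exp_box I0 D. \<Sum>t\<in>{1..D}. x (m + Poly_Mapping.single r t) * h (m + Poly_Mapping.single r t))"
      unfolding sum_distrib_left sum_subtractf[symmetric] xadd[symmetric]
      by (intro sum.cong refl) (simp add: hr algebra_simps)
    also have "\<dots> = X r * excl_sum N D f I - X a * excl_sum N D f (insert r I0)"
      unfolding E I(1) sum_exp_box_insert[OF I(2)] sum_exp_box_insert[OF I(3)] ..
    finally show ?thesis by (simp add: I0_def)
  qed
  show ?thesis using 1 2 by blast
qed

lemma finite_partitions_box: "finite {\<mu>. is_partition \<mu> \<and> size \<mu> = k \<and> set_mset \<mu> \<subseteq> {..D}}"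
proof -
  have "{\<mu>. is_partition \<mu> \<and> size \<mu> = k \<and> set_mset \<mu> \<subseteq> {..D}} \<subseteq> mset ` {xs. set xs \<subseteq> {..D} \<and> length xs = k}"
    by (metis (mono_tags, lifting) ex_mset image_eqI mem_Collect_eq set_mset_mset size_mset subsetI)
  then show ?thesis by (rule finite_subset) (simp add: finite_lists_length_eq)
qed

text \<open>Both sides run over the exponent vectors with k nonzero entries, all at most D, grouped
  by support on the left and by type on the right. One factor \<open>c_part\<close> suffices, since
  the monomials of a type are distinct.\<close>

lemma sum_excl_sum:
  "(\<Sum>I | I \<subseteq> {1..N} \<and> card I = k. excl_sum N D f I) =
   proj N (\<Sum>\<mu> | is_partition \<mu> \<and> size \<mu> = k \<and> set_mset \<mu> \<subseteq> {..D}. of_nat (c_part \<mu>) * monomial_sym \<mu> * adjoint_op (monomial_sym \<mu>) f)"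
proof -
  let ?P = "{\<mu>. is_partition \<mu> \<and> size \<mu> = k \<and> set_mset \<mu> \<subseteq> {..D}}"
  let ?A = "{m :: nat \<Rightarrow>\<^sub>0 nat. Poly_Mapping.keys m \<subseteq> {1..N} \<and> card (Poly_Mapping.keys m) = k \<and> (\<forall>i. Poly_Mapping.lookup m i \<le> D)}"
  let ?g = "\<lambda>m. Poly_Mapping.single m 1 * proj N (adjoint_op (aug_monomial (mtype m)) f)"
  note finP = finite_partitions_box[of k D]
  have finI: "finite {I. I \<subseteq> {1..N} \<and> card I = k}" by simp
  have "(\<Sum>I | I \<subseteq> {1..N} \<and> card I = k. excl_sum N D f I) = (\<Sum>m\<in>(\<Union>I\<in>{I. I \<subseteq> {1..N} \<and> card I = k}. exp_box I D). ?g m)"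
    unfolding excl_sum_def
  proof (rule sum.UNION_disjoint[symmetric, OF finI])
    show "\<forall>I\<in>{I. I \<subseteq> {1..N} \<and> card I = k}. finite (exp_box I D)"
      using finite_exp_box finite_subset[of _ "{1..N}"] by blast
  qed (auto simp: exp_box_def)
  also have "(\<Union>I\<in>{I. I \<subseteq> {1..N} \<and> card I = k}. exp_box I D) = ?A"
    by (auto simp: exp_box_def)
  also have "?A = (\<Union>\<mu>\<in>?P. mon_exps N \<mu>)"
  proof -
    have "(\<forall>i. Poly_Mapping.lookup m i \<le> D) \<longleftrightarrow> set_mset (mtype m) \<subseteq> {..D}" for m
      by (auto simp: mtype_def image_subset_iff) (metis in_keys_iff le0)
    then show ?thesis by (auto simp: mon_exps_mtype size_mtype is_partition_mtype)
  qed
  also have "(\<Sum>m\<in>(\<Union>\<mu>\<in>?P. mon_exps N \<mu>). ?g m) = (\<Sum>\<mu>\<in>?P. \<Sum>m\<in>mon_exps N \<mu>. ?g m)"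
  proof (rule sum.UNION_disjoint[OF finP])
    show "\<forall>\<mu>\<in>?P. finite (mon_exps N \<mu>)" by (simp add: finite_mon_exps)
  qed (auto simp: mon_exps_mtype)
  also have "\<dots> = (\<Sum>\<mu>\<in>?P. proj N (of_nat (c_part \<mu>) * monomial_sym \<mu> * adjoint_op (monomial_sym \<mu>) f))"
  proof (rule sum.cong[OF refl])
    fix \<mu>
    have "(\<Sum>m\<in>mon_exps N \<mu>. ?g m) = (\<Sum>m\<in>mon_exps N \<mu>. Poly_Mapping.single m 1 * proj N (adjoint_op (aug_monomial \<mu>) f))"
      by (intro sum.cong refl) (auto simp: mon_exps_mtype)
    also have "\<dots> = proj N (monomial_sym \<mu>) * proj N (adjoint_op (aug_monomial \<mu>) f)"
      by (simp add: proj_monomial_sym sum_distrib_right)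
    also have "adjoint_op (aug_monomial \<mu>) f = of_nat (c_part \<mu>) * adjoint_op (monomial_sym \<mu>) f"
      unfolding aug_monomial_def scale_of_nat[symmetric] by (simp add: adjoint_op_scale_left)
    finally show "(\<Sum>m\<in>mon_exps N \<mu>. ?g m) = proj N (of_nat (c_part \<mu>) * monomial_sym \<mu> * adjoint_op (monomial_sym \<mu>) f)"
      by (simp add: mult_ac)
  qed
  finally show ?thesis by (simp add: proj_sum)
qed

section \<open>The factors of the determinant as operators on polynomials in u\<close>

definition euler_coeffs :: "nat \<Rightarrow> mpoly poly \<Rightarrow> mpoly poly" where
  "euler_coeffs r g = map_poly (\<lambda>h. const alpha * euler r h) g"

lemma coeff_euler_coeffs: "coeff (euler_coeffs r g) n = const alpha * euler r (coeff g n)"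
  by (simp add: euler_coeffs_def coeff_map_poly)

lemma SD_factor_eq: "SD_factor N s i g = [:X i ^ (N - s):] * ([:of_nat s - 1, 1:] * g - euler_coeffs i g)"
  by (simp add: SD_factor_def euler_coeffs_def euler_def mult.assoc)

lemma euler_coeffs_add: "euler_coeffs r (f + g) = euler_coeffs r f + euler_coeffs r g"
  by (rule poly_eqI) (simp add: coeff_euler_coeffs euler_add distrib_left)

lemma euler_coeffs_0 [simp]: "euler_coeffs r 0 = 0"
  by (rule poly_eqI) (simp add: coeff_euler_coeffs)

lemma euler_coeffs_uminus: "euler_coeffs r (- f) = - euler_coeffs r f"
  by (rule poly_eqI) (simp add: coeff_euler_coeffs euler_uminus)

lemma euler_coeffs_diff: "euler_coeffs r (f - g) = euler_coeffs r f - euler_coeffs r g"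
  using euler_coeffs_add[of r f "- g"] by (simp add: euler_coeffs_uminus)

lemma euler_coeffs_sum: "euler_coeffs r (sum f A) = (\<Sum>a\<in>A. euler_coeffs r (f a))"
  by (induction A rule: infinite_finite_induct) (simp_all add: euler_coeffs_add)

lemma euler_coeffs_mult: "euler_coeffs r (f * g) = euler_coeffs r f * g + f * euler_coeffs r g"
proof (rule poly_eqI)
  fix n
  show "coeff (euler_coeffs r (f * g)) n = coeff (euler_coeffs r f * g + f * euler_coeffs r g) n"
    unfolding coeff_add coeff_mult coeff_euler_coeffs euler_sum euler_mult sum_distrib_left sum.distrib[symmetric]
    by (intro sum.cong refl) (simp add: algebra_simps)
qed

lemma euler_coeffs_pCons: "euler_coeffs r (pCons a p) = pCons (const alpha * euler r a) (euler_coeffs r p)"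
  by (rule poly_eqI) (simp add: coeff_euler_coeffs coeff_pCons split: nat.split)

lemma euler_coeffs_1 [simp]: "euler_coeffs r 1 = 0"
  by (simp add: one_pCons euler_coeffs_pCons)

lemma euler_coeffs_of_nat [simp]: "euler_coeffs r (of_nat n) = 0"
  by (induction n) (simp_all add: euler_coeffs_add)

lemma euler_coeffs_power_uminus_1 [simp]: "euler_coeffs r ((- 1) ^ n) = 0"
  by (induction n) (simp_all add: euler_coeffs_mult euler_coeffs_uminus)

lemma euler_of_nat [simp]: "euler r (of_nat n) = 0"
  by (induction n) (simp_all add: euler_add)

lemma euler_diff: "euler r (p - q) = euler r p - euler r q"
  using euler_add[of r p "- q"] by (simp add: euler_uminus)

lemma euler_coeffs_linear_factor [simp]: "euler_coeffs r [:of_nat s - 1, 1:] = 0" "euler_coeffs r [:0, 1:] = 0"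
  by (simp_all add: euler_coeffs_pCons euler_diff)

lemma euler_coeffs_pochhammer:
  assumes "euler_coeffs r z = 0"
  shows "euler_coeffs r (pochhammer z m) = 0"
  by (induction m) (simp_all add: pochhammer_Suc euler_coeffs_mult euler_coeffs_add assms)

lemma euler_coeffs_commute: "euler_coeffs i (euler_coeffs j g) = euler_coeffs j (euler_coeffs i g)"
  by (rule poly_eqI, rule poly_mapping_eqI) (simp add: coeff_euler_coeffs euler_const_mult lookup_const_mult lookup_euler)

text \<open>For distinct rows the power of one variable is a constant for the Euler operator of the
  other. Within a row this would fail, but a term of the determinant uses each row once.\<close>

lemma SD_factor_commute:
  assumes "i \<noteq> j"
  shows "SD_factor N s i (SD_factor N t j g) = SD_factor N t j (SD_factor N s i g)"
proof -
  have z: "euler_coeffs i [:X j ^ n:] = 0" "euler_coeffs j [:X i ^ n:] = 0" for n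
    using assms by (simp_all add: euler_coeffs_pCons euler_X_power)
  define a where "a = [:X i ^ (N - s):]"
  define b where "b = [:X j ^ (N - t):]"
  define K where "K = [:of_nat s - 1, 1 :: mpoly:]"
  define L where "L = [:of_nat t - 1, 1 :: mpoly:]"
  have "euler_coeffs i b = 0" "euler_coeffs j a = 0" "euler_coeffs i L = 0" "euler_coeffs j K = 0"
    using z by (simp_all add: a_def b_def K_def L_def)
  then show ?thesis
    unfolding SD_factor_eq a_def[symmetric] b_def[symmetric] K_def[symmetric] L_def[symmetric]
    by (simp add: euler_coeffs_mult euler_coeffs_diff euler_coeffs_commute[of i j] algebra_simps)
qed

lemma SD_factor_add: "SD_factor N s i (f + g) = SD_factor N s i f + SD_factor N s i g"
  unfolding SD_factor_eq euler_coeffs_add by (simp only: distrib_left add_diff_add right_diff_distrib)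

lemma SD_factor_0 [simp]: "SD_factor N s i 0 = 0"
  by (simp add: SD_factor_eq)

lemma SD_factor_sum: "SD_factor N s i (sum f A) = (\<Sum>a\<in>A. SD_factor N s i (f a))"
  by (induction A rule: infinite_finite_induct) (simp_all add: SD_factor_add)

lemma SD_factor_sign: "SD_factor N s i (of_int (sign p) * g) = of_int (sign p) * SD_factor N s i g"
proof -
  have "SD_factor N s i (- g) = - SD_factor N s i g"
    using SD_factor_add[of N s i "- g" g] by (simp add: eq_neg_iff_add_eq_0)
  then show ?thesis by (cases rule: sign_cases[of p]) simp_all
qed

section \<open>Expansion along columns\<close>

text \<open>The factors of one term commute, so they can be listed by column;
  \<open>inv \<sigma>\<close> names the row used in a column.\<close>

lemma foldr_SD_factor_columns:
  assumes \<sigma>: "\<sigma> permutes {1..N}"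
  shows "foldr (\<lambda>i. SD_factor N (\<sigma> i) i) [1..<Suc N] g = foldr (\<lambda>j. SD_factor N j (inv \<sigma> j)) [1..<Suc N] g"
proof -
  let ?F = "\<lambda>i. SD_factor N (\<sigma> i) i"
  have comm: "?F i \<circ> ?F j = ?F j \<circ> ?F i" for i j
    by (cases "i = j") (auto simp: SD_factor_commute fun_eq_iff)
  have img: "inv \<sigma> ` {1..N} = {1..N}" by (rule permutes_image[OF permutes_inv[OF \<sigma>]])
  have inj: "inj_on (inv \<sigma>) {1..N}" using permutes_inj[OF permutes_inv[OF \<sigma>]] by (rule inj_on_subset) simp
  have "mset (map (inv \<sigma>) [1..<Suc N]) = image_mset (inv \<sigma>) (mset_set {1..N})"
    by (simp only: mset_map mset_upt atLeastLessThanSuc_atLeastAtMost)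
  also have "\<dots> = mset_set {1..N}"
    using image_mset_mset_set[OF inj] img by simp
  also have "\<dots> = mset [1..<Suc N]" by (simp only: mset_upt atLeastLessThanSuc_atLeastAtMost)
  finally have ms: "mset (map (inv \<sigma>) [1..<Suc N]) = mset [1..<Suc N]" .
  have "foldr ?F [1..<Suc N] = foldr ?F (map (inv \<sigma>) [1..<Suc N])"
    unfolding foldr_conv_fold by (rule fold_multiset_equiv) (use comm ms in \<open>auto simp del: upt_Suc\<close>)
  also have "\<dots> = foldr (?F \<circ> inv \<sigma>) [1..<Suc N]" by (rule ext) (rule foldr_map)
  also have "?F \<circ> inv \<sigma> = (\<lambda>j. SD_factor N j (inv \<sigma> j))"
    using permutes_inverses(1)[OF \<sigma>] by (simp add: fun_eq_iff)
  finally show ?thesis by simp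
qed

text \<open>In terms of the absolute column index \<open>j\<close> the factors do not involve \<open>k\<close>, so deleting column \<open>k\<close> and
  any row leaves a determinant of the same kind for \<open>k + 1\<close>; in rows this would fail.\<close>

definition column_det :: "nat \<Rightarrow> nat \<Rightarrow> (nat \<Rightarrow> nat) \<Rightarrow> mpoly poly \<Rightarrow> mpoly poly" where
  "column_det N k \<rho> g = (\<Sum>p | p permutes {k..N}. of_int (sign p) * foldr (\<lambda>j. SD_factor N j (\<rho> (p j))) [k..<Suc N] g)"

lemma SD_op_eq: "SD_op N f = inverse (to_fract [:vandermonde N:]) * to_fract (column_det N 1 id [:f:])"
proof -
  have tsum: "to_fract (sum h A) = (\<Sum>a\<in>A. to_fract (h a))" for h :: "(nat \<Rightarrow> nat) \<Rightarrow> mpoly poly" and A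
    by (induction A rule: infinite_finite_induct) simp_all
  have "(\<Sum>\<sigma> | \<sigma> permutes {1..N}. of_int (sign \<sigma>) * foldr (\<lambda>i. SD_factor N (\<sigma> i) i) [1..<Suc N] [:f:]) =
    (\<Sum>\<sigma> | \<sigma> permutes {1..N}. of_int (sign \<sigma>) * foldr (\<lambda>j. SD_factor N j (inv \<sigma> j)) [1..<Suc N] [:f:])"
    by (intro sum.cong refl arg_cong2[of _ _ _ _ "(*)"] foldr_SD_factor_columns) simp
  also have "\<dots> = (\<Sum>\<sigma> | \<sigma> permutes {1..N}. of_int (sign (inv \<sigma>)) * foldr (\<lambda>j. SD_factor N j (inv \<sigma> j)) [1..<Suc N] [:f:])"
    using permutes_imp_permutation[of "{1..N}"] by (intro sum.cong refl) (simp add: sign_inverse del: upt_Suc)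
  also have "\<dots> = column_det N 1 id [:f:]"
    unfolding column_det_def
    by (subst sum_permutations_inverse[of _ "{1..N}"]) (simp add: permutes_inv_inv del: upt_Suc cong: sum.cong)
  finally have det: "(\<Sum>\<sigma> | \<sigma> permutes {1..N}. of_int (sign \<sigma>) * foldr (\<lambda>i. SD_factor N (\<sigma> i) i) [1..<Suc N] [:f:])
    = column_det N 1 id [:f:]" .
  show ?thesis
    unfolding SD_op_def to_fract_def[symmetric] tsum[symmetric] det ..
qed

text \<open>Laplace expansion along column k. A permutation of the remaining indices is uniquely
  \<open>transpose k b \<circ> q\<close> with q fixing k; the transposition is absorbed into the
  labelling \<open>\<rho>\<close>, so row b is relabelled and the minor again has consecutive
  indices.\<close>

lemma column_det_Suc:
  assumes k: "k \<le> N"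
  shows "column_det N k \<rho> g = (\<Sum>b\<in>{k..N}. of_int (sign (transpose k b)) *
    SD_factor N k (\<rho> b) (column_det N (Suc k) (\<rho> \<circ> transpose k b) g))"
proof -
  have ins: "{k..N} = insert k {Suc k..N}" using k by auto
  have upt: "[k..<Suc N] = k # [Suc k..<Suc N]" using k by (simp add: upt_conv_Cons del: upt_Suc)
  let ?f = "\<lambda>p. of_int (sign p) * foldr (\<lambda>j. SD_factor N j (\<rho> (p j))) [k..<Suc N] g"
  have "column_det N k \<rho> g = (\<Sum>b\<in>{k..N}. \<Sum>q | q permutes {Suc k..N}. ?f (transpose k b \<circ> q))"
    unfolding column_det_def ins by (rule sum_over_permutations_insert) auto
  also have "\<dots> = (\<Sum>b\<in>{k..N}. \<Sum>q | q permutes {Suc k..N}. of_int (sign (transpose k b)) *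
     SD_factor N k (\<rho> b) (of_int (sign q) * foldr (\<lambda>j. SD_factor N j ((\<rho> \<circ> transpose k b) (q j))) [Suc k..<Suc N] g))"
  proof (intro sum.cong refl)
    fix b q assume q: "q \<in> {q. q permutes {Suc k..N}}"
    then have qk: "q k = k" by (simp add: permutes_not_in)
    have "sign (transpose k b \<circ> q) = sign (transpose k b) * sign q"
      using q by (intro sign_compose permutation_swap_id) (auto intro: permutes_imp_permutation)
    then show "?f (transpose k b \<circ> q) = of_int (sign (transpose k b)) *
     SD_factor N k (\<rho> b) (of_int (sign q) * foldr (\<lambda>j. SD_factor N j ((\<rho> \<circ> transpose k b) (q j))) [Suc k..<Suc N] g)"
      unfolding upt SD_factor_sign by (simp add: qk mult.assoc del: upt_Suc)
  qed
  finally show ?thesis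
    by (simp add: column_det_def SD_factor_sum sum_distrib_left del: upt_Suc)
qed

section \<open>Vandermonde products\<close>

definition vdm :: "(nat \<Rightarrow> 'a::comm_ring_1) \<Rightarrow> nat set \<Rightarrow> 'a" where
  "vdm x A = (\<Prod>j\<in>A. \<Prod>i\<in>{i\<in>A. i < j}. x i - x j)"

lemma vandermonde_eq_vdm: "vandermonde N = vdm X {1..N}"
  unfolding vandermonde_def vdm_def by (intro prod.cong refl) auto

lemma vdm_insert:
  assumes A: "finite A" "b \<notin> A"
  shows "vdm x (insert b A) = (\<Prod>i\<in>A. if i < b then x i - x b else x b - x i) * vdm x A"
proof -
  have 1: "{i\<in>insert b A. i < b} = {i\<in>A. i < b}" by auto
  have 2: "(\<Prod>i\<in>{i\<in>insert b A. i < j}. x i - x j) = (if b < j then x b - x j else 1) * (\<Prod>i\<in>{i\<in>A. i < j}. x i - x j)"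
    if "j \<in> A" for j
  proof (cases "b < j")
    case True
    then have "{i\<in>insert b A. i < j} = insert b {i\<in>A. i < j}" by auto
    then show ?thesis using A True by simp
  next
    case False
    then have "{i\<in>insert b A. i < j} = {i\<in>A. i < j}" by auto
    then show ?thesis using False by simp
  qed
  have "vdm x (insert b A) = (\<Prod>i\<in>{i\<in>A. i < b}. x i - x b) * (\<Prod>j\<in>A. (if b < j then x b - x j else 1) * (\<Prod>i\<in>{i\<in>A. i < j}. x i - x j))"
  proof -
    have "vdm x (insert b A) = (\<Prod>i\<in>{i\<in>insert b A. i < b}. x i - x b) * (\<Prod>j\<in>A. \<Prod>i\<in>{i\<in>insert b A. i < j}. x i - x j)"
      unfolding vdm_def by (rule prod.insert[OF A])
    also have "(\<Prod>j\<in>A. \<Prod>i\<in>{i\<in>insert b A. i < j}. x i - x j) =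
      (\<Prod>j\<in>A. (if b < j then x b - x j else 1) * (\<Prod>i\<in>{i\<in>A. i < j}. x i - x j))"
      by (rule prod.cong[OF refl 2])
    finally show ?thesis unfolding 1 .
  qed
  also have "(\<Prod>i\<in>{i\<in>A. i < b}. x i - x b) = (\<Prod>i\<in>A. if i < b then x i - x b else 1)"
    using A by (simp add: prod.inter_filter)
  also have "\<dots> * (\<Prod>j\<in>A. (if b < j then x b - x j else 1) * (\<Prod>i\<in>{i\<in>A. i < j}. x i - x j)) =
    (\<Prod>i\<in>A. (if i < b then x i - x b else 1) * (if b < i then x b - x i else 1)) * vdm x A"
    by (simp add: vdm_def prod.distrib mult.assoc)
  also have "(\<Prod>i\<in>A. (if i < b then x i - x b else 1) * (if b < i then x b - x i else 1)) = (\<Prod>i\<in>A. if i < b then x i - x b else x b - x i)"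
    using A by (intro prod.cong) (auto simp: not_less le_less)
  finally show ?thesis .
qed

lemma vdm_cong: "(\<And>i. i \<in> A \<Longrightarrow> x i = y i) \<Longrightarrow> vdm x A = vdm y A"
  unfolding vdm_def by (intro prod.cong refl) auto

lemma vdm_Suc:
  assumes "k \<le> N"
  shows "vdm x {k..N} = (\<Prod>i\<in>{Suc k..N}. x k - x i) * vdm x {Suc k..N}"
proof -
  have ins: "{k..N} = insert k {Suc k..N}" using assms by auto
  show ?thesis unfolding ins by (subst vdm_insert) (auto intro!: arg_cong2[of _ _ _ _ "(*)"] prod.cong)
qed

text \<open>For every other index i, the two factors that pair i with k and with b have an unchanged
  product; only the factor pairing k with b changes its sign.\<close>

lemma vdm_transpose:
  fixes x :: "nat \<Rightarrow> 'a::comm_ring_1"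
  assumes b: "b \<in> {k..N}"
  shows "vdm (x \<circ> transpose k b) {k..N} = of_int (sign (transpose k b)) * vdm x {k..N}"
proof (cases "b = k")
  case False
  define A where "A = {k..N} - {k, b}"
  have A: "finite A" "k \<notin> A" "b \<notin> A" by (simp_all add: A_def)
  have lt: "k < i" if "i \<in> insert b A" for i using that b False by (auto simp: A_def)
  have ins: "{k..N} = insert k (insert b A)" using b by (auto simp: A_def)
  have V: "vdm y {k..N} = (y k - y b) * (\<Prod>i\<in>A. (y k - y i) * (if i < b then y i - y b else y b - y i)) * vdm y A" for y :: "nat \<Rightarrow> 'a"
  proof -
    have "vdm y {k..N} = (\<Prod>i\<in>insert b A. if i < k then y i - y k else y k - y i) * ((\<Prod>i\<in>A. if i < b then y i - y b else y b - y i) * vdm y A)"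
      unfolding ins using A False by (simp add: vdm_insert)
    also have "(\<Prod>i\<in>insert b A. if i < k then y i - y k else y k - y i) = (\<Prod>i\<in>insert b A. y k - y i)"
      using lt by (intro prod.cong) (auto dest: less_asym)
    finally show ?thesis using A by (simp add: prod.distrib mult_ac)
  qed
  have t: "transpose k b i = i" if "i \<in> A" for i using that A by (auto simp: transpose_def)
  have vA: "vdm (x \<circ> transpose k b) A = vdm x A" by (rule vdm_cong) (simp add: t)
  have "vdm (x \<circ> transpose k b) {k..N} = (x b - x k) * (\<Prod>i\<in>A. (x b - x i) * (if i < b then x i - x k else x k - x i)) * vdm x A"
  proof -
    have "(\<Prod>i\<in>A. ((x \<circ> transpose k b) k - (x \<circ> transpose k b) i) *
       (if i < b then (x \<circ> transpose k b) i - (x \<circ> transpose k b) b else (x \<circ> transpose k b) b - (x \<circ> transpose k b) i)) =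
      (\<Prod>i\<in>A. (x b - x i) * (if i < b then x i - x k else x k - x i))"
      by (intro prod.cong refl) (simp add: t)
    then show ?thesis unfolding V vA by simp
  qed
  also have "(\<Prod>i\<in>A. (x b - x i) * (if i < b then x i - x k else x k - x i)) = (\<Prod>i\<in>A. (x k - x i) * (if i < b then x i - x b else x b - x i))"
    by (intro prod.cong refl) (simp add: algebra_simps)
  also have "(x b - x k) * \<dots> * vdm x A = - vdm x {k..N}"
    unfolding V by (simp add: algebra_simps)
  finally show ?thesis using False by (simp add: sign_swap_id o_def)
qed simp

text \<open>The signed Vandermonde product of the minor, divided by the whole one, is the reciprocal
  of the denominator in \<open>lag_weight\<close>.\<close>

lemma vdm_column:
  fixes x :: "nat \<Rightarrow> 'a::comm_ring_1"
  assumes b: "b \<in> {k..N}"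
  shows "of_int (sign (transpose k b)) * vdm x {k..N} =
    (\<Prod>j\<in>{k..N} - {b}. x b - x j) * vdm (x \<circ> transpose k b) {Suc k..N}"
proof -
  have "of_int (sign (transpose k b)) * vdm x {k..N} = vdm (x \<circ> transpose k b) {k..N}"
    using vdm_transpose[OF b, of x] by simp
  also have "\<dots> = (\<Prod>i\<in>{Suc k..N}. x b - x (transpose k b i)) * vdm (x \<circ> transpose k b) {Suc k..N}"
    using b by (subst vdm_Suc) auto
  also have "(\<Prod>i\<in>{Suc k..N}. x b - x (transpose k b i)) = (\<Prod>j\<in>{k..N} - {b}. x b - x j)"
    by (rule prod.reindex_bij_witness[of _ "transpose k b" "transpose k b"])
       (use b in \<open>auto simp: transpose_def split: if_splits\<close>)
  finally show ?thesis .
qed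

section \<open>The determinant acting on a symmetric function\<close>

text \<open>The weights need a field, so the evaluation is carried out in the fraction field of
  \<open>mpoly poly\<close> and pulled back by injectivity of \<open>to_fract\<close>.\<close>

definition frac_const :: "mpoly \<Rightarrow> mpoly poly fract" where
  "frac_const a = to_fract [:a:]"

lemma frac_const_simps [simp]:
  "frac_const 0 = 0" "frac_const 1 = 1" "frac_const (a + b) = frac_const a + frac_const b"
  "frac_const (a - b) = frac_const a - frac_const b" "frac_const (- a) = - frac_const a"
  "frac_const (a * b) = frac_const a * frac_const b"
proof -
  have "[:a * b:] = [:a:] * [:b:]" "[:a + b:] = [:a:] + [:b:]" "[:a - b:] = [:a:] - [:b:]" "[:- a:] = - [:a:]" "[:1:] = (1 :: mpoly poly)"
    by (simp_all add: one_pCons)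
  then show "frac_const 0 = 0" "frac_const 1 = 1" "frac_const (a + b) = frac_const a + frac_const b"
    "frac_const (a - b) = frac_const a - frac_const b" "frac_const (- a) = - frac_const a"
    "frac_const (a * b) = frac_const a * frac_const b"
    unfolding frac_const_def by (simp_all only: to_fract_mult to_fract_add to_fract_diff to_fract_uminus to_fract_1)
      simp
qed

lemma frac_const_eq_iff [simp]: "frac_const a = frac_const b \<longleftrightarrow> a = b"
  by (simp add: frac_const_def)

lemma frac_const_eq_0_iff [simp]: "frac_const a = 0 \<longleftrightarrow> a = 0"
  by (simp add: frac_const_def)

lemma frac_const_sum: "frac_const (sum f A) = (\<Sum>a\<in>A. frac_const (f a))"
  by (induction A rule: infinite_finite_induct) simp_all

lemma frac_const_prod: "frac_const (prod f A) = (\<Prod>a\<in>A. frac_const (f a))"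
  by (induction A rule: infinite_finite_induct) simp_all

lemma frac_const_power: "frac_const (a ^ n) = frac_const a ^ n"
  by (induction n) simp_all

lemma to_fract_sum: "to_fract (sum f A) = (\<Sum>a\<in>A. to_fract (f a))"
  by (induction A rule: infinite_finite_induct) simp_all

lemma to_fract_of_nat [simp]: "to_fract (of_nat n) = of_nat n"
  by (induction n) simp_all

lemma to_fract_power: "to_fract (a ^ n) = to_fract a ^ n"
  by (induction n) simp_all

lemma to_fract_sign: "to_fract (of_int (sign p)) = of_int (sign p)"
  by (cases rule: sign_cases[of p]) simp_all

lemma to_fract_pochhammer: "to_fract (pochhammer z n) = pochhammer (to_fract z) n"
  by (induction n) (simp_all add: pochhammer_Suc)

lemma X_inj: "X i = X j \<longleftrightarrow> i = j"
proof
  assume "X i = X j"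
  then have "Poly_Mapping.keys (X i) = Poly_Mapping.keys (X j)" by simp
  then have "Poly_Mapping.single i (1::nat) = Poly_Mapping.single j 1" by simp
  then have "Poly_Mapping.lookup (Poly_Mapping.single i (1::nat)) i = Poly_Mapping.lookup (Poly_Mapping.single j 1) i" by simp
  then show "i = j" by (simp add: lookup_single when_def split: if_splits)
qed simp

lemma vdm_nonzero:
  fixes x :: "nat \<Rightarrow> 'a::idom"
  assumes "finite A" "inj_on x A"
  shows "vdm x A \<noteq> 0"
  using assms by (auto simp: vdm_def inj_on_def)

lemma euler_vdm_0:
  assumes "finite A" "r \<notin> \<rho> ` A"
  shows "euler r (vdm (X \<circ> \<rho>) A) = 0"
proof -
  have p: "euler r (prod f B) = 0" if "\<And>b. b \<in> B \<Longrightarrow> euler r (f b) = 0" for f :: "nat \<Rightarrow> mpoly" and B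
    using that by (induction B rule: infinite_finite_induct) (simp_all add: euler_mult)
  have "euler r (X (\<rho> i)) = 0" if "i \<in> A" for i
    using euler_X_power[of r "\<rho> i" 1] that assms(2) by auto
  then show ?thesis
    unfolding vdm_def by (intro p) (auto simp: euler_diff)
qed

lemma frac_const_euler_excl_sum:
  assumes r: "r \<in> {1..N}" "r \<notin> I" and I: "I \<subseteq> {1..N}" and f: "f \<in> deg_filt D"
  defines "e \<equiv> \<lambda>J. frac_const (excl_sum N D f J)" and "x \<equiv> \<lambda>i. frac_const (X i)"
  shows "frac_const (const alpha * euler r (excl_sum N D f I)) =
    e (insert r I) + (\<Sum>a\<in>I. (x r * e I - x a * e (insert r (I - {a}))) / (x a - x r))"
proof -
  obtain Z where Z: "const alpha * euler r (excl_sum N D f I) = excl_sum N D f (insert r I) + (\<Sum>a\<in>I. Z a)"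
    "\<And>a. a \<in> I \<Longrightarrow> (X a - X r) * Z a = X r * excl_sum N D f I - X a * excl_sum N D f (insert r (I - {a}))"
    using euler_excl_sum[OF r I f] by blast
  have "frac_const (Z a) = (x r * e I - x a * e (insert r (I - {a}))) / (x a - x r)" if a: "a \<in> I" for a
  proof -
    have "x a - x r \<noteq> 0" using a r(2) by (auto simp: x_def X_inj)
    moreover have "(x a - x r) * frac_const (Z a) = x r * e I - x a * e (insert r (I - {a}))"
      using arg_cong[OF Z(2)[OF a], of frac_const] by (simp add: x_def e_def)
    ultimately show ?thesis by (simp add: nonzero_eq_divide_eq mult.commute)
  qed
  then show ?thesis unfolding Z(1) by (simp add: frac_const_sum e_def)
qed

text \<open>Descending induction on k. All injective labellings are treated together because the
  expansion replaces \<open>\<rho>\<close> by \<open>\<rho> \<circ> transpose k b\<close>; the case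
  wanted is k = 1 with the identity.\<close>

lemma column_det_proj:
  assumes f: "f \<in> deg_filt D"
    and "1 \<le> k" "k \<le> Suc N" "inj_on \<rho> {k..N}" "\<rho> ` {k..N} \<subseteq> {1..N}"
  shows "column_det N k \<rho> [:proj N f:] = [:vdm (X \<circ> \<rho>) {k..N}:] * (\<Sum>I\<in>Pow (\<rho> ` {k..N}).
     (- 1) ^ card I * pochhammer ([:of_nat k - 1, 1:] + of_nat (card I)) (card (\<rho> ` {k..N}) - card I) * [:excl_sum N D f I:])"
  using assms(2-)
proof (induction "Suc N - k" arbitrary: k \<rho>)
  case 0
  then have k: "k = Suc N" by simp
  have "{p :: nat \<Rightarrow> nat. p permutes {}} = {id}" by (auto simp: permutes_empty)
  then show ?case by (simp add: k column_det_def vdm_def excl_sum_empty one_pCons)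
next
  case (Suc n)
  then have kN: "k \<le> N" by simp
  define S where "S = \<rho> ` {k..N}"
  define e where "e J = excl_sum N D f J" for J
  define v where "v = [:of_nat k - 1, 1 :: mpoly:]"
  have finS: "finite S" by (simp add: S_def)
  \<comment> \<open>Column k carries the power N - k, which is exactly the exponent in
    \<open>lag_weight\<close> for the remaining rows.\<close>
  have cardS: "card S - 1 = N - k" using card_image[OF Suc.prems(3)] by (simp add: S_def)
  \<comment> \<open>Passing to the next column adds 1 to the linear term; this is the
    \<open>v + 1\<close> in \<open>lagrange_exclusion_step\<close>.\<close>
  have v': "[:of_nat (Suc k) - 1, 1:] = v + 1" by (simp add: v_def one_pCons)
  define P where "P J = (- 1) ^ card J * pochhammer (v + 1 + of_nat (card J)) (card S - 1 - card J)" for J :: "nat set"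
  define V where "V b = vdm (X \<circ> (\<rho> \<circ> transpose k b)) {Suc k..N}" for b
  have step: "SD_factor N k (\<rho> b) (column_det N (Suc k) (\<rho> \<circ> transpose k b) [:proj N f:]) =
     [:X (\<rho> b) ^ (card S - 1) * V b:] * (\<Sum>I\<in>Pow (S - {\<rho> b}). P I * (v * [:e I:] - [:const alpha * euler (\<rho> b) (e I):]))"
    if b: "b \<in> {k..N}" for b
  proof -
    let ?\<rho> = "\<rho> \<circ> transpose k b"
    have tr: "transpose k b ` {Suc k..N} = {k..N} - {b}"
    proof (intro equalityI subsetI)
      fix i assume "i \<in> {k..N} - {b}"
      then show "i \<in> transpose k b ` {Suc k..N}"
        using b by (intro image_eqI[of _ _ "transpose k b i"]) (auto simp: transpose_def)
    qed (use b in \<open>auto simp: transpose_def split: if_splits\<close>)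
    have im: "?\<rho> ` {Suc k..N} = S - {\<rho> b}"
    proof -
      have "?\<rho> ` {Suc k..N} = \<rho> ` ({k..N} - {b})" by (simp only: image_comp[symmetric] tr)
      also have "\<dots> = S - {\<rho> b}"
        using Suc.prems(3) b by (simp add: S_def inj_on_image_set_diff[of _ "{k..N}"])
      finally show ?thesis .
    qed
    have inj: "inj_on ?\<rho> {Suc k..N}"
    proof (rule comp_inj_on)
      show "inj_on (transpose k b) {Suc k..N}" by (rule inj_on_subset[OF inj_transpose]) simp
      show "inj_on \<rho> (transpose k b ` {Suc k..N})" unfolding tr by (rule inj_on_subset[OF Suc.prems(3)]) auto
    qed
    have c1: "card (S - {\<rho> b}) = card S - 1" using b by (simp add: S_def)
    have IH: "column_det N (Suc k) ?\<rho> [:proj N f:] = [:V b:] * (\<Sum>I\<in>Pow (S - {\<rho> b}). P I * [:e I:])"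
    proof -
      have "n = Suc N - Suc k" "1 \<le> Suc k" "Suc k \<le> Suc N" using Suc.hyps(2) kN by auto
      moreover have "?\<rho> ` {Suc k..N} \<subseteq> {1..N}" unfolding im using Suc.prems(4) by (auto simp: S_def)
      ultimately show ?thesis
        using Suc.hyps(1)[of "Suc k" ?\<rho>, OF _ _ _ inj] unfolding im v' c1 P_def V_def e_def by blast
    qed
    \<comment> \<open>The minor omits row b, so its Vandermonde factor is constant for the Euler
      operator of that row; so are the coefficients \<open>P I\<close>. The operator therefore acts
      on the exclusion sums alone.\<close>
    have EV: "euler_coeffs (\<rho> b) [:V b:] = 0"
      using euler_vdm_0[of "{Suc k..N}" "\<rho> b" ?\<rho>] im unfolding V_def by (simp add: euler_coeffs_pCons)
    have Ev: "euler_coeffs (\<rho> b) v = 0" by (simp add: v_def)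
    then have EP: "euler_coeffs (\<rho> b) (P I) = 0" for I
      by (simp add: P_def euler_coeffs_mult euler_coeffs_pochhammer euler_coeffs_add)
    have Ee: "euler_coeffs (\<rho> b) [:e I:] = [:const alpha * euler (\<rho> b) (e I):]" for I
      by (simp add: euler_coeffs_pCons)
    have "v * ([:V b:] * (\<Sum>I\<in>Pow (S - {\<rho> b}). P I * [:e I:])) - euler_coeffs (\<rho> b) ([:V b:] * (\<Sum>I\<in>Pow (S - {\<rho> b}). P I * [:e I:])) =
      [:V b:] * (\<Sum>I\<in>Pow (S - {\<rho> b}). P I * (v * [:e I:] - [:const alpha * euler (\<rho> b) (e I):]))"
      unfolding euler_coeffs_mult EV euler_coeffs_sum EP Ee right_diff_distrib sum_subtractf
      by (simp only: mult_zero_left add_0 sum.neutral_const sum_distrib_left mult.left_commute)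
    then have "SD_factor N k (\<rho> b) (column_det N (Suc k) ?\<rho> [:proj N f:]) =
      [:X (\<rho> b) ^ (N - k):] * ([:V b:] * (\<Sum>I\<in>Pow (S - {\<rho> b}). P I * (v * [:e I:] - [:const alpha * euler (\<rho> b) (e I):])))"
      unfolding IH SD_factor_eq v_def[symmetric] by simp
    also have "[:X (\<rho> b) ^ (N - k):] * ([:V b:] * (\<Sum>I\<in>Pow (S - {\<rho> b}). P I * (v * [:e I:] - [:const alpha * euler (\<rho> b) (e I):]))) =
      ([:X (\<rho> b) ^ (N - k):] * [:V b:]) * (\<Sum>I\<in>Pow (S - {\<rho> b}). P I * (v * [:e I:] - [:const alpha * euler (\<rho> b) (e I):]))"
      by (rule mult.assoc[symmetric])
    also have "[:X (\<rho> b) ^ (N - k):] * [:V b:] = [:X (\<rho> b) ^ (card S - 1) * V b:]"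
      using cardS by simp
    finally show ?thesis .
  qed
  define x where "x i = frac_const (X i)" for i
  define E where "E J = frac_const (e J)" for J
  define w where "w = to_fract v"
  define W where "W = frac_const (vdm (X \<circ> \<rho>) {k..N})"
  have injx: "inj_on x S" by (simp add: inj_on_def x_def X_inj)
  \<comment> \<open>Sign, power and Vandermonde factor of the minor combine to a weight times the
    full Vandermonde factor, which leaves the determinant sum as in
    \<open>lagrange_exclusion_step\<close>.\<close>
  have weight: "of_int (sign (transpose k b)) * (x (\<rho> b) ^ (card S - 1) * frac_const (V b)) = W * lag_weight x S (\<rho> b)"
    if b: "b \<in> {k..N}" for b
  proof -
    define Q where "Q = (\<Prod>j\<in>{k..N} - {b}. X (\<rho> b) - X (\<rho> j))"
    have Q': "(\<Prod>j\<in>S - {\<rho> b}. x (\<rho> b) - x j) = frac_const Q"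
    proof -
      have "S - {\<rho> b} = \<rho> ` ({k..N} - {b})" 
        using Suc.prems(3) b by (simp add: S_def inj_on_image_set_diff[of _ "{k..N}"])
      moreover have "inj_on \<rho> ({k..N} - {b})" by (rule inj_on_subset[OF Suc.prems(3)]) auto
      ultimately show ?thesis by (simp add: Q_def x_def frac_const_prod prod.reindex)
    qed
    have Q0: "frac_const Q \<noteq> 0"
      unfolding Q'[symmetric] using finS injx b by (auto simp: inj_on_def S_def)
    have "of_int (sign (transpose k b)) * vdm (X \<circ> \<rho>) {k..N} = Q * V b"
      using vdm_column[OF b, of "X \<circ> \<rho>"] by (simp add: Q_def V_def comp_assoc)
    then have "frac_const (of_int (sign (transpose k b)) * vdm (X \<circ> \<rho>) {k..N}) = frac_const Q * frac_const (V b)" by simp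
    then have "of_int (sign (transpose k b)) * W = frac_const Q * frac_const (V b)"
      unfolding W_def by (cases rule: sign_cases[of "transpose k b"]) simp_all
    then have "frac_const (V b) = of_int (sign (transpose k b)) * W / frac_const Q"
      using Q0 by (simp add: nonzero_eq_divide_eq mult.commute)
    then show ?thesis unfolding lag_weight_def Q'
      by (cases rule: sign_cases[of "transpose k b"]) simp_all
  qed
  have "to_fract (column_det N k \<rho> [:proj N f:]) =
    (\<Sum>b\<in>{k..N}. W * (lag_weight x S (\<rho> b) * (\<Sum>I\<in>Pow (S - {\<rho> b}). to_fract (P I) * (w * E I - frac_const (const alpha * euler (\<rho> b) (e I))))))"
    unfolding column_det_Suc[OF kN] to_fract_sum
  proof (intro sum.cong refl)
    fix b assume b: "b \<in> {k..N}"
    have "to_fract (of_int (sign (transpose k b)) * SD_factor N k (\<rho> b) (column_det N (Suc k) (\<rho> \<circ> transpose k b) [:proj N f:])) =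
      of_int (sign (transpose k b)) * (x (\<rho> b) ^ (card S - 1) * frac_const (V b)) *
      (\<Sum>I\<in>Pow (S - {\<rho> b}). to_fract (P I) * (w * E I - frac_const (const alpha * euler (\<rho> b) (e I))))"
      unfolding step[OF b] to_fract_mult to_fract_sum to_fract_diff frac_const_def[symmetric] E_def[symmetric] w_def[symmetric]
        to_fract_sign frac_const_simps frac_const_power x_def by (simp only: mult.assoc)
    then show "to_fract (of_int (sign (transpose k b)) * SD_factor N k (\<rho> b) (column_det N (Suc k) (\<rho> \<circ> transpose k b) [:proj N f:])) =
      W * (lag_weight x S (\<rho> b) * (\<Sum>I\<in>Pow (S - {\<rho> b}). to_fract (P I) * (w * E I - frac_const (const alpha * euler (\<rho> b) (e I)))))"
      unfolding weight[OF b] by (simp only: mult.assoc)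
  qed
  also have "\<dots> = W * (\<Sum>r\<in>S. lag_weight x S r * (\<Sum>I\<in>Pow (S - {r}). to_fract (P I) * (w * E I - frac_const (const alpha * euler r (e I)))))"
    unfolding S_def sum.reindex[OF Suc.prems(3)] sum_distrib_left[symmetric] by (simp only: o_def)
  also have "(\<Sum>r\<in>S. lag_weight x S r * (\<Sum>I\<in>Pow (S - {r}). to_fract (P I) * (w * E I - frac_const (const alpha * euler r (e I))))) =
    (\<Sum>r\<in>S. lag_weight x S r * (\<Sum>I\<in>Pow (S - {r}). (- 1) ^ card I * pochhammer (w + 1 + of_nat (card I)) (card S - 1 - card I) *
      (w * E I - (E (insert r I) + (\<Sum>a\<in>I. (x r * E I - x a * E (insert r (I - {a}))) / (x a - x r))))))"
  proof (intro sum.cong refl arg_cong2[of _ _ _ _ "(*)"])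
    fix r I assume r: "r \<in> S" and I: "I \<in> Pow (S - {r})"
    show "to_fract (P I) = (- 1) ^ card I * pochhammer (w + 1 + of_nat (card I)) (card S - 1 - card I)"
      by (simp add: P_def to_fract_power to_fract_pochhammer w_def)
    have SN: "S \<subseteq> {1..N}" using Suc.prems(4) by (simp add: S_def)
    have "frac_const (const alpha * euler r (e I)) = E (insert r I) + (\<Sum>a\<in>I. (x r * E I - x a * E (insert r (I - {a}))) / (x a - x r))"
      unfolding E_def e_def x_def using r I SN by (intro frac_const_euler_excl_sum[OF _ _ _ f]) auto
    then show "w * E I - frac_const (const alpha * euler r (e I)) =
       w * E I - (E (insert r I) + (\<Sum>a\<in>I. (x r * E I - x a * E (insert r (I - {a}))) / (x a - x r)))" by simp
  qed
  also have "\<dots> = (\<Sum>I\<in>Pow S. (- 1) ^ card I * pochhammer (w + of_nat (card I)) (card S - card I) * E I)"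
    using kN by (intro lagrange_exclusion_step[OF finS injx]) (simp add: S_def)
  also have "W * \<dots> = to_fract ([:vdm (X \<circ> \<rho>) {k..N}:] * (\<Sum>I\<in>Pow S. (- 1) ^ card I * pochhammer (v + of_nat (card I)) (card S - card I) * [:e I:]))"
    by (simp only: to_fract_mult to_fract_sum to_fract_power to_fract_pochhammer to_fract_add to_fract_of_nat to_fract_uminus to_fract_1
      W_def w_def E_def frac_const_def)
  finally show ?case unfolding to_fract_eq_iff by (simp only: S_def v_def e_def)
qed

section \<open>The operators at infinity\<close>

lemma deg_filt_mono: "d \<le> e \<Longrightarrow> deg_filt d \<subseteq> deg_filt e"
  unfolding deg_filt_def by (rule symfun.span_mono) auto

definition adjoint_sum_terms :: "nat \<Rightarrow> symfun \<Rightarrow> nat multiset set" where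
  "adjoint_sum_terms k f = {\<mu>. is_partition \<mu> \<and> size \<mu> = k \<and> monomial_sym \<mu> * adjoint_op (monomial_sym \<mu>) f \<noteq> 0}"

definition adjoint_sum_op :: "nat \<Rightarrow> symfun \<Rightarrow> symfun" where
  "adjoint_sum_op k f = (- 1) ^ k *
    (\<Sum>\<mu>\<in>adjoint_sum_terms k f. of_nat (c_part \<mu>) * monomial_sym \<mu> * adjoint_op (monomial_sym \<mu>) f)"

lemma adjoint_sum_terms_subset:
  assumes "f \<in> deg_filt D"
  shows "adjoint_sum_terms k f \<subseteq> {\<mu>. is_partition \<mu> \<and> size \<mu> = k \<and> set_mset \<mu> \<subseteq> {..D}}"
proof
  fix \<mu> assume \<mu>: "\<mu> \<in> adjoint_sum_terms k f"
  then have p: "is_partition \<mu>" "size \<mu> = k" by (simp_all add: adjoint_sum_terms_def)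
  have "sum_mset \<mu> \<le> D"
  proof (rule ccontr)
    assume "\<not> sum_mset \<mu> \<le> D"
    then have "adjoint_op (monomial_sym \<mu>) f = 0"
      using adjoint_aug_monomial_vanish[OF assms p(1)] by (simp add: monomial_sym_eq adjoint_op_scale_left)
    with \<mu> show False by (simp add: adjoint_sum_terms_def)
  qed
  moreover have "x \<le> sum_mset \<mu>" if "x \<in># \<mu>" for x
  proof -
    have "sum_mset \<mu> = x + sum_mset (\<mu> - {#x#})" using that by (metis insert_DiffM sum_mset.add_mset)
    then show ?thesis by simp
  qed
  ultimately show "\<mu> \<in> {\<mu>. is_partition \<mu> \<and> size \<mu> = k \<and> set_mset \<mu> \<subseteq> {..D}}"
    using p by (auto intro: order_trans)
qed

lemma finite_adjoint_sum_terms: "finite (adjoint_sum_terms k f)"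
  using ex_deg_filt[of f] adjoint_sum_terms_subset finite_partitions_box by (meson finite_subset)

text \<open>The set of nonvanishing terms varies with f. The partitions with parts at most D form an
  index set common to all of \<open>deg_filt D\<close>, as linearity and the comparison with
  exclusion sums require.\<close>

lemma adjoint_sum_op_eq:
  assumes "f \<in> deg_filt D"
  shows "adjoint_sum_op k f = (- 1) ^ k *
    (\<Sum>\<mu> | is_partition \<mu> \<and> size \<mu> = k \<and> set_mset \<mu> \<subseteq> {..D}. of_nat (c_part \<mu>) * monomial_sym \<mu> * adjoint_op (monomial_sym \<mu>) f)"
  unfolding adjoint_sum_op_def
  by (intro arg_cong2[of _ _ _ _ "(*)"] refl sum.mono_neutral_left finite_partitions_box adjoint_sum_terms_subset[OF assms])
     (auto simp: adjoint_sum_terms_def mult.assoc)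

lemma linear_adjoint_sum_op: "Vector_Spaces.linear scale scale (adjoint_sum_op k)"
  unfolding linear_symfun_iff
proof (intro conjI allI)
  fix f g
  obtain d e where "f \<in> deg_filt d" "g \<in> deg_filt e" using ex_deg_filt by metis
  then have fg: "f \<in> deg_filt (max d e)" "g \<in> deg_filt (max d e)"
    using deg_filt_mono[of d "max d e"] deg_filt_mono[of e "max d e"] by auto
  then have "f + g \<in> deg_filt (max d e)" by (simp add: deg_filt_def symfun.span_add)
  then show "adjoint_sum_op k (f + g) = adjoint_sum_op k f + adjoint_sum_op k g"
    using fg by (simp add: adjoint_sum_op_eq adjoint_op_add distrib_left sum.distrib)
next
  fix c f
  obtain d where f: "f \<in> deg_filt d" using ex_deg_filt by metis
  then have "scale c f \<in> deg_filt d" by (simp add: deg_filt_def symfun.span_scale)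
  then show "adjoint_sum_op k (scale c f) = scale c (adjoint_sum_op k f)"
    using f by (simp add: adjoint_sum_op_eq adjoint_op_scale scale_mult_right symfun.scale_sum_right[symmetric])
qed

lemma proj_uminus_power: "proj N ((- 1) ^ k * f) = (- 1) ^ k * proj N f"
  by (simp add: proj_power)

lemma proj_adjoint_sum_op:
  assumes "f \<in> deg_filt D"
  shows "proj N (adjoint_sum_op k f) = (- 1) ^ k * (\<Sum>I | I \<subseteq> {1..N} \<and> card I = k. excl_sum N D f I)"
  unfolding adjoint_sum_op_eq[OF assms] proj_uminus_power sum_excl_sum ..

section \<open>Expansion in reciprocals of shifted factorials\<close>

lemma u_frac_eq: "u_frac = to_fract [:0, 1:]"
  by (simp add: u_frac_def to_fract_def)

lemma u_frac_add: "u_frac + of_nat i = to_fract [:of_nat i, 1:]"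
proof -
  have "[:0, 1:] + of_nat i = [:of_nat i, 1 :: mpoly:]" by (simp add: of_nat_poly)
  then show ?thesis unfolding u_frac_eq by (metis to_fract_add to_fract_of_nat)
qed

lemma pochhammer_u_frac_nonzero: "pochhammer u_frac k \<noteq> 0"
  by (simp add: pochhammer_prod u_frac_add)

lemma SD_op_proj:
  assumes f: "f \<in> deg_filt D"
  shows "SD_op N (proj N f) = (\<Sum>I\<in>Pow {1..N}. (- 1) ^ card I *
    pochhammer (u_frac + of_nat (card I)) (N - card I) * frac_const (excl_sum N D f I))"
proof -
  have "vandermonde N \<noteq> 0"
    unfolding vandermonde_eq_vdm by (rule vdm_nonzero) (auto simp: inj_on_def X_inj)
  then have V: "frac_const (vandermonde N) \<noteq> 0" by simp
  have "column_det N 1 id [:proj N f:] = [:vandermonde N:] * (\<Sum>I\<in>Pow {1..N}.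
     (- 1) ^ card I * pochhammer ([:0, 1:] + of_nat (card I)) (N - card I) * [:excl_sum N D f I:])"
    using column_det_proj[OF f, of 1 N id] by (simp add: vandermonde_eq_vdm)
  then have "to_fract (column_det N 1 id [:proj N f:]) = frac_const (vandermonde N) * (\<Sum>I\<in>Pow {1..N}. (- 1) ^ card I *
    pochhammer (u_frac + of_nat (card I)) (N - card I) * frac_const (excl_sum N D f I))"
    by (simp only: to_fract_mult to_fract_sum to_fract_power to_fract_pochhammer to_fract_add to_fract_of_nat
        to_fract_uminus to_fract_1 frac_const_def u_frac_eq)
  then show ?thesis
    unfolding SD_op_eq frac_const_def[symmetric] using V by simp
qed

text \<open>After grouping subsets by cardinality k, the quotient of (u+k)_(N-k) by (u)_N is 1 /
  (u)_k.\<close>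

lemma SD_op_expansion:
  "SD_op N (proj N f) / pochhammer u_frac N =
    (\<Sum>k\<le>N. Fract [:proj N (adjoint_sum_op k f):] 1 / pochhammer u_frac k)"
proof -
  obtain D where f: "f \<in> deg_filt D" using ex_deg_filt by metis
  have quot: "pochhammer (u_frac + of_nat k) (N - k) / pochhammer u_frac N = 1 / pochhammer u_frac k" if "k \<le> N" for k
    using pochhammer_product[OF that, of u_frac] pochhammer_u_frac_nonzero[of N] by (simp add: divide_simps)
  have "SD_op N (proj N f) = (\<Sum>k\<le>N. \<Sum>I | I \<in> Pow {1..N} \<and> card I = k. (- 1) ^ card I *
    pochhammer (u_frac + of_nat (card I)) (N - card I) * frac_const (excl_sum N D f I))"
    unfolding SD_op_proj[OF f]
    by (rule sum.group[symmetric]) (use card_mono[of "{1..N}"] in auto)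
  also have "\<dots> = (\<Sum>k\<le>N. pochhammer (u_frac + of_nat k) (N - k) * frac_const (proj N (adjoint_sum_op k f)))"
  proof (intro sum.cong refl)
    fix k
    have "frac_const (proj N (adjoint_sum_op k f)) = (\<Sum>I | I \<in> Pow {1..N} \<and> card I = k. (- 1) ^ k * frac_const (excl_sum N D f I))"
      unfolding proj_adjoint_sum_op[OF f] by (simp add: frac_const_power frac_const_sum sum_distrib_left)
    then show "(\<Sum>I | I \<in> Pow {1..N} \<and> card I = k. (- 1) ^ card I *
      pochhammer (u_frac + of_nat (card I)) (N - card I) * frac_const (excl_sum N D f I)) =
      pochhammer (u_frac + of_nat k) (N - k) * frac_const (proj N (adjoint_sum_op k f))"
      by (simp add: sum_distrib_left mult_ac)
  qed
  finally have "SD_op N (proj N f) / pochhammer u_frac N =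
    (\<Sum>k\<le>N. frac_const (proj N (adjoint_sum_op k f)) * (pochhammer (u_frac + of_nat k) (N - k) / pochhammer u_frac N))"
    by (simp add: sum_divide_distrib mult.commute)
  also have "\<dots> = (\<Sum>k\<le>N. Fract [:proj N (adjoint_sum_op k f):] 1 / pochhammer u_frac k)"
    by (intro sum.cong refl) (simp add: quot frac_const_def to_fract_def)
  finally show ?thesis .
qed

text \<open>The last product is empty and all others share the factor of largest index. At the root
  of that factor only the last coefficient survives; then the factor is cancelled.\<close>

lemma rising_products_independent:
  fixes c :: "nat \<Rightarrow> 'a::idom"
  assumes "(\<Sum>k\<le>N. [:c k:] * (\<Prod>i\<in>{k..<N}. [:of_nat i, 1:])) = 0" "k \<le> N"
  shows "c k = 0"
  using assms
proof (induction N arbitrary: k)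
  case (Suc N)
  have "(\<Sum>k\<le>N. [:c k:] * (\<Prod>i\<in>{k..<Suc N}. [:of_nat i, 1:])) = [:of_nat N, 1:] * (\<Sum>k\<le>N. [:c k:] * (\<Prod>i\<in>{k..<N}. [:of_nat i, 1:]))"
    unfolding sum_distrib_left by (intro sum.cong refl) (simp add: mult_ac)
  then have eq: "[:of_nat N, 1:] * (\<Sum>k\<le>N. [:c k:] * (\<Prod>i\<in>{k..<N}. [:of_nat i, 1:])) + [:c (Suc N):] = 0"
    using Suc.prems(1) by simp
  have c: "c (Suc N) = 0"
    using arg_cong[OF eq, of "\<lambda>p. poly p (- of_nat N)"] by simp
  then have "(\<Sum>k\<le>N. [:c k:] * (\<Prod>i\<in>{k..<N}. [:of_nat i, 1:])) = 0"
    using eq by (simp only: pCons_0_0 add_0_right mult_eq_0_iff pCons_eq_0_iff one_neq_zero simp_thms)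
  then show ?case using Suc.IH[of k] Suc.prems(2) c by (cases "k = Suc N") simp_all
qed simp

text \<open>Multiplication by (u)_N turns 1 / (u)_k into the product of u + i over k \<le> i < N,
  which reduces uniqueness to polynomials in u.\<close>

lemma SD_expansion_unique:
  assumes eq: "(\<Sum>k\<le>N. Fract [:a k:] 1 / pochhammer u_frac k) = (\<Sum>k\<le>N. Fract [:b k:] 1 / pochhammer u_frac k)"
    and k: "k \<le> N"
  shows "a k = b k"
proof -
  have "to_fract ([:a k - b k:] * (\<Prod>i\<in>{k..<N}. [:of_nat i, 1:])) =
     pochhammer u_frac N * (Fract [:a k:] 1 / pochhammer u_frac k - Fract [:b k:] 1 / pochhammer u_frac k)" if "k \<le> N" for k
  proof -
    have "pochhammer u_frac N = pochhammer u_frac k * to_fract (\<Prod>i\<in>{k..<N}. [:of_nat i, 1:])"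
    proof -
      have tp: "to_fract (prod h A) = (\<Prod>i\<in>A. to_fract (h i))" for h :: "nat \<Rightarrow> mpoly poly" and A
        by (induction A rule: infinite_finite_induct) simp_all
      have "{0..<N} = {0..<k} \<union> {k..<N}" using that by auto
      then show ?thesis
        by (simp add: pochhammer_prod u_frac_add tp prod.union_disjoint)
    qed
    moreover have "to_fract [:a k - b k:] = Fract [:a k:] 1 - Fract [:b k:] 1"
      using frac_const_simps(4)[of "a k" "b k"] by (simp add: frac_const_def to_fract_def)
    ultimately show ?thesis
      unfolding to_fract_mult using pochhammer_u_frac_nonzero[of k] by (simp add: field_simps)
  qed
  then have "to_fract (\<Sum>k\<le>N. [:a k - b k:] * (\<Prod>i\<in>{k..<N}. [:of_nat i, 1:])) =
    (\<Sum>k\<le>N. pochhammer u_frac N * (Fract [:a k:] 1 / pochhammer u_frac k - Fract [:b k:] 1 / pochhammer u_frac k))"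
    unfolding to_fract_sum by (intro sum.cong refl) simp
  also have "\<dots> = 0"
    using eq by (simp only: sum_distrib_left[symmetric] sum_subtractf) simp
  finally have "(\<Sum>k\<le>N. [:a k - b k:] * (\<Prod>i\<in>{k..<N}. [:of_nat i, 1:])) = 0"
    by (simp only: to_fract_eq_0_iff)
  from rising_products_independent[OF this k] show ?thesis by simp
qed

lemma SD_coeff_proj: "SD_coeff k N (proj N f) = proj N (adjoint_sum_op k f)"
proof -
  let ?a = "\<lambda>k. proj N (adjoint_sum_op k f)"
  have "SD_coeffs N (proj N f) = ?a"
    unfolding SD_coeffs_def
  proof (rule the_equality)
    obtain D where f: "f \<in> deg_filt D" using ex_deg_filt by metis
    have "?a k = 0" if "k > N" for k
    proof -
      have "\<not> (I \<subseteq> {1..N} \<and> card I = k)" for I using card_mono[of "{1..N}" I] that by auto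
      then have "{I. I \<subseteq> {1..N} \<and> card I = k} = {}" by blast
      then show ?thesis by (simp only: proj_adjoint_sum_op[OF f] sum.empty mult_zero_right)
    qed
    moreover have "?a k \<in> sym_polys N" for k using proj_seq[of "adjoint_sum_op k f"] by (simp add: proj_def)
    ultimately show a: "(\<forall>k. ?a k \<in> sym_polys N) \<and> (\<forall>k>N. ?a k = 0) \<and>
      SD_op N (proj N f) / pochhammer u_frac N = (\<Sum>k\<le>N. Fract [:?a k:] 1 / pochhammer u_frac k)"
      by (intro conjI allI impI SD_op_expansion)
    fix b assume b: "(\<forall>k. b k \<in> sym_polys N) \<and> (\<forall>k>N. b k = 0) \<and>
      SD_op N (proj N f) / pochhammer u_frac N = (\<Sum>k\<le>N. Fract [:b k:] 1 / pochhammer u_frac k)"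
    show "b = ?a"
    proof
      fix k
      show "b k = ?a k"
      proof (cases "k \<le> N")
        case True
        then show ?thesis using a b by (intro SD_expansion_unique[of b N ?a]) auto
      next
        case False
        then show ?thesis using a b by simp
      qed
    qed
  qed
  then show ?thesis by (simp add: SD_coeff_def)
qed

text \<open>The operators at infinity are specified for N \<ge> 1; component 0 is the image of
  component 1 under \<open>rho\<close>.\<close>

lemma proj_ext_pos:
  assumes "\<And>N. N \<ge> 1 \<Longrightarrow> proj N f = proj N g"
  shows "f = g"
proof (rule proj_ext)
  fix N
  have "proj 0 h = rho 1 (proj 1 h)" for h using proj_seq[of h] by (simp add: proj_def)
  then show "proj N f = proj N g" using assms by (cases "N = 0") simp_all
qed

text \<open>The specification fixes every projection, and projections separate elements. That an
  operator at infinity exists comes out of the formula, which is one element of \<Lambda> projecting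
  to all finite coefficients.\<close>

lemma SD_infinity_eq: "SD_infinity k = adjoint_sum_op k"
  unfolding SD_infinity_def
proof (rule the_equality)
  fix A assume A: "Vector_Spaces.linear scale scale A \<and> (\<forall>N\<ge>1. \<forall>f. proj N (A f) = SD_coeff k N (proj N f))"
  show "A = adjoint_sum_op k"
  proof
    fix f show "A f = adjoint_sum_op k f" by (rule proj_ext_pos) (simp add: A SD_coeff_proj)
  qed
qed (simp add: linear_adjoint_sum_op SD_coeff_proj)

theorem mainTheorem2:
  fixes k :: nat and f :: symfun
  assumes "k \<ge> 1"
  shows "finite {\<mu>. is_partition \<mu> \<and> size \<mu> = k \<and> monomial_sym \<mu> * adjoint_op (monomial_sym \<mu>) f \<noteq> 0}
    \<and> SD_infinity k f =
        (- 1) ^ k *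
        (\<Sum>\<mu> | is_partition \<mu> \<and> size \<mu> = k \<and> monomial_sym \<mu> * adjoint_op (monomial_sym \<mu>) f \<noteq> 0.
           of_nat (c_part \<mu>) * monomial_sym \<mu> * adjoint_op (monomial_sym \<mu>) f)"
  using finite_adjoint_sum_terms[of k f] unfolding SD_infinity_eq adjoint_sum_op_def adjoint_sum_terms_def by (intro conjI refl)

end
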